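(* Let $m\ge 2$ be an integer, $j=2$ and $N=m+2$. Let $\Omega=\Omega_1\times\Omega_2\subset\mathbb{R}^N$, where $\Omega_1\subset\mathbb{R}^m$ is a bounded open set of class $C^1$ and $\Omega_2\subset\mathbb{R}^2$ is a ball of radius $R>0$ centered at the origin. Let $G$ be a compact subgroup of the orthogonal group $\mathcal{O}(m)$ acting on $\Omega_1$ (so $\Omega_1$ is $G$-invariant), and suppose that $k=\min_{x\in\overline{\Omega_1}}\dim O^x_G$ satisfies $k\ge 1$. Let $l>0$ be a real number and let $h(x_1,x_2)=\Vert x_2\Vert^l$ for $(x_1,x_2)\in\Omega_1\times\Omega_2$. Then the embedding $H^1_{s,G}(\Omega)\hookrightarrow L^q_h(\Omega)$ is compact for every $q\in(1,2^*_k+\psi)$, where $$2^*_k=\frac{2(N-k)}{N-k-2},\qquad \psi=-\frac{2k(N-k)}{m(m-k)(m-k+1)}+\frac{2(m+1)}{m(m-k+1)}\min\left\{l,\frac{1}{m-k}\right\}.$$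
   Context: Points of $\Omega=\Omega_1\times\Omega_2$ are written $x=(x_1,x_2)$ with $x_1\in\Omega_1$, $x_2\in\Omega_2$; $\Vert\cdot\Vert$ is the Euclidean norm. For $x\in\mathbb{R}^m$, $O^x_G=\{gx: g\in G\}$ is the orbit of $x$ under $G$ (a compact submanifold, whose dimension is $\dim O^x_G$). $H^1_s(\Omega)=\{u\in H^1_0(\Omega): u(x_1,x_2)=u(x_1,\Vert x_2\Vert)\ \forall x_2\in\Omega_2\}$, i.e. the functions in $H^1_0(\Omega)$ that are radially symmetric in the variable $x_2$. $H^1_{s,G}(\Omega)=\{u\in H^1_s(\Omega): u(gx_1,x_2)=u(x_1,x_2)\ \forall g\in G\}$, with the norm of $H^1_0(\Omega)$. For a nonnegative Hölder continuous function $h$ on $\overline{\Omega}$, $L^q_h(\Omega)$ is the weighted Lebesgue space with norm $\Vert u\Vert_{L^q_h(\Omega)}=\left(\int_\Omega h|u|^q\right)^{1/q}$. *)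

theory Defs
  imports "HOL-Analysis.Analysis"
begin

section \<open>Functions of class \<open>C\<^sup>n\<close>, open sets of class \<open>C\<^sup>1\<close>, submanifolds\<close>

text \<open>Only meant for open \<open>S\<close>. In finite dimension, continuity of all directional derivatives
  of a differentiable function is continuity of the derivative.\<close>

primrec Ck_on :: "nat \<Rightarrow> 'a::euclidean_space set \<Rightarrow> ('a \<Rightarrow> 'b::euclidean_space) \<Rightarrow> bool" where
  "Ck_on 0 S f \<longleftrightarrow> continuous_on S f"
| "Ck_on (Suc n) S f \<longleftrightarrow>
     (\<forall>x\<in>S. f differentiable (at x)) \<and>
     (\<forall>v. Ck_on n S (\<lambda>x. frechet_derivative f (at x) v))"

definition smooth_on :: "'a::euclidean_space set \<Rightarrow> ('a \<Rightarrow> 'b::euclidean_space) \<Rightarrow> bool" where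
  "smooth_on S f \<longleftrightarrow> (\<forall>n. Ck_on n S f)"

text \<open>Near each boundary point, \<open>S\<close> is the part lying above the graph of a \<open>C\<^sup>1\<close> function
  \<open>\<gamma>\<close>, after a rotation of the axes. The unit vector \<open>e\<close> is the upward direction; the graph
  function is evaluated only at the orthogonal projection of \<open>y\<close> to the hyperplane \<open>e\<^sup>\<bottom>\<close>.\<close>

definition C1_open_set :: "'a::euclidean_space set \<Rightarrow> bool" where
  "C1_open_set S \<longleftrightarrow> open S \<and>
     (\<forall>p \<in> frontier S. \<exists>r>0. \<exists>e (\<gamma> :: 'a \<Rightarrow> real). norm e = 1 \<and> Ck_on 1 UNIV \<gamma> \<and>
        S \<inter> ball p r = {y \<in> ball p r. y \<bullet> e > \<gamma> (y - (y \<bullet> e) *\<^sub>R e)})"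

text \<open>Smooth embedded submanifolds of a Euclidean space, by local flattening to a linear subspace
  \<open>L\<close>. For nonempty \<open>S\<close> the dimension \<open>d\<close> is unique.\<close>

definition submanifold_of_dim :: "nat \<Rightarrow> 'a::euclidean_space set \<Rightarrow> bool" where
  "submanifold_of_dim d S \<longleftrightarrow>
     (\<forall>p\<in>S. \<exists>U V (\<Phi> :: 'a \<Rightarrow> 'a) \<Psi> L.
        open U \<and> p \<in> U \<and> open V \<and> homeomorphism U V \<Phi> \<Psi> \<and> smooth_on U \<Phi> \<and> smooth_on V \<Psi> \<and>
        subspace L \<and> dim L = d \<and> \<Phi> ` (S \<inter> U) = L \<inter> V)"


section \<open>Compact groups of orthogonal matrices and their orbits\<close>

definition compact_orthogonal_group :: "(real^'m^'m) set \<Rightarrow> bool" where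
  "compact_orthogonal_group G \<longleftrightarrow>
     compact G \<and> (\<forall>g\<in>G. orthogonal_matrix g) \<and>
     mat 1 \<in> G \<and> (\<forall>g\<in>G. \<forall>g'\<in>G. g ** g' \<in> G) \<and> (\<forall>g\<in>G. matrix_inv g \<in> G)"

definition orbit :: "(real^'m^'m) set \<Rightarrow> real^'m \<Rightarrow> (real^'m) set" where
  "orbit G x = (\<lambda>g. g *v x) ` G"

definition orbit_dim :: "(real^'m^'m) set \<Rightarrow> real^'m \<Rightarrow> nat" where
  "orbit_dim G x = (THE d. submanifold_of_dim d (orbit G x))"


section \<open>Function spaces\<close>

text \<open>The elements of the spaces below are functions, not classes modulo a.e. equality, so the
  norms are seminorms whose kernel consists of the functions vanishing a.e.\<close>

definition test_functions :: "'a::euclidean_space set \<Rightarrow> ('a \<Rightarrow> real) set" where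
  "test_functions \<Omega> =
     {\<phi>. smooth_on UNIV \<phi> \<and> compact (closure {x. \<phi> x \<noteq> 0}) \<and> closure {x. \<phi> x \<noteq> 0} \<subseteq> \<Omega>}"

definition L2_on :: "'a::euclidean_space set \<Rightarrow> ('a \<Rightarrow> 'b::euclidean_space) set" where
  "L2_on \<Omega> = {u \<in> borel_measurable (lebesgue_on \<Omega>).
     integrable (lebesgue_on \<Omega>) (\<lambda>x. (norm (u x))\<^sup>2)}"

definition has_weak_gradient ::
  "'a::euclidean_space set \<Rightarrow> ('a \<Rightarrow> real) \<Rightarrow> ('a \<Rightarrow> 'a) \<Rightarrow> bool" where
  "has_weak_gradient \<Omega> u v \<longleftrightarrow>
     (\<forall>\<phi> \<in> test_functions \<Omega>. \<forall>b \<in> Basis.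
        (\<integral>x. u x * frechet_derivative \<phi> (at x) b \<partial>lebesgue_on \<Omega>) =
        - (\<integral>x. (v x \<bullet> b) * \<phi> x \<partial>lebesgue_on \<Omega>))"

definition H1 :: "'a::euclidean_space set \<Rightarrow> ('a \<Rightarrow> real) set" where
  "H1 \<Omega> = {u \<in> L2_on \<Omega>. \<exists>v \<in> L2_on \<Omega>. has_weak_gradient \<Omega> u v}"

text \<open>For \<open>u\<close> in \<open>H1 \<Omega>\<close> the weak gradient is unique up to a.e. equality.\<close>

definition weak_gradient :: "'a::euclidean_space set \<Rightarrow> ('a \<Rightarrow> real) \<Rightarrow> 'a \<Rightarrow> 'a" where
  "weak_gradient \<Omega> u = (SOME v. v \<in> L2_on \<Omega> \<and> has_weak_gradient \<Omega> u v)"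

definition H1_norm :: "'a::euclidean_space set \<Rightarrow> ('a \<Rightarrow> real) \<Rightarrow> real" where
  "H1_norm \<Omega> u = sqrt ((\<integral>x. (u x)\<^sup>2 \<partial>lebesgue_on \<Omega>) +
                        (\<integral>x. (norm (weak_gradient \<Omega> u x))\<^sup>2 \<partial>lebesgue_on \<Omega>))"

definition H10 :: "'a::euclidean_space set \<Rightarrow> ('a \<Rightarrow> real) set" where
  "H10 \<Omega> = {u \<in> H1 \<Omega>. \<exists>\<phi>. (\<forall>n::nat. \<phi> n \<in> test_functions \<Omega>) \<and>
     (\<lambda>n. H1_norm \<Omega> (\<lambda>x. u x - \<phi> n x)) \<longlonglongrightarrow> 0}"

text \<open>The symmetries are required a.e., as is appropriate for elements of \<open>H10\<close>.\<close>

definition H1s ::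
  "('a::euclidean_space \<times> 'b::euclidean_space) set \<Rightarrow> ('a \<times> 'b \<Rightarrow> real) set" where
  "H1s \<Omega> = {u \<in> H10 \<Omega>. \<exists>w :: 'a \<Rightarrow> real \<Rightarrow> real.
     AE x in lebesgue_on \<Omega>. u x = w (fst x) (norm (snd x))}"

definition H1sG ::
  "(real^'m^'m) set \<Rightarrow> ((real^'m) \<times> 'b::euclidean_space) set \<Rightarrow> ((real^'m) \<times> 'b \<Rightarrow> real) set" where
  "H1sG G \<Omega> = {u \<in> H1s \<Omega>. \<forall>g\<in>G. AE x in lebesgue_on \<Omega>. u (g *v fst x, snd x) = u x}"

definition weighted_Lq ::
  "('a::euclidean_space \<Rightarrow> real) \<Rightarrow> real \<Rightarrow> 'a set \<Rightarrow> ('a \<Rightarrow> real) set" where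
  "weighted_Lq h q \<Omega> = {u \<in> borel_measurable (lebesgue_on \<Omega>).
     integrable (lebesgue_on \<Omega>) (\<lambda>x. h x * \<bar>u x\<bar> powr q)}"

definition weighted_Lq_norm ::
  "('a::euclidean_space \<Rightarrow> real) \<Rightarrow> real \<Rightarrow> 'a set \<Rightarrow> ('a \<Rightarrow> real) \<Rightarrow> real" where
  "weighted_Lq_norm h q \<Omega> u = (\<integral>x. h x * \<bar>u x\<bar> powr q \<partial>lebesgue_on \<Omega>) powr (1 / q)"

text \<open>The inclusion of \<open>V\<close> (with seminorm \<open>nV\<close>) into \<open>W\<close> (with seminorm \<open>nW\<close>) is defined,
  continuous, injective modulo the kernels of the seminorms, and maps bounded sequences to
  sequences with a subsequence converging in \<open>W\<close>.\<close>

definition compactly_embedded ::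
  "('a \<Rightarrow> real) set \<Rightarrow> (('a \<Rightarrow> real) \<Rightarrow> real) \<Rightarrow> ('a \<Rightarrow> real) set \<Rightarrow> (('a \<Rightarrow> real) \<Rightarrow> real) \<Rightarrow> bool"
where
  "compactly_embedded V nV W nW \<longleftrightarrow>
     V \<subseteq> W \<and> (\<exists>C. \<forall>u\<in>V. nW u \<le> C * nV u) \<and> (\<forall>u\<in>V. nW u = 0 \<longrightarrow> nV u = 0) \<and>
     (\<forall>u :: nat \<Rightarrow> 'a \<Rightarrow> real. (\<forall>n. u n \<in> V) \<and> bounded (range (\<lambda>n. nV (u n))) \<longrightarrow>
        (\<exists>w\<in>W. \<exists>r. strict_mono r \<and> (\<lambda>n. nW (\<lambda>x. u (r n) x - w x)) \<longlonglongrightarrow> 0))"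


section \<open>The exponents\<close>

definition crit_exp :: "nat \<Rightarrow> nat \<Rightarrow> real" where
  "crit_exp N k = 2 * (real N - real k) / (real N - real k - 2)"

definition psi :: "nat \<Rightarrow> nat \<Rightarrow> nat \<Rightarrow> real \<Rightarrow> real" where
  "psi N m k l =
     - (2 * real k * (real N - real k)) /
         (real m * (real m - real k) * (real m - real k + 1)) +
     2 * (real m + 1) / (real m * (real m - real k + 1)) * min l (1 / (real m - real k))"

end

theory Submission
  imports Defs "HOL-Complex_Analysis.Great_Picard" "HOL-Library.Diagonal_Subsequence"
begin

text \<open>The weight and the radial symmetry do not help: for \<open>1 \<le> k < m\<close> the correction \<open>\<psi>\<close> is
  nonpositive and \<open>h\<close> is bounded, so it suffices to embed \<open>G\<close>-invariant functions compactly into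
  \<open>L\<^sup>q\<close> for \<open>q < 2n/(n - 2)\<close> with \<open>n = N - k\<close>.

  Since all orbits have dimension at least \<open>k\<close>, a ball of radius \<open>r\<close> in \<open>\<Omega>\<close> has at least \<open>c r\<^sup>-\<^sup>k\<close>
  disjoint copies under \<open>G\<close>, and an invariant \<open>|u|\<^sup>p\<close> has mass at most \<open>C r\<^sup>k \<integral>|u|\<^sup>p\<close> in it. Hence, if
  \<open>\<integral>|u|\<^sup>p \<le> K\<close>, averages of \<open>|u|\<close> over balls of radius \<open>r \<sim> \<lambda>\<^sup>-\<^sup>p\<^sup>/\<^sup>n\<close> are small compared to \<open>\<lambda>\<close>, so that on
  \<open>{|u| > \<lambda>}\<close> the function \<open>u\<close> is controlled by its oscillation at scale \<open>r\<close>, and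
  \<open>\<integral>\<^bsub>|u| > \<lambda>\<^esub> u\<^sup>2 \<le> C r\<^sup>2 \<integral>|\<nabla>u|\<^sup>2\<close>. Summing over dyadic \<open>\<lambda>\<close> bounds \<open>\<integral>|u|\<^sup>q\<close> for all \<open>q < 2 + 2p/n\<close>; the
  fixed point of \<open>p \<mapsto> 2 + 2p/n\<close> is \<open>2n/(n - 2)\<close>. Compactness follows by interpolating with the
  Rellich theorem in \<open>L\<^sup>2\<close>.

  That orbits are submanifolds at all, of dimension \<open>dim (\<gg> x)\<close> for the Lie algebra \<open>\<gg>\<close> of \<open>G\<close>, is
  proved by a version of von Neumann's closed subgroup theorem.\<close>

section \<open>Smooth functions\<close>

text \<open>The obstacle is that the orbit dimension may jump, so coordinates adapted to the orbits
  need not exist uniformly on the closure of \<open>\<Omega>1\<close>, and the Sobolev inequality in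
  \<open>n\<close> variables cannot simply be quoted. A count of separated orbit points is stable
  under small changes of the base point, and compactness makes it uniform. This count and the charts
  of an orbit come from the same product of one-parameter groups.

  Mass at most \<open>c r^k K\<close> in a ball of volume \<open>v r^N\<close> is an average of
  order \<open>r powr (- n)\<close>; this is how \<open>N - k\<close> takes over the role of the
  dimension. The map sending \<open>p\<close> to \<open>2 + 2 p / n\<close> has slope less than 1,
  so below its fixed point the gain per step is bounded from below and finitely many steps suffice.

  Sobolev spaces enter only through a translation estimate, which survives limits. After it
  everything concerns Borel functions on the whole space, where Fubini and translations are at hand.

  The sign of \<open>\<psi>\<close> is a cancellation: with \<open>d = m - k\<close> and
  \<open>min l (1 / d) \<le> 1 / d\<close>, the numerator becomes
  \<open>2 (d + 1) (1 - k)\<close>.\<close>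

lemma Ck_on_cong:
  assumes "open S" "\<And>x. x \<in> S \<Longrightarrow> f x = g x" "Ck_on n S f"
  shows "Ck_on n S g"
  using assms(2,3)
proof (induction n arbitrary: f g)
  case 0
  then show ?case using continuous_on_cong[of S S f g] by simp
next
  case (Suc n)
  have D: "(g has_derivative frechet_derivative f (at x)) (at x)" if "x \<in> S" for x
  proof -
    have "(f has_derivative frechet_derivative f (at x)) (at x)"
      using Suc.prems(2) that by (simp add: frechet_derivative_works)
    then show ?thesis
      using has_derivative_transform_within_open[of f _ x UNIV S g] assms(1) that Suc.prems(1) by auto
  qed
  have "frechet_derivative f (at x) = frechet_derivative g (at x)" if "x \<in> S" for x
    using frechet_derivative_at[OF D[OF that]] .
  then have "Ck_on n S (\<lambda>x. frechet_derivative g (at x) v)" for v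
    using Suc.IH[of "\<lambda>x. frechet_derivative f (at x) v" "\<lambda>x. frechet_derivative g (at x) v"] Suc.prems(2)
    by simp
  moreover have "g differentiable (at x)" if "x \<in> S" for x
    using D[OF that] differentiableI by blast
  ultimately show ?case by simp
qed

text \<open>The derivative may be supplied by a formula, so inductions over \<open>n\<close> need
  not handle \<open>frechet_derivative\<close> of a compound expression.\<close>

lemma Ck_on_SucI:
  assumes "open S" "\<And>x. x \<in> S \<Longrightarrow> (f has_derivative f' x) (at x)"
    and "\<And>v. Ck_on n S (\<lambda>x. f' x v)"
  shows "Ck_on (Suc n) S f"
proof -
  have "frechet_derivative f (at x) = f' x" if "x \<in> S" for x
    using frechet_derivative_at[OF assms(2)[OF that]] by simp
  then have "Ck_on n S (\<lambda>x. frechet_derivative f (at x) v)" for v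
    using Ck_on_cong[OF assms(1) _ assms(3)] by simp
  then show ?thesis
    using differentiableI[OF assms(2)] by (auto simp only: Ck_on.simps)
qed

lemma Ck_on_Suc_has_derivative:
  assumes "Ck_on (Suc n) S f" "x \<in> S"
  shows "(f has_derivative frechet_derivative f (at x)) (at x)"
  using assms by (simp add: frechet_derivative_works)

lemma Ck_on_Suc_imp: "Ck_on (Suc n) S f \<Longrightarrow> Ck_on n S f"
proof (induction n arbitrary: f)
  case 0
  then show ?case
    by (simp add: continuous_at_imp_continuous_on differentiable_imp_continuous_within)
next
  case (Suc n)
  then show ?case by (metis Ck_on.simps(2))
qed

lemma Ck_on_imp_continuous_on: "Ck_on n S f \<Longrightarrow> continuous_on S f"
  by (induction n) (use Ck_on_Suc_imp in auto)

lemma Ck_on_subset_open: "Ck_on n T f \<Longrightarrow> S \<subseteq> T \<Longrightarrow> Ck_on n S f"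
  by (induction n arbitrary: f) (auto intro: continuous_on_subset)

lemma Ck_on_const: "Ck_on n S (\<lambda>x. c)"
  by (induction n arbitrary: c) (auto simp: frechet_derivative_const)

lemma Ck_on_bounded_linear:
  assumes "open S" "bounded_linear f"
  shows "Ck_on n S f"
proof (cases n)
  case 0
  then show ?thesis using linear_continuous_on[OF assms(2)] by simp
next
  case (Suc k)
  show ?thesis unfolding Suc
    by (rule Ck_on_SucI[OF assms(1), of f "\<lambda>x. f"])
      (auto intro: Ck_on_const bounded_linear.has_derivative[OF assms(2) has_derivative_ident])
qed

lemma Ck_on_add:
  assumes "open S" "Ck_on n S f" "Ck_on n S g"
  shows "Ck_on n S (\<lambda>x. f x + g x)"
  using assms(2,3)
proof (induction n arbitrary: f g)
  case 0
  then show ?case by (auto intro: continuous_intros)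
next
  case (Suc n)
  show ?case
    by (rule Ck_on_SucI[OF assms(1), of _ "\<lambda>x v. frechet_derivative f (at x) v + frechet_derivative g (at x) v"])
      (use Suc in \<open>auto intro!: has_derivative_add Ck_on_Suc_has_derivative Suc.IH\<close>)
qed

lemma Ck_on_bilinear:
  fixes prod :: "'b::euclidean_space \<Rightarrow> 'c::euclidean_space \<Rightarrow> 'd::euclidean_space"
  assumes "bounded_bilinear prod" "open S" "Ck_on n S f" "Ck_on n S g"
  shows "Ck_on n S (\<lambda>x. prod (f x) (g x))"
  using assms(3,4)
proof (induction n arbitrary: f g)
  case 0
  then show ?case using bounded_bilinear.continuous_on[OF assms(1)] by auto
next
  case (Suc n)
  show ?case
  proof (rule Ck_on_SucI[OF assms(2), of _ "\<lambda>x v. prod (f x) (frechet_derivative g (at x) v) + prod (frechet_derivative f (at x) v) (g x)"])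
    show "((\<lambda>x. prod (f x) (g x)) has_derivative
       (\<lambda>v. prod (f x) (frechet_derivative g (at x) v) + prod (frechet_derivative f (at x) v) (g x))) (at x)"
      if "x \<in> S" for x
      using Suc.prems that by (intro bounded_bilinear.FDERIV[OF assms(1)] Ck_on_Suc_has_derivative)
    show "Ck_on n S (\<lambda>x. prod (f x) (frechet_derivative g (at x) v) + prod (frechet_derivative f (at x) v) (g x))" for v
      using Suc.prems by (intro Ck_on_add[OF assms(2)] Suc.IH) (auto intro: Ck_on_Suc_imp)
  qed
qed

lemmas Ck_on_mult = Ck_on_bilinear[OF bounded_bilinear_mult]
lemmas Ck_on_scaleR = Ck_on_bilinear[OF bounded_bilinear_scaleR]

lemma Ck_on_sum:
  assumes "open S" "\<And>i. i \<in> I \<Longrightarrow> Ck_on n S (f i)"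
  shows "Ck_on n S (\<lambda>x. \<Sum>i\<in>I. f i x)"
  using assms(2) by (induction I rule: infinite_finite_induct) (auto intro: Ck_on_const Ck_on_add[OF assms(1)])

lemma Ck_on_prod:
  fixes f :: "'i \<Rightarrow> 'a::euclidean_space \<Rightarrow> real"
  assumes "open S" "\<And>i. i \<in> I \<Longrightarrow> Ck_on n S (f i)"
  shows "Ck_on n S (\<lambda>x. \<Prod>i\<in>I. f i x)"
  using assms(2) by (induction I rule: infinite_finite_induct) (auto intro: Ck_on_const Ck_on_mult[OF assms(1)])

lemma Ck_on_linear_compose:
  assumes "open S" "bounded_linear h" "Ck_on n S f"
  shows "Ck_on n S (\<lambda>x. h (f x))"
  using assms(3)
proof (induction n arbitrary: f)
  case 0
  then show ?case using bounded_linear.continuous_on[OF assms(2)] by auto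
next
  case (Suc n)
  show ?case
    by (rule Ck_on_SucI[OF assms(1), of _ "\<lambda>x v. h (frechet_derivative f (at x) v)"])
      (use Suc in \<open>auto intro!: bounded_linear.has_derivative[OF assms(2)] Ck_on_Suc_has_derivative\<close>)
qed

lemma Ck_on_diff:
  assumes "open S" "Ck_on n S f" "Ck_on n S g"
  shows "Ck_on n S (\<lambda>x. f x - g x)"
  using Ck_on_add[OF assms(1,2) Ck_on_linear_compose[OF assms(1) bounded_linear_minus[OF bounded_linear_ident] assms(3)]]
  by simp

text \<open>The chain rule pairs an operator depending on \<open>x\<close> with a vector depending
  on \<open>x\<close>. Expanding the vector in the basis separates the two, and the induction
  hypothesis applies to \<open>g\<close> differentiated in a fixed basis direction; hence
  \<open>g\<close> varies in the induction.\<close>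

lemma Ck_on_compose:
  fixes f :: "'a::euclidean_space \<Rightarrow> 'b::euclidean_space" and g :: "'b \<Rightarrow> 'c::euclidean_space"
  assumes "open S" "f ` S \<subseteq> T" "Ck_on n S f" "Ck_on n T g"
  shows "Ck_on n S (\<lambda>x. g (f x))"
  using assms(3,4)
proof (induction n arbitrary: g)
  case 0
  then show ?case using continuous_on_compose2[of T g S f] assms(2) by auto
next
  case (Suc n)
  have lin: "linear (frechet_derivative g (at (f x)))" if "x \<in> S" for x
    using Ck_on_Suc_has_derivative[OF Suc.prems(2)] assms(2) that has_derivative_linear by blast
  have eq: "frechet_derivative g (at (f x)) v = (\<Sum>b\<in>Basis. (v \<bullet> b) *\<^sub>R frechet_derivative g (at (f x)) b)"
    if "x \<in> S" for x v
  proof -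
    have "frechet_derivative g (at (f x)) (\<Sum>b\<in>Basis. (v \<bullet> b) *\<^sub>R b) = (\<Sum>b\<in>Basis. (v \<bullet> b) *\<^sub>R frechet_derivative g (at (f x)) b)"
      by (simp add: linear_sum[OF lin[OF that]] linear_cmul[OF lin[OF that]])
    then show ?thesis by (simp add: euclidean_representation)
  qed
  show ?case
  proof (rule Ck_on_SucI[OF assms(1), of _ "\<lambda>x v. \<Sum>b\<in>Basis. (frechet_derivative f (at x) v \<bullet> b) *\<^sub>R frechet_derivative g (at (f x)) b"])
    fix x assume x: "x \<in> S"
    have "((\<lambda>x. g (f x)) has_derivative (\<lambda>v. frechet_derivative g (at (f x)) (frechet_derivative f (at x) v))) (at x)"
      using has_derivative_compose[OF Ck_on_Suc_has_derivative[OF Suc.prems(1) x] Ck_on_Suc_has_derivative[OF Suc.prems(2)]]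
        assms(2) x by blast
    then show "((\<lambda>x. g (f x)) has_derivative (\<lambda>v. \<Sum>b\<in>Basis. (frechet_derivative f (at x) v \<bullet> b) *\<^sub>R frechet_derivative g (at (f x)) b)) (at x)"
      unfolding eq[OF x, symmetric] .
  next
    fix v
    show "Ck_on n S (\<lambda>x. \<Sum>b\<in>Basis. (frechet_derivative f (at x) v \<bullet> b) *\<^sub>R frechet_derivative g (at (f x)) b)"
      using Suc.prems Ck_on_Suc_imp[OF Suc.prems(1)]
      by (intro Ck_on_sum Ck_on_scaleR assms(1) Suc.IH Ck_on_linear_compose[OF assms(1) bounded_linear_inner_left]) auto
  qed
qed

lemma Ck_on_inverse:
  fixes f :: "'a::euclidean_space \<Rightarrow> real"
  assumes "open S" "\<And>x. x \<in> S \<Longrightarrow> f x \<noteq> 0" "Ck_on n S f"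
  shows "Ck_on n S (\<lambda>x. inverse (f x))"
  using assms(3)
proof (induction n)
  case 0
  then show ?case using assms(2) by (auto intro: continuous_intros)
next
  case (Suc n)
  show ?case
  proof (rule Ck_on_SucI[OF assms(1), of _ "\<lambda>x v. (-1) * (inverse (f x) * frechet_derivative f (at x) v * inverse (f x))"])
    show "((\<lambda>x. inverse (f x)) has_derivative
        (\<lambda>v. (-1) * (inverse (f x) * frechet_derivative f (at x) v * inverse (f x)))) (at x)" if "x \<in> S" for x
      using Ck_on_Suc_has_derivative[OF Suc.prems that] assms(2)[OF that]
      by (auto intro!: derivative_eq_intros)
    show "Ck_on n S (\<lambda>x. (-1) * (inverse (f x) * frechet_derivative f (at x) v * inverse (f x)))" for v
      using Suc Ck_on_Suc_imp[OF Suc.prems] by (intro Ck_on_mult Ck_on_const assms(1)) auto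
  qed
qed

lemma Ck_on_det:
  fixes A :: "'a::euclidean_space \<Rightarrow> real^'m^'m"
  assumes "open S" "\<And>i j. Ck_on n S (\<lambda>x. A x $ i $ j)"
  shows "Ck_on n S (\<lambda>x. det (A x))"
  unfolding det_def
  by (intro Ck_on_sum Ck_on_mult Ck_on_prod Ck_on_const assms)

lemma Ck_on_vec:
  fixes f :: "'a::euclidean_space \<Rightarrow> real^'m"
  assumes "open S" "\<And>i. Ck_on n S (\<lambda>x. f x $ i)"
  shows "Ck_on n S f"
proof -
  have "Ck_on n S (\<lambda>x. \<Sum>i\<in>UNIV. f x $ i *\<^sub>R axis i (1::real))"
    by (intro Ck_on_sum Ck_on_scaleR Ck_on_const assms)
  moreover have "(\<Sum>i\<in>UNIV. y $ i *\<^sub>R axis i (1::real)) = y" for y :: "real^'m"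
    using basis_expansion[of y] by (simp add: scalar_mult_eq_scaleR)
  ultimately show ?thesis by simp
qed

text \<open>Bootstrapping: the derivative of \<open>\<Phi>\<close> is the inverse of the Jacobian
  matrix of \<open>F\<close> at \<open>\<Phi> x\<close>. By Cramer's rule it is rational in the
  entries of that matrix, and these are as often differentiable as \<open>\<Phi>\<close> is already
  known to be.\<close>

lemma Ck_on_inverse_function:
  fixes F \<Phi> :: "real^'m \<Rightarrow> real^'m"
  assumes "open U" "\<Phi> ` U \<subseteq> V" and F: "\<And>n. Ck_on n V F"
    and der: "\<And>x. x \<in> U \<Longrightarrow> (\<Phi> has_derivative \<Phi>' x) (at x)"
    and inv: "\<And>x. x \<in> U \<Longrightarrow> \<Phi>' x = inv (frechet_derivative F (at (\<Phi> x)))"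
    and bij: "\<And>x. x \<in> U \<Longrightarrow> bij (frechet_derivative F (at (\<Phi> x)))"
  shows "Ck_on n U \<Phi>"
proof (induction n)
  case 0
  then show ?case
    using has_derivative_continuous[OF der] by (auto intro: continuous_at_imp_continuous_on)
next
  case (Suc n)
  define M where "M x = matrix (frechet_derivative F (at (\<Phi> x)))" for x
  have lin: "linear (frechet_derivative F (at (\<Phi> x)))" if "x \<in> U" for x
    using Ck_on_Suc_has_derivative[OF F] assms(2) that has_derivative_linear by blast
  have M: "M x *v y = frechet_derivative F (at (\<Phi> x)) y" if "x \<in> U" for x y
    using fun_cong[OF matrix_vector_mul(2)[OF lin[OF that]]] unfolding M_def by simp
  have det: "det (M x) \<noteq> 0" if "x \<in> U" for x
    using det_nz_iff_inj[OF lin[OF that]] bij_is_inj[OF bij[OF that]] by (simp add: M_def)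
  have entries: "Ck_on n U (\<lambda>x. M x $ i $ j)" for i j
  proof -
    have "Ck_on n V (\<lambda>z. frechet_derivative F (at z) (axis j 1))"
      using F[of "Suc n"] by simp
    from Ck_on_compose[OF assms(1,2) Suc this]
    have "Ck_on n U (\<lambda>x. frechet_derivative F (at (\<Phi> x)) (axis j 1) \<bullet> axis i 1)"
      by (intro Ck_on_linear_compose[OF assms(1) bounded_linear_inner_left])
    then show ?thesis by (simp add: M_def matrix_def inner_axis)
  qed
  show ?case
  proof (rule Ck_on_SucI[OF assms(1) der])
    fix v
    \<comment> \<open>Column \<open>k\<close> of the Jacobian is replaced by \<open>v\<close>:
      Cramer's rule for the solution of \<open>M x *v y = v\<close>.\<close>
    have eq: "(\<chi> k. det (\<chi> i j. if j = k then v $ i else M x $ i $ j) * inverse (det (M x))) = \<Phi>' x v"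
      if "x \<in> U" for x
    proof -
      have "M x *v \<Phi>' x v = v"
        using M[OF that] inv[OF that] bij_is_surj[OF bij[OF that]] by (simp add: surj_f_inv_f)
      then show ?thesis
        using cramer[OF det[OF that], of "\<Phi>' x v" v] by (simp add: divide_inverse)
    qed
    have 1: "Ck_on n U (\<lambda>x. if j = k then v $ i else M x $ i $ j)" for i j k
      using entries by (cases "j = k") (simp_all add: Ck_on_const)
    have "Ck_on n U (\<lambda>x. \<chi> k. det (\<chi> i j. if j = k then v $ i else M x $ i $ j) * inverse (det (M x)))"
      by (rule Ck_on_vec[OF assms(1)])
        (auto intro!: Ck_on_mult Ck_on_inverse Ck_on_det assms(1) det 1 entries)
    then show "Ck_on n U (\<lambda>x. \<Phi>' x v)"
      by (rule Ck_on_cong[OF assms(1) eq, rotated])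
  qed
qed

lemma smooth_on_frechet: "smooth_on S f \<Longrightarrow> smooth_on S (\<lambda>x. frechet_derivative f (at x) v)"
  unfolding smooth_on_def using Ck_on.simps(2) by blast

section \<open>Smooth bump functions on boxes\<close>

text \<open>The powers of \<open>1 / t\<close> make the family closed under differentiation up to
  linear combinations, so smoothness of the flat function \<open>exp (- 1 / t)\<close> is an
  induction over the whole family.\<close>

definition flat_exp :: "nat \<Rightarrow> real \<Rightarrow> real" where
  "flat_exp i t = (if t > 0 then exp (- inverse t) * inverse t ^ i else 0)"

lemma flat_exp_tendsto: "((\<lambda>t. exp (- inverse t) * inverse t ^ i) \<longlongrightarrow> 0) (at_right (0::real))"
proof -
  have "((\<lambda>x::real. x ^ i / exp x) \<longlongrightarrow> 0) at_top"
    by (rule tendsto_power_div_exp_0)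
  from filterlim_compose[OF this filterlim_inverse_at_top_right]
  show ?thesis by (simp add: exp_minus field_simps)
qed

lemma flat_exp_deriv:
  "(flat_exp i has_real_derivative (flat_exp (i + 2) t - real i * flat_exp (i + 1) t)) (at t)"
proof -
  consider "t > 0" | "t < 0" | "t = 0" by linarith
  then show ?thesis
  proof cases
    case 1
    have "((\<lambda>t. exp (- inverse t) * inverse t ^ i) has_real_derivative (flat_exp (i + 2) t - real i * flat_exp (i + 1) t)) (at t)"
      using 1 by (auto intro!: derivative_eq_intros simp: flat_exp_def power2_eq_square algebra_simps)
        (cases i; simp)
    then show ?thesis
      by (rule has_field_derivative_transform_within_open[where S="{0<..}"]) (use 1 in \<open>auto simp: flat_exp_def\<close>)
  next
    case 2
    have "((\<lambda>t. 0) has_real_derivative (flat_exp (i + 2) t - real i * flat_exp (i + 1) t)) (at t)"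
      using 2 by (auto intro!: derivative_eq_intros simp: flat_exp_def)
    then show ?thesis
      by (rule has_field_derivative_transform_within_open[where S="{..<0}"]) (use 2 in \<open>auto simp: flat_exp_def\<close>)
  next
    case 3
    \<comment> \<open>Divided by \<open>y\<close>, \<open>flat_exp i\<close> becomes the next member
      of the family, which also tends to \<open>0\<close> from the right.\<close>
    have r: "((\<lambda>y. flat_exp i y / y) \<longlongrightarrow> 0) (at_right 0)"
      by (rule Lim_transform_eventually[OF flat_exp_tendsto[of "Suc i"]])
        (auto simp: eventually_at_filter flat_exp_def divide_inverse)
    have l: "((\<lambda>y. flat_exp i y / y) \<longlongrightarrow> 0) (at_left 0)"
      by (rule Lim_transform_eventually[OF tendsto_const])
        (auto simp: eventually_at_filter flat_exp_def)
    from filterlim_split_at[OF l r] show ?thesis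
      unfolding has_field_derivative_iff 3 by (simp add: flat_exp_def)
  qed
qed

lemma Ck_on_flat_exp: "Ck_on n UNIV (flat_exp i)"
proof (induction n arbitrary: i)
  case 0
  have "isCont (flat_exp i) x" for x using DERIV_isCont[OF flat_exp_deriv] .
  then show ?case by (simp add: continuous_at_imp_continuous_on)
next
  case (Suc n)
  show ?case
    by (rule Ck_on_SucI[OF open_UNIV, of _ "\<lambda>x v. v * (flat_exp (i + 2) x - real i * flat_exp (i + 1) x)"])
      (use flat_exp_deriv Suc in \<open>auto simp: has_field_derivative_def mult.commute[of _ "_ - _"]
         intro!: Ck_on_mult Ck_on_diff Ck_on_const\<close>)
qed

text \<open>Approximates the indicator of the open box from below as \<open>n\<close> grows; weak
  identities can thus be tested on boxes.\<close>

definition box_bump :: "nat \<Rightarrow> 'a::euclidean_space \<Rightarrow> 'a \<Rightarrow> 'a \<Rightarrow> real" where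
  "box_bump n a c x = (\<Prod>b\<in>Basis. flat_exp 0 (real n * (x \<bullet> b - a \<bullet> b)) * flat_exp 0 (real n * (c \<bullet> b - x \<bullet> b)))"

lemma smooth_on_box_bump: "smooth_on UNIV (box_bump n a c)"
  unfolding smooth_on_def box_bump_def
proof (intro allI Ck_on_prod open_UNIV Ck_on_mult)
  fix k and b :: 'a
  have 1: "Ck_on k UNIV (\<lambda>x. real n * (x \<bullet> b - a \<bullet> b))" "Ck_on k UNIV (\<lambda>x. real n * (c \<bullet> b - x \<bullet> b))"
    by (intro Ck_on_mult Ck_on_diff Ck_on_const Ck_on_bounded_linear bounded_linear_inner_left open_UNIV)+
  show "Ck_on k UNIV (\<lambda>x. flat_exp 0 (real n * (x \<bullet> b - a \<bullet> b)))" 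
    "Ck_on k UNIV (\<lambda>x. flat_exp 0 (real n * (c \<bullet> b - x \<bullet> b)))"
    using Ck_on_compose[OF open_UNIV _ 1(1) Ck_on_flat_exp] Ck_on_compose[OF open_UNIV _ 1(2) Ck_on_flat_exp]
    by auto
qed

lemma flat_exp_0_bounds: "0 \<le> flat_exp 0 t" "flat_exp 0 t \<le> 1"
  by (auto simp: flat_exp_def)

lemma box_bump_bounds: "0 \<le> box_bump n a c x" "box_bump n a c x \<le> 1"
  unfolding box_bump_def
  by (auto intro!: prod_nonneg prod_le_1 mult_nonneg_nonneg mult_le_one simp: flat_exp_0_bounds)

lemma box_bump_outside: "x \<notin> box a c \<Longrightarrow> box_bump n a c x = 0"
  unfolding box_bump_def mem_box
  by (auto simp: flat_exp_def zero_less_mult_iff intro!: prod_zero)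

lemma box_bump_tendsto: "(\<lambda>n. box_bump n a c x) \<longlonglongrightarrow> indicator (box a c) x"
proof (cases "x \<in> box a c")
  case True
  have 1: "(\<lambda>n. flat_exp 0 (real n * s)) \<longlonglongrightarrow> 1" if "s > 0" for s
  proof -
    have "(\<lambda>n. exp (- inverse (real n * s))) \<longlonglongrightarrow> exp (- 0)"
      by (intro tendsto_intros tendsto_inverse_0_at_top
        filterlim_at_top_mult_tendsto_pos[OF tendsto_const that filterlim_real_sequentially])
    moreover have "\<forall>\<^sub>F n in sequentially. exp (- inverse (real n * s)) = flat_exp 0 (real n * s)"
      using eventually_gt_at_top[of 0] by eventually_elim (use that in \<open>auto simp: flat_exp_def\<close>)
    ultimately show ?thesis
      using Lim_transform_eventually by fastforce
  qed
  have "(\<lambda>n. box_bump n a c x) \<longlonglongrightarrow> (\<Prod>b\<in>(Basis::'a set). 1 * 1)"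
    unfolding box_bump_def
    by (intro tendsto_prod tendsto_mult 1) (use True in \<open>auto simp: mem_box\<close>)
  then show ?thesis using True by simp
qed (simp add: box_bump_outside)

lemma box_bump_test_function:
  assumes "cbox a c \<subseteq> \<Omega>"
  shows "box_bump n a c \<in> test_functions \<Omega>"
proof -
  have "closure {x. box_bump n a c x \<noteq> 0} \<subseteq> cbox a c"
    by (rule closure_minimal) (use box_bump_outside box_subset_cbox in \<open>auto, blast\<close>)
  moreover have "bounded {x. box_bump n a c x \<noteq> 0}"
    using calculation by (meson bounded_cbox bounded_subset closure_subset)
  ultimately show ?thesis
    using assms unfolding test_functions_def by (auto simp: compact_closure smooth_on_box_bump)
qed

section \<open>The Lie algebra of a compact linear group and its orbits\<close>

text \<open>A copy of the bounded operators from \<open>'a\<close> to itself, with composition as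
  product, so that \<open>exp\<close> and its theory for Banach algebras apply. Operators between
  two different spaces have no product, so the algebra structure sits on a type of its own.\<close>

typedef (overloaded) 'a endo = "UNIV :: ('a::euclidean_space \<Rightarrow>\<^sub>L 'a) set" ..

setup_lifting type_definition_endo

instantiation endo :: (euclidean_space) real_normed_algebra_1
begin

lift_definition norm_endo :: "'a endo \<Rightarrow> real" is norm .
lift_definition minus_endo :: "'a endo \<Rightarrow> 'a endo \<Rightarrow> 'a endo" is minus .
lift_definition dist_endo :: "'a endo \<Rightarrow> 'a endo \<Rightarrow> real" is dist .
definition uniformity_endo :: "('a endo \<times> 'a endo) filter" where
  "uniformity_endo = (INF e\<in>{0<..}. principal {(x, y). dist x y < e})"
definition open_endo :: "'a endo set \<Rightarrow> bool" where
  "open_endo U = (\<forall>x\<in>U. \<forall>\<^sub>F (x', y) in uniformity. x' = x \<longrightarrow> y \<in> U)"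
lift_definition uminus_endo :: "'a endo \<Rightarrow> 'a endo" is uminus .
lift_definition zero_endo :: "'a endo" is 0 .
lift_definition plus_endo :: "'a endo \<Rightarrow> 'a endo \<Rightarrow> 'a endo" is plus .
lift_definition scaleR_endo :: "real \<Rightarrow> 'a endo \<Rightarrow> 'a endo" is scaleR .
lift_definition sgn_endo :: "'a endo \<Rightarrow> 'a endo" is sgn .
lift_definition times_endo :: "'a endo \<Rightarrow> 'a endo \<Rightarrow> 'a endo" is blinfun_compose .
lift_definition one_endo :: "'a endo" is id_blinfun .

instance
proof
  fix a b c :: "'a endo" and r s :: real
  show "(0::'a endo) \<noteq> 1"
  proof (transfer, rule notI)
    assume "0 = (id_blinfun :: 'a \<Rightarrow>\<^sub>L 'a)"
    then have "blinfun_apply (id_blinfun :: 'a \<Rightarrow>\<^sub>L 'a) b = 0" for b by simp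
    then show False using nonzero_Basis[OF SOME_Basis, where 'a='a] by simp
  qed
  show "norm (1::'a endo) = 1" by transfer (simp add: norm_blinfun_id)
  show "norm (a * b) \<le> norm a * norm b" by transfer (rule norm_blinfun_compose)
  show "a * b * c = a * (b * c)" by transfer (auto intro!: blinfun_eqI)
  show "(a + b) * c = a * c + b * c" by transfer (auto intro!: blinfun_eqI simp: blinfun.bilinear_simps)
  show "a * (b + c) = a * b + a * c" by transfer (auto intro!: blinfun_eqI simp: blinfun.bilinear_simps)
  show "r *\<^sub>R a * b = r *\<^sub>R (a * b)" by transfer (auto intro!: blinfun_eqI simp: blinfun.bilinear_simps)
  show "a * r *\<^sub>R b = r *\<^sub>R (a * b)" by transfer (auto intro!: blinfun_eqI simp: blinfun.bilinear_simps)
  show "1 * a = a" by transfer (auto intro!: blinfun_eqI)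
  show "a * 1 = a" by transfer (auto intro!: blinfun_eqI)
  show "a + b + c = a + (b + c)" by transfer (simp add: algebra_simps)
  show "a + b = b + a" by transfer (simp add: algebra_simps)
  show "0 + a = a" by transfer simp
  show "- a + a = 0" by transfer simp
  show "a - b = a + - b" by transfer simp
  show "r *\<^sub>R (a + b) = r *\<^sub>R a + r *\<^sub>R b" by transfer (simp add: scaleR_add_right)
  show "(r + s) *\<^sub>R a = r *\<^sub>R a + s *\<^sub>R a" by transfer (simp add: scaleR_add_left)
  show "r *\<^sub>R s *\<^sub>R a = (r * s) *\<^sub>R a" by transfer simp
  show "1 *\<^sub>R a = a" by transfer simp
  show "dist a b = norm (a - b)" by transfer (rule dist_norm)
  show "sgn a = inverse (norm a) *\<^sub>R a" by transfer (simp add: sgn_div_norm)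
  show "(norm a = 0) = (a = 0)" by transfer simp
  show "norm (a + b) \<le> norm a + norm b" by transfer (rule norm_triangle_ineq)
  show "norm (r *\<^sub>R a) = \<bar>r\<bar> * norm a" by transfer simp
  show "uniformity = (INF e\<in>{0<..}. principal {(x, y::'a endo). dist x y < e})"
    by (rule uniformity_endo_def)
  fix U :: "'a endo set"
  show "open U = (\<forall>x\<in>U. \<forall>\<^sub>F (x', y) in uniformity. x' = x \<longrightarrow> y \<in> U)" by (rule open_endo_def)
qed

end

lemma Rep_endo_tendsto_iff:
  "(X \<longlonglongrightarrow> L) \<longleftrightarrow> (\<lambda>n. Rep_endo (X n)) \<longlonglongrightarrow> Rep_endo L"
  unfolding tendsto_iff dist_endo.rep_eq ..

instance endo :: (euclidean_space) banach
proof
  fix X :: "nat \<Rightarrow> 'a endo"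
  assume "Cauchy X"
  then have "Cauchy (\<lambda>n. Rep_endo (X n))"
    unfolding Cauchy_def dist_endo.rep_eq .
  then obtain L where "(\<lambda>n. Rep_endo (X n)) \<longlonglongrightarrow> L"
    using Cauchy_convergent convergent_def by blast
  then have "X \<longlonglongrightarrow> Abs_endo L"
    by (simp add: Rep_endo_tendsto_iff Abs_endo_inverse)
  then show "convergent X" by (auto simp: convergent_def)
qed

text \<open>This is how the finite dimension of the algebra enters: directions in which elements of
  \<open>G\<close> approach \<open>1\<close> have convergent subsequences.\<close>

instance endo :: (euclidean_space) heine_borel
proof
  fix X :: "nat \<Rightarrow> 'a endo"
  assume "bounded (range X)"
  then obtain B where "\<And>n. norm (X n) \<le> B" by (auto simp: bounded_iff)
  then have "bounded (range (\<lambda>n. Rep_endo (X n)))"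
    unfolding bounded_iff norm_endo.rep_eq by auto
  from bounded_imp_convergent_subsequence[OF this] obtain L r where
    "strict_mono r" "((\<lambda>n. Rep_endo (X n)) \<circ> r) \<longlonglongrightarrow> L" by blast
  then have "strict_mono r \<and> (X \<circ> r) \<longlonglongrightarrow> Abs_endo L"
    by (simp add: Rep_endo_tendsto_iff Abs_endo_inverse o_def)
  then show "\<exists>l r. strict_mono r \<and> (X \<circ> r) \<longlonglongrightarrow> l" by blast
qed

lift_definition endo_apply :: "'a::euclidean_space endo \<Rightarrow> 'a \<Rightarrow> 'a" is blinfun_apply .

lemma endo_apply_mult [simp]: "endo_apply (a * b) x = endo_apply a (endo_apply b x)"
  by transfer simp

lemma endo_apply_one [simp]: "endo_apply 1 x = x"
  by transfer simp

lemma norm_endo_apply: "norm (endo_apply a x) \<le> norm a * norm x"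
  by transfer (rule norm_blinfun)

lemma bounded_bilinear_endo_apply: "bounded_bilinear endo_apply"
proof
  show "\<exists>K. \<forall>a x. norm (endo_apply a x) \<le> norm a * norm x * K"
    by (rule exI[of _ 1]) (simp add: norm_endo_apply)
qed (transfer; simp add: blinfun.bilinear_simps)+

interpretation endo_apply: bounded_bilinear endo_apply
  by (rule bounded_bilinear_endo_apply)

lift_definition matrix_endo :: "real^'m^'m \<Rightarrow> (real^'m) endo" is "\<lambda>A. Blinfun ((*v) A)" .

lemma endo_apply_matrix_endo [simp]: "endo_apply (matrix_endo A) x = A *v x"
  by transfer (simp add: bounded_linear_Blinfun_apply matrix_vector_mul_bounded_linear)

lemma endo_eqI: "(\<And>x. endo_apply a x = endo_apply b x) \<Longrightarrow> a = b"
  by transfer (rule blinfun_eqI)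

lemma matrix_endo_mult: "matrix_endo (A ** B) = matrix_endo A * matrix_endo B"
  by (rule endo_eqI) (simp add: matrix_vector_mul_assoc)

lemma matrix_endo_one: "matrix_endo (mat 1) = 1"
  by (rule endo_eqI) simp

lemma continuous_on_matrix_endo: "continuous_on S matrix_endo"
proof -
  have "linear (matrix_endo :: real^'m^'m \<Rightarrow> _)"
    by (intro linearI endo_eqI)
      (simp_all add: endo_apply.add_left endo_apply.scaleR_left matrix_vector_mult_add_rdistrib scaleR_matrix_vector_assoc)
  then show ?thesis by (rule linear_continuous_on[OF linear_conv_bounded_linear[THEN iffD1]])
qed

section \<open>One-parameter groups\<close>

lemma exp_scaleR_diff_quotient:
  fixes X :: "'a::{real_normed_algebra_1, banach}"
  assumes "t \<longlonglongrightarrow> 0" "\<And>n. t n \<noteq> 0"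
  shows "(\<lambda>n. (exp (t n *\<^sub>R X) - 1) /\<^sub>R t n) \<longlonglongrightarrow> X"
proof -
  have "((\<lambda>s. (exp (s *\<^sub>R X) - 1) /\<^sub>R s) \<longlongrightarrow> X) (at 0)"
  proof -
    have "((\<lambda>t. exp (t *\<^sub>R X)) has_vector_derivative exp (0 *\<^sub>R X) * X) (at 0)"
      by (rule exp_scaleR_has_vector_derivative_right)
    then have "((\<lambda>s. norm (exp (s *\<^sub>R X) - 1 - s *\<^sub>R X) / norm s) \<longlongrightarrow> 0) (at 0)"
      by (simp add: has_vector_derivative_def has_derivative_iff_norm)
    then have "((\<lambda>s. dist ((exp (s *\<^sub>R X) - 1) /\<^sub>R s) X) \<longlongrightarrow> 0) (at 0)"
    proof (rule Lim_transform_eventually)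
      have "norm (exp (s *\<^sub>R X) - 1 - s *\<^sub>R X) / norm s = dist ((exp (s *\<^sub>R X) - 1) /\<^sub>R s) X" if "s \<noteq> 0" for s
      proof -
        have "(exp (s *\<^sub>R X) - 1) /\<^sub>R s - X = (exp (s *\<^sub>R X) - 1 - s *\<^sub>R X) /\<^sub>R s"
          using that by (simp add: scaleR_diff_right)
        then show ?thesis by (simp add: dist_norm divide_inverse mult.commute)
      qed
      then show "\<forall>\<^sub>F s in at 0. norm (exp (s *\<^sub>R X) - 1 - s *\<^sub>R X) / norm s = dist ((exp (s *\<^sub>R X) - 1) /\<^sub>R s) X"
        by (simp add: eventually_at_filter)
    qed
    then show ?thesis by (simp add: tendsto_dist_iff[symmetric])
  qed
  moreover have "filterlim t (at 0) sequentially"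
    using assms by (auto simp: filterlim_at)
  ultimately show ?thesis by (rule filterlim_compose)
qed

lemma continuous_on_exp_scaleR:
  fixes X :: "'a::{real_normed_algebra_1, banach}"
  shows "continuous_on S (\<lambda>t. exp (t *\<^sub>R X))"
  unfolding continuous_on_eq_continuous_within
  using has_vector_derivative_continuous[OF exp_scaleR_has_vector_derivative_right] by blast

lemma exp_scaleR_power:
  fixes X :: "'a::{real_normed_algebra_1, banach}"
  shows "exp (t *\<^sub>R X) ^ m = exp ((real m * t) *\<^sub>R X)"
proof (induction m)
  case (Suc m)
  have "exp (t *\<^sub>R X + (real m * t) *\<^sub>R X) = exp (t *\<^sub>R X) * exp ((real m * t) *\<^sub>R X)"
    by (rule exp_add_commuting) simp
  moreover have "t *\<^sub>R X + (real m * t) *\<^sub>R X = (real (Suc m) * t) *\<^sub>R X"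
    by (simp add: distrib_right scaleR_add_left)
  ultimately show ?case using Suc by simp
qed simp

lemma exp_scaleR_minus_mult:
  fixes X :: "'a::{real_normed_algebra_1, banach}"
  shows "exp (t *\<^sub>R X) * exp ((- t) *\<^sub>R X) = 1"
proof -
  have "exp (t *\<^sub>R X + (- t) *\<^sub>R X) = exp (t *\<^sub>R X) * exp ((- t) *\<^sub>R X)"
    by (rule exp_add_commuting) simp
  then show ?thesis by simp
qed

text \<open>Telescoping. The factors \<open>a\<close> cost nothing because of
  \<open>norm a \<le> 1\<close>, so only the growth of \<open>b\<close> appears.\<close>

lemma norm_power_diff_le:
  fixes a b :: "'a::real_normed_algebra_1"
  assumes "norm a \<le> 1" "norm b \<le> \<beta>" "1 \<le> \<beta>"
  shows "norm (a ^ m - b ^ m) \<le> real m * norm (a - b) * \<beta> ^ m"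
proof (induction m)
  case (Suc m)
  have "norm (b ^ m) \<le> \<beta> ^ m"
    using norm_power_ineq[of b m] power_mono[OF assms(2), of m] by simp
  then have 1: "norm ((a - b) * b ^ m) \<le> norm (a - b) * \<beta> ^ m"
    by (meson mult_left_mono norm_ge_zero norm_mult_ineq order_trans)
  have 2: "norm (a * (a ^ m - b ^ m)) \<le> real m * norm (a - b) * \<beta> ^ m"
    using mult_right_mono[OF assms(1), of "norm (a ^ m - b ^ m)"] Suc norm_mult_ineq[of a "a ^ m - b ^ m"] by simp
  have "a ^ Suc m - b ^ Suc m = a * (a ^ m - b ^ m) + (a - b) * b ^ m"
    by (simp add: algebra_simps)
  then have "norm (a ^ Suc m - b ^ Suc m) \<le> real (Suc m) * norm (a - b) * \<beta> ^ m"
    using norm_triangle_ineq[of "a * (a ^ m - b ^ m)" "(a - b) * b ^ m"] 1 2 by (simp add: algebra_simps)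
  also have "\<dots> \<le> real (Suc m) * norm (a - b) * \<beta> ^ Suc m"
    using assms(3) by (intro mult_left_mono power_increasing) auto
  finally show ?case .
qed simp

section \<open>Lie algebra and tangent spaces of a compact group\<close>

text \<open>Inverses are postulated as elements of \<open>G\<close>, the algebra having no inverse
  operation. The bound \<open>norm a \<le> 1\<close> stands in for orthogonality: applied to an
  element and its inverse it makes both isometries.\<close>

locale compact_endo_group =
  fixes G :: "'a::euclidean_space endo set"
  assumes compact_G: "compact G" and one_G: "1 \<in> G"
    and mult_G: "\<And>a b. a \<in> G \<Longrightarrow> b \<in> G \<Longrightarrow> a * b \<in> G"
    and inverse_G: "\<And>a. a \<in> G \<Longrightarrow> \<exists>b\<in>G. a * b = 1 \<and> b * a = 1"
    and norm_G: "\<And>a. a \<in> G \<Longrightarrow> norm a \<le> 1"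
begin

definition lie :: "'a endo set" where
  "lie = {X. \<forall>t. exp (t *\<^sub>R X) \<in> G}"

definition orb :: "'a \<Rightarrow> 'a set" where
  "orb p = (\<lambda>g. endo_apply g p) ` G"

definition tangent :: "'a \<Rightarrow> 'a set" where
  "tangent p = (\<lambda>X. endo_apply X p) ` lie"

lemma power_G: "a \<in> G \<Longrightarrow> a ^ m \<in> G"
  by (induction m) (auto intro: one_G mult_G)

lemma closed_G: "closed G" using compact_G compact_imp_closed by blast

text \<open>The logarithm-free form of von Neumann's argument: \<open>g n\<close> is compared with \<open>exp (t n X)\<close> and
  both are raised to the power \<open>\<lfloor>s / t n\<rfloor>\<close>.\<close>

lemma tangent_limit_in_lie:
  assumes g: "\<And>n. g n \<in> G" and t: "\<And>n. 0 < t n" "t \<longlonglongrightarrow> 0"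
    and lim: "(\<lambda>n. (g n - 1) /\<^sub>R t n) \<longlonglongrightarrow> X"
  shows "X \<in> lie"
proof -
  have pos: "exp (s *\<^sub>R X) \<in> G" if s: "0 \<le> s" for s
  proof -
    \<comment> \<open>The number of steps of size \<open>t n\<close> that fit into time
      \<open>s\<close>, so that the powers below arrive near time \<open>s\<close>.\<close>
    define m where "m n = nat \<lfloor>s / t n\<rfloor>" for n
    define e where "e n = exp (t n *\<^sub>R X)" for n
    have m_le: "real (m n) * t n \<le> s" for n
    proof -
      have "real (m n) \<le> s / t n" using s t(1)[of n] by (simp add: m_def)
      then show ?thesis using t(1)[of n] by (simp add: field_simps)
    qed
    have m_ge: "s - t n \<le> real (m n) * t n" for n
    proof -
      have "s / t n - 1 \<le> real (m n)" unfolding m_def using s t(1)[of n] by linarith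
      then show ?thesis using t(1)[of n] by (simp add: field_simps)
    qed
    have m_lim: "(\<lambda>n. real (m n) * t n) \<longlonglongrightarrow> s"
    proof (rule tendsto_sandwich[of "\<lambda>n. s - t n" _ _ "\<lambda>_. s"])
      show "(\<lambda>n. s - t n) \<longlonglongrightarrow> s" using tendsto_diff[OF tendsto_const t(2), of s] by simp
    qed (auto simp: m_le m_ge)
    have "(\<lambda>n. exp ((real (m n) * t n) *\<^sub>R X)) \<longlonglongrightarrow> exp (s *\<^sub>R X)"
      using continuous_on_tendsto_compose[OF continuous_on_exp_scaleR[of UNIV X] m_lim] by simp
    then have e_lim: "(\<lambda>n. e n ^ m n) \<longlonglongrightarrow> exp (s *\<^sub>R X)"
      by (simp add: e_def exp_scaleR_power)
    \<comment> \<open>Both difference quotients on the right tend to \<open>X\<close>, and the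
      factor in front stays bounded because \<open>m n * t n \<le> s\<close>.\<close>
    have bound: "norm (g n ^ m n - e n ^ m n) \<le> s * exp (s * norm X) * norm ((g n - 1) /\<^sub>R t n - (e n - 1) /\<^sub>R t n)" for n
    proof -
      define \<beta> where "\<beta> = exp (t n * norm X)"
      have "norm (e n) \<le> \<beta>"
        using norm_exp[of "t n *\<^sub>R X"] t(1)[of n] by (simp add: e_def \<beta>_def)
      moreover have "1 \<le> \<beta>" using t(1)[of n] by (simp add: \<beta>_def)
      ultimately have "norm (g n ^ m n - e n ^ m n) \<le> real (m n) * norm (g n - e n) * \<beta> ^ m n"
        using norm_power_diff_le[OF norm_G[OF g]] by blast
      also have "\<beta> ^ m n = exp ((real (m n) * t n) * norm X)"
        by (simp add: \<beta>_def exp_of_nat_mult[symmetric] mult_ac)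
      also have "real (m n) * norm (g n - e n) * \<dots> \<le> real (m n) * norm (g n - e n) * exp (s * norm X)"
        using m_le[of n] by (intro mult_left_mono) (auto intro: mult_right_mono)
      also have "norm (g n - e n) = t n * norm ((g n - 1) /\<^sub>R t n - (e n - 1) /\<^sub>R t n)"
      proof -
        have "(g n - 1) /\<^sub>R t n - (e n - 1) /\<^sub>R t n = (g n - e n) /\<^sub>R t n"
          by (simp add: scaleR_diff_right)
        then show ?thesis using t(1)[of n] by simp
      qed
      also have "real (m n) * (t n * norm ((g n - 1) /\<^sub>R t n - (e n - 1) /\<^sub>R t n)) * exp (s * norm X)
          = (real (m n) * t n) * (exp (s * norm X) * norm ((g n - 1) /\<^sub>R t n - (e n - 1) /\<^sub>R t n))"
        by (simp add: mult_ac)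
      also have "\<dots> \<le> s * (exp (s * norm X) * norm ((g n - 1) /\<^sub>R t n - (e n - 1) /\<^sub>R t n))"
        using m_le[of n] by (intro mult_right_mono) auto
      finally show ?thesis by (simp add: mult_ac)
    qed
    have "(\<lambda>n. (e n - 1) /\<^sub>R t n) \<longlonglongrightarrow> X"
      unfolding e_def using t by (intro exp_scaleR_diff_quotient) (auto simp: less_imp_neq[symmetric])
    from tendsto_mult[OF tendsto_const tendsto_norm[OF tendsto_diff[OF lim this]], of "s * exp (s * norm X)"]
    have "(\<lambda>n. s * exp (s * norm X) * norm ((g n - 1) /\<^sub>R t n - (e n - 1) /\<^sub>R t n)) \<longlonglongrightarrow> 0"
      by simp
    then have "(\<lambda>n. g n ^ m n - e n ^ m n) \<longlonglongrightarrow> 0"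
      by (rule Lim_null_comparison[rotated]) (use bound in auto)
    from tendsto_add[OF this e_lim] have "(\<lambda>n. g n ^ m n) \<longlonglongrightarrow> exp (s *\<^sub>R X)" by simp
    with power_G[OF g] show ?thesis
      by (rule closed_sequentially[OF closed_G])
  qed
  \<comment> \<open>Inverses are unique, so the inverse in \<open>G\<close> of the exponential at
    the positive time \<open>- s\<close> is the exponential at time \<open>s\<close>.\<close>
  have "exp (s *\<^sub>R X) \<in> G" if "s < 0" for s
  proof -
    have "exp ((- s) *\<^sub>R X) \<in> G" using pos[of "- s"] that by simp
    then obtain h where h: "h \<in> G" "h * exp ((- s) *\<^sub>R X) = 1" using inverse_G by blast
    have "exp (s *\<^sub>R X) = h * exp ((- s) *\<^sub>R X) * exp (s *\<^sub>R X)" using h(2) by simp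
    also have "\<dots> = h" using exp_scaleR_minus_mult[of "- s" X] by (simp add: mult.assoc)
    finally show ?thesis using h(1) by simp
  qed
  then show ?thesis using pos unfolding lie_def mem_Collect_eq by (meson not_less)
qed

lemma inverse_nat_seq: "(0::real) < inverse (real (Suc n))" "(\<lambda>n. inverse (real (Suc n))) \<longlonglongrightarrow> 0"
  by (simp, rule LIMSEQ_inverse_real_of_nat)

lemma exp_lie: "X \<in> lie \<Longrightarrow> exp (t *\<^sub>R X) \<in> G"
  by (simp add: lie_def)

lemma lie_exp_quotient: "(\<lambda>n. (exp (inverse (real (Suc n)) *\<^sub>R X) - 1) /\<^sub>R inverse (real (Suc n))) \<longlonglongrightarrow> X"
  for X :: "'b::{real_normed_algebra_1, banach}"
  by (intro exp_scaleR_diff_quotient inverse_nat_seq) simp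

lemma lie_exp_tendsto: "(\<lambda>n. exp (inverse (real (Suc n)) *\<^sub>R X)) \<longlonglongrightarrow> 1"
  for X :: "'b::{real_normed_algebra_1, banach}"
  using continuous_on_tendsto_compose[OF continuous_on_exp_scaleR[of UNIV X] inverse_nat_seq(2)] by simp

text \<open>The product of the two one-parameter groups is a curve in \<open>G\<close> that leaves
  \<open>1\<close> with velocity \<open>X + Y\<close>, and \<open>tangent_limit_in_lie\<close> turns
  such a velocity into an element of the algebra.\<close>

lemma lie_add:
  assumes "X \<in> lie" "Y \<in> lie"
  shows "X + Y \<in> lie"
proof (rule tangent_limit_in_lie[OF _ inverse_nat_seq])
  let ?t = "\<lambda>n. inverse (real (Suc n))"
  show "exp (?t n *\<^sub>R X) * exp (?t n *\<^sub>R Y) \<in> G" for n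
    using assms by (intro mult_G exp_lie)
  have "(\<lambda>n. (exp (?t n *\<^sub>R X) - 1) /\<^sub>R ?t n * exp (?t n *\<^sub>R Y) + (exp (?t n *\<^sub>R Y) - 1) /\<^sub>R ?t n) \<longlonglongrightarrow> X * 1 + Y"
    by (intro tendsto_intros lie_exp_quotient lie_exp_tendsto)
  moreover have "(exp (?t n *\<^sub>R X) - 1) /\<^sub>R ?t n * exp (?t n *\<^sub>R Y) + (exp (?t n *\<^sub>R Y) - 1) /\<^sub>R ?t n
     = (exp (?t n *\<^sub>R X) * exp (?t n *\<^sub>R Y) - 1) /\<^sub>R ?t n" for n
    by (simp add: scaleR_diff_right left_diff_distrib)
  ultimately show "(\<lambda>n. (exp (?t n *\<^sub>R X) * exp (?t n *\<^sub>R Y) - 1) /\<^sub>R ?t n) \<longlonglongrightarrow> X + Y"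
    by simp
qed

lemma subspace_lie: "subspace lie"
  by (auto simp: subspace_def lie_add) (auto simp: lie_def one_G)

text \<open>The adjoint action, obtained from the conjugated curve. It compares the tangent spaces
  at two points of one orbit.\<close>

lemma lie_conj:
  assumes "X \<in> lie" "h \<in> G" "k \<in> G" "h * k = 1"
  shows "h * X * k \<in> lie"
proof (rule tangent_limit_in_lie[OF _ inverse_nat_seq])
  let ?t = "\<lambda>n. inverse (real (Suc n))"
  show "h * exp (?t n *\<^sub>R X) * k \<in> G" for n
    using assms by (intro mult_G exp_lie)
  have "(\<lambda>n. h * ((exp (?t n *\<^sub>R X) - 1) /\<^sub>R ?t n) * k) \<longlonglongrightarrow> h * X * k"
    by (intro tendsto_intros lie_exp_quotient)
  moreover have "h * ((exp (?t n *\<^sub>R X) - 1) /\<^sub>R ?t n) * k = (h * exp (?t n *\<^sub>R X) * k - 1) /\<^sub>R ?t n" for n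
    using assms(4) by (simp add: scaleR_diff_right right_diff_distrib left_diff_distrib)
  ultimately show "(\<lambda>n. (h * exp (?t n *\<^sub>R X) * k - 1) /\<^sub>R ?t n) \<longlonglongrightarrow> h * X * k"
    by simp
qed

lemma linear_endo_apply: "linear (endo_apply g)"
  by (rule bounded_linear.linear[OF endo_apply.bounded_linear_right])

lemma subspace_tangent: "subspace (tangent p)"
  unfolding tangent_def
  by (intro linear_subspace_image subspace_lie) (rule bounded_linear.linear[OF endo_apply.bounded_linear_left])

text \<open>With \<open>h\<close> the inverse of \<open>g\<close>,
  \<open>X (g p) = g ((h X g) p)\<close>: the tangent space at \<open>g p\<close> lies in the image
  under \<open>g\<close> of the one at \<open>p\<close>.\<close>

lemma dim_tangent_orbit_le:
  assumes "g \<in> G"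
  shows "dim (tangent (endo_apply g p)) \<le> dim (tangent p)"
proof -
  obtain h where h: "h \<in> G" "g * h = 1" "h * g = 1" using inverse_G[OF assms] by blast
  have "tangent (endo_apply g p) \<subseteq> endo_apply g ` tangent p"
  proof
    fix v assume "v \<in> tangent (endo_apply g p)"
    then obtain X where X: "X \<in> lie" "v = endo_apply X (endo_apply g p)" by (auto simp: tangent_def)
    have "h * X * g \<in> lie" using lie_conj[OF X(1) h(1) assms h(3)] .
    moreover have "v = endo_apply g (endo_apply (h * X * g) p)"
    proof -
      have "g * (h * X * g) = X * g" using h(2) by (simp add: mult.assoc[symmetric])
      then show ?thesis using X(2) by (metis endo_apply_mult)
    qed
    ultimately show "v \<in> endo_apply g ` tangent p" unfolding tangent_def by blast
  qed
  then show ?thesis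
    by (meson dim_image_le dim_subset linear_endo_apply order_trans)
qed

lemma dim_tangent_orbit:
  assumes "g \<in> G"
  shows "dim (tangent (endo_apply g p)) = dim (tangent p)"
proof -
  obtain h where h: "h \<in> G" "h * g = 1" using inverse_G[OF assms] by blast
  have "p = endo_apply h (endo_apply g p)" using h(2) endo_apply_mult endo_apply_one by metis
  then show ?thesis
    using dim_tangent_orbit_le[OF assms, of p] dim_tangent_orbit_le[OF h(1), of "endo_apply g p"] by simp
qed

lemma orb_eq:
  assumes "q \<in> orb p"
  shows "orb q = orb p"
proof -
  have le: "orb (endo_apply g x) \<subseteq> orb x" if "g \<in> G" for g x
    using that mult_G unfolding orb_def by (force simp flip: endo_apply_mult)
  obtain g where g: "g \<in> G" "q = endo_apply g p" using assms by (auto simp: orb_def)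
  obtain h where h: "h \<in> G" "h * g = 1" using inverse_G[OF g(1)] by blast
  have "p = endo_apply h q" using h(2) g(2) endo_apply_mult endo_apply_one by metis
  then show ?thesis using le[OF g(1), of p] le[OF h(1), of q] g(2) by auto
qed

text \<open>The curve \<open>exp (t X) p\<close> has derivative \<open>exp (t X) (X p) = 0\<close>,
  so it stays at its starting point.\<close>

lemma exp_fixes:
  assumes "endo_apply X p = 0"
  shows "endo_apply (exp (t *\<^sub>R X)) p = p"
proof -
  have "((\<lambda>t. endo_apply (exp (t *\<^sub>R X)) p) has_derivative (\<lambda>_. 0)) (at s within UNIV)" for s
    using bounded_linear.has_vector_derivative[OF endo_apply.bounded_linear_left
        exp_scaleR_has_vector_derivative_right[of X s UNIV], of p]
    by (simp add: has_vector_derivative_def assms endo_apply.zero_right)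
  then have "\<exists>c. \<forall>s\<in>UNIV. endo_apply (exp (s *\<^sub>R X)) p = c"
    by (intro has_derivative_zero_constant convex_UNIV)
  then obtain c where c: "endo_apply (exp (s *\<^sub>R X)) p = c" for s by auto
  from c[of t] c[of 0] show ?thesis by simp
qed

text \<open>The witness \<open>g\<close> with \<open>g p = p + n\<close> is taken nearest to \<open>1\<close>; the direction in which such
  witnesses approach \<open>1\<close> then lies in the stabiliser algebra of \<open>p\<close>, and dividing it out would
  produce a nearer one.\<close>

lemma orbit_transversal:
  "\<exists>\<eta>>0. \<forall>n. norm n < \<eta> \<longrightarrow> (\<forall>v\<in>tangent p. n \<bullet> v = 0) \<longrightarrow> p + n \<in> orb p \<longrightarrow> n = 0"
proof (rule ccontr)
  assume "\<not> ?thesis"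
  then have "\<forall>j. \<exists>n. norm n < inverse (real (Suc j)) \<and> (\<forall>v\<in>tangent p. n \<bullet> v = 0) \<and> p + n \<in> orb p \<and> n \<noteq> 0"
    by (metis inverse_nat_seq(1))
  then obtain n where n: "\<And>j. norm (n j) < inverse (real (Suc j))" "\<And>j v. v \<in> tangent p \<Longrightarrow> n j \<bullet> v = 0"
    "\<And>j. p + n j \<in> orb p" "\<And>j. n j \<noteq> 0" by metis
  have n_lim: "n \<longlonglongrightarrow> 0"
    by (rule Lim_null_comparison[OF always_eventually inverse_nat_seq(2)]) (use n(1) less_imp_le in blast)
  define S where "S j = {g \<in> G. endo_apply g p = p + n j}" for j
  have S_closed: "compact (S j)" for j
  proof -
    have "S j = G \<inter> (\<lambda>g. endo_apply g p) -` {p + n j}" by (auto simp: S_def)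
    moreover have "closed ((\<lambda>g. endo_apply g p) -` {p + n j})"
      by (intro closed_vimage closed_singleton linear_continuous_on endo_apply.bounded_linear_left)
    ultimately show ?thesis using compact_Int_closed[OF compact_G] by simp
  qed
  have S_ne: "S j \<noteq> {}" for j using n(3)[of j] by (auto simp: S_def orb_def)
  have "\<exists>g\<in>S j. \<forall>h\<in>S j. norm (g - 1) \<le> norm (h - 1)" for j
    by (rule continuous_attains_inf[OF S_closed S_ne]) (intro continuous_intros)
  then obtain g where g: "\<And>j. g j \<in> S j" "\<And>j h. h \<in> S j \<Longrightarrow> norm (g j - 1) \<le> norm (h - 1)" by metis
  define s where "s j = norm (g j - 1)" for j
  have gp: "endo_apply (g j) p = p + n j" and gG: "g j \<in> G" for j using g(1)[of j] by (auto simp: S_def)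
  have s_pos: "s j > 0" for j
    using gp[of j] n(4)[of j] by (auto simp: s_def)
  obtain k r where r: "k \<in> G" "strict_mono r" "(g \<circ> r) \<longlonglongrightarrow> k"
    using compact_G gG unfolding compact_def by metis
  have n_lim_r: "(\<lambda>j. n (r j)) \<longlonglongrightarrow> 0"
    using LIMSEQ_subseq_LIMSEQ[OF n_lim r(2)] by (simp add: o_def)
  have "(\<lambda>j. endo_apply (g (r j)) p) \<longlonglongrightarrow> endo_apply k p"
    using endo_apply.tendsto[OF r(3) tendsto_const, of p] by (simp add: o_def)
  moreover have "(\<lambda>j. endo_apply (g (r j)) p) \<longlonglongrightarrow> p"
    unfolding gp using tendsto_add[OF tendsto_const n_lim_r, of p] by simp
  ultimately have kp: "endo_apply k p = p" by (rule LIMSEQ_unique)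
  obtain k' where k': "k' \<in> G" "k * k' = 1" "k' * k = 1" using inverse_G[OF r(1)] by blast
  have k'p: "endo_apply k' p = p" using kp k'(3) endo_apply_mult endo_apply_one by metis
  \<comment> \<open>The limit \<open>k\<close> need not be \<open>1\<close>, but it fixes
    \<open>p\<close>. Dividing by it gives further witnesses, and these tend to \<open>1\<close>; so
    the nearest ones do as well.\<close>
  have s_le: "s (r j) \<le> norm (g (r j) * k' - 1)" for j
    unfolding s_def using gG gp k' k'p mult_G by (intro g(2)) (auto simp: S_def)
  have "(\<lambda>j. g (r j) * k' - 1) \<longlonglongrightarrow> k * k' - 1"
    using r(3) by (intro tendsto_intros) (simp add: o_def)
  then have "(\<lambda>j. norm (g (r j) * k' - 1)) \<longlonglongrightarrow> 0"
    using k'(2) tendsto_norm_zero by fastforce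
  then have s_lim: "(\<lambda>j. s (r j)) \<longlonglongrightarrow> 0"
    by (rule Lim_null_comparison[rotated]) (use s_le s_pos in \<open>auto simp: less_imp_le\<close>)
  define Y where "Y j = (g (r j) - 1) /\<^sub>R s (r j)" for j
  have Y_norm: "norm (Y j) = 1" for j
    using s_pos[of "r j"] by (simp add: Y_def) (simp add: s_def)
  then have "bounded (range Y)" by (auto simp: bounded_iff)
  then obtain X r' where r': "strict_mono r'" "(Y \<circ> r') \<longlonglongrightarrow> X"
    using bounded_imp_convergent_subsequence by blast
  define a where "a j = g (r (r' j))" for j
  define b where "b j = s (r (r' j))" for j
  have Y_lim: "(\<lambda>j. (a j - 1) /\<^sub>R b j) \<longlonglongrightarrow> X"
    using r'(2) by (simp add: o_def Y_def a_def b_def)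
  have b_lim: "b \<longlonglongrightarrow> 0"
    using LIMSEQ_subseq_LIMSEQ[OF s_lim r'(1)] by (simp add: o_def b_def[abs_def])
  have b_pos: "b j > 0" for j by (simp add: b_def s_pos)
  have X_lie: "X \<in> lie"
    by (rule tangent_limit_in_lie[OF _ b_pos b_lim Y_lim]) (simp add: a_def gG)
  have "(\<lambda>j. endo_apply ((a j - 1) /\<^sub>R b j) p) \<longlonglongrightarrow> endo_apply X p"
    by (rule endo_apply.tendsto[OF Y_lim tendsto_const])
  then have Xp_lim: "(\<lambda>j. n (r (r' j)) /\<^sub>R b j) \<longlonglongrightarrow> endo_apply X p"
    by (simp add: endo_apply.scaleR_left endo_apply.diff_left a_def gp)
  have Xp_T: "endo_apply X p \<in> tangent p" using X_lie by (auto simp: tangent_def)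
  \<comment> \<open>The vector \<open>endo_apply X p\<close> is tangent, and it is a limit of
    multiples of the normal vectors \<open>n\<close>; hence it is orthogonal to itself.\<close>
  have "(\<lambda>j. (n (r (r' j)) /\<^sub>R b j) \<bullet> endo_apply X p) \<longlonglongrightarrow> endo_apply X p \<bullet> endo_apply X p"
    by (intro tendsto_intros Xp_lim)
  then have "endo_apply X p \<bullet> endo_apply X p = 0"
    using n(2)[OF Xp_T] by (simp add: LIMSEQ_const_iff)
  then have Xp0: "endo_apply X p = 0" by simp
  have fix_exp: "endo_apply (exp (t *\<^sub>R X)) p = p" for t using exp_fixes[OF Xp0] .
  \<comment> \<open>The exponential fixes \<open>p\<close>, so the product is another witness for
    the same normal vector and, by minimality, no nearer to \<open>1\<close> than
    \<open>a j\<close>.\<close>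
  have ge1: "1 \<le> norm ((a j * exp ((- b j) *\<^sub>R X) - 1) /\<^sub>R b j)" for j
  proof -
    have "a j * exp ((- b j) *\<^sub>R X) \<in> S (r (r' j))"
      using gG gp fix_exp[of "- b j"] exp_lie[OF X_lie, of "- b j"] by (auto simp: S_def a_def intro!: mult_G)
    then have "b j \<le> norm (a j * exp ((- b j) *\<^sub>R X) - 1)"
      using g(2) by (simp add: b_def s_def)
    then show ?thesis using b_pos[of j] by (simp only: norm_scaleR) (simp add: field_simps)
  qed
  \<comment> \<open>To first order \<open>a j\<close> is \<open>1 + b j X\<close>, and
    multiplication by the exponential cancels exactly this term.\<close>
  have lim0: "(\<lambda>j. (a j * exp ((- b j) *\<^sub>R X) - 1) /\<^sub>R b j) \<longlonglongrightarrow> 0"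
  proof -
    have "(\<lambda>j. exp ((- b j) *\<^sub>R X)) \<longlonglongrightarrow> exp ((- 0) *\<^sub>R X)"
      by (rule continuous_on_tendsto_compose[OF continuous_on_exp_scaleR[of UNIV X] tendsto_minus[OF b_lim]]) auto
    then have 1: "(\<lambda>j. exp ((- b j) *\<^sub>R X)) \<longlonglongrightarrow> 1" by simp
    have 2: "(\<lambda>j. (exp ((- b j) *\<^sub>R X) - 1) /\<^sub>R (- b j)) \<longlonglongrightarrow> X"
      using tendsto_minus[OF b_lim] b_pos by (intro exp_scaleR_diff_quotient) (auto simp: less_imp_neq[symmetric])
    have "(\<lambda>j. (a j - 1) /\<^sub>R b j * exp ((- b j) *\<^sub>R X) - (exp ((- b j) *\<^sub>R X) - 1) /\<^sub>R (- b j)) \<longlonglongrightarrow> X * 1 - X"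
      by (intro tendsto_intros Y_lim 1 2)
    moreover have "(a j - 1) /\<^sub>R b j * exp ((- b j) *\<^sub>R X) - (exp ((- b j) *\<^sub>R X) - 1) /\<^sub>R (- b j)
      = (a j * exp ((- b j) *\<^sub>R X) - 1) /\<^sub>R b j" for j
      by (simp add: scaleR_diff_right left_diff_distrib)
    ultimately show ?thesis by simp
  qed
  have "1 \<le> norm (0 :: 'a endo)"
    by (rule tendsto_lowerbound[OF tendsto_norm[OF lim0]]) (use ge1 in auto)
  then show False by simp
qed

end

section \<open>Exponential coordinates\<close>

text \<open>Functions of the form exponential applied to a regular vector field are closed under
  differentiation: the derivative has the same exponential and a new field, built from
  \<open>w\<close> and its derivative. Hence the induction runs over all \<open>w\<close>.\<close>

lemma Ck_on_exp_action:
  assumes "Ck_on n UNIV w"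
  shows "Ck_on n UNIV (\<lambda>z::'a::euclidean_space. endo_apply (exp ((z \<bullet> b) *\<^sub>R X)) (w z))"
  using assms
proof (induction n arbitrary: w)
  case 0
  have "continuous_on UNIV (\<lambda>z. exp ((z \<bullet> b) *\<^sub>R X))"
    by (rule continuous_on_compose2[OF continuous_on_exp_scaleR[of UNIV X]])
      (auto intro: continuous_intros)
  then show ?case
    using 0 endo_apply.continuous_on by auto
next
  case (Suc n)
  let ?E = "\<lambda>z. exp ((z \<bullet> b) *\<^sub>R X)"
  show ?case
  proof (rule Ck_on_SucI[OF open_UNIV, of _ "\<lambda>z v. endo_apply (?E z) (frechet_derivative w (at z) v + (v \<bullet> b) *\<^sub>R endo_apply X (w z))"])
    fix z
    have "((\<lambda>s. exp (s *\<^sub>R X)) has_derivative (\<lambda>s. s *\<^sub>R (?E z * X))) (at (z \<bullet> b))"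
      using exp_scaleR_has_vector_derivative_right[of X "z \<bullet> b" UNIV]
      by (simp add: has_vector_derivative_def)
    from has_derivative_compose[OF has_derivative_inner_left[OF has_derivative_ident] this]
    have "(?E has_derivative (\<lambda>v. (v \<bullet> b) *\<^sub>R (?E z * X))) (at z)" .
    from endo_apply.FDERIV[OF this Ck_on_Suc_has_derivative[OF Suc.prems UNIV_I]]
    show "((\<lambda>z. endo_apply (?E z) (w z)) has_derivative
       (\<lambda>v. endo_apply (?E z) (frechet_derivative w (at z) v + (v \<bullet> b) *\<^sub>R endo_apply X (w z)))) (at z)"
      by (simp add: endo_apply.add_right endo_apply.scaleR_right endo_apply.scaleR_left)
  next
    fix v
    have "Ck_on n UNIV (\<lambda>z. endo_apply X (w z))"
      by (rule Ck_on_linear_compose[OF open_UNIV endo_apply.bounded_linear_right Ck_on_Suc_imp[OF Suc.prems]])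
    then show "Ck_on n UNIV (\<lambda>z. endo_apply (?E z) (frechet_derivative w (at z) v + (v \<bullet> b) *\<^sub>R endo_apply X (w z)))"
      using Suc.prems by (intro Suc.IH Ck_on_add Ck_on_scaleR Ck_on_const open_UNIV) simp
  qed
qed

text \<open>Strict differentiability at \<open>0\<close>: both points move. It controls the distance
  between \<open>f x\<close> and \<open>f y\<close> for all pairs near \<open>0\<close>, which
  differentiability at the single point \<open>0\<close> does not.\<close>

definition strict_deriv0 :: "('a::real_normed_vector \<Rightarrow> 'b::real_normed_vector) \<Rightarrow> ('a \<Rightarrow> 'b) \<Rightarrow> bool" where
  "strict_deriv0 f D \<longleftrightarrow> (\<forall>e>0. \<exists>\<rho>>0. \<forall>x y. norm x < \<rho> \<longrightarrow> norm y < \<rho> \<longrightarrow>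
     norm (f x - f y - D (x - y)) \<le> e * norm (x - y))"

lemma strict_deriv0_has_derivative:
  assumes "strict_deriv0 f D" "bounded_linear D"
  shows "(f has_derivative D) (at 0)"
  unfolding has_derivative_at_alt
proof (intro conjI assms(2) allI impI)
  fix e :: real assume "e > 0"
  then obtain \<rho> where "\<rho> > 0" "\<And>x y. norm x < \<rho> \<Longrightarrow> norm y < \<rho> \<Longrightarrow> norm (f x - f y - D (x - y)) \<le> e * norm (x - y)"
    using assms(1) unfolding strict_deriv0_def by blast
  then show "\<exists>d>0. \<forall>y. norm (y - 0) < d \<longrightarrow> norm (f y - f 0 - D (y - 0)) \<le> e * norm (y - 0)"
    by (intro exI[of _ \<rho>]) (metis diff_zero norm_zero)
qed

lemma strict_deriv0_isCont: 
  assumes "strict_deriv0 f D" "bounded_linear D" "\<delta> > 0"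
  obtains \<rho> where "\<rho> > 0" "\<And>x. norm x < \<rho> \<Longrightarrow> norm (f x - f 0) \<le> \<delta>"
proof -
  have "isCont f 0"
    using has_derivative_continuous[OF strict_deriv0_has_derivative[OF assms(1,2)]] .
  then obtain \<rho> where "\<rho> > 0" "\<And>x. dist x 0 < \<rho> \<Longrightarrow> dist (f x) (f 0) < \<delta>"
    using assms(3) unfolding continuous_at_eps_delta dist_norm by metis
  then show thesis by (intro that[of \<rho>]) (auto simp: dist_norm less_imp_le)
qed

text \<open>The group law reduces a pair of times \<open>s\<close>, \<open>t\<close> to the single
  increment \<open>u = s - t\<close>, where ordinary differentiability at \<open>0\<close> is
  enough; the factor \<open>exp (t X)\<close> is close to \<open>1\<close>.\<close>

lemma strict_deriv0_exp:
  fixes b :: "'a::real_inner" and X :: "'b::{real_normed_algebra_1, banach}"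
  assumes "norm b = 1"
  shows "strict_deriv0 (\<lambda>z. exp ((z \<bullet> b) *\<^sub>R X)) (\<lambda>h. (h \<bullet> b) *\<^sub>R X)"
  unfolding strict_deriv0_def
proof (intro allI impI)
  fix e :: real assume e: "e > 0"
  \<comment> \<open>The error splits into two halves of \<open>e\<close>: \<open>2 * (e / 4)\<close>
    from the derivative at \<open>0\<close>, and \<open>\<delta> * norm X\<close> from replacing
    \<open>exp (t X)\<close> by \<open>1\<close>.\<close>
  define \<delta> where "\<delta> = min 1 (e / (2 * (norm X + 1)))"
  have \<delta>: "\<delta> > 0" "\<delta> \<le> 1" "\<delta> * norm X \<le> e / 2"
  proof -
    have X1: "norm X + 1 > 0" using norm_ge_zero[of X] by linarith
    then show "\<delta> > 0" "\<delta> \<le> 1" using e by (auto simp: \<delta>_def)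
    have "\<delta> * norm X \<le> e / (2 * (norm X + 1)) * (norm X + 1)"
      using e X1 by (intro mult_mono) (auto simp: \<delta>_def)
    also have "e / (2 * c) * c = e / 2" if "c > 0" for c :: real using that by simp
    finally show "\<delta> * norm X \<le> e / 2" using X1 by simp
  qed
  have "isCont (\<lambda>s. exp (s *\<^sub>R X)) 0"
    using continuous_on_exp_scaleR[of UNIV X] by (simp add: continuous_on_eq_continuous_at)
  then obtain \<rho>1 where \<rho>1: "\<rho>1 > 0" "\<And>s. dist s 0 < \<rho>1 \<Longrightarrow> dist (exp (s *\<^sub>R X)) (exp (0 *\<^sub>R X)) < \<delta>"
    using \<delta>(1) unfolding continuous_at_eps_delta dist_norm by metis
  have small: "norm (exp (s *\<^sub>R X) - 1) \<le> \<delta>" if "\<bar>s\<bar> < \<rho>1" for s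
    using \<rho>1(2)[of s] that by (simp add: dist_norm)
  have "((\<lambda>s. exp (s *\<^sub>R X)) has_derivative (\<lambda>s. s *\<^sub>R X)) (at 0)"
    using exp_scaleR_has_vector_derivative_right[of X 0 UNIV] by (simp add: has_vector_derivative_def)
  then obtain \<rho>2 where \<rho>2: "\<rho>2 > 0"
    "\<And>u. norm (u - 0) < \<rho>2 \<Longrightarrow> norm (exp (u *\<^sub>R X) - exp (0 *\<^sub>R X) - (u - 0) *\<^sub>R X) \<le> e / 4 * norm (u - 0)"
    using e unfolding has_derivative_at_alt by (meson divide_pos_pos zero_less_numeral)
  \<comment> \<open>Half of \<open>\<rho>2\<close>, because the increment \<open>u\<close> is a
    difference of two times below \<open>\<rho>\<close>.\<close>
  define \<rho> where "\<rho> = min \<rho>1 (\<rho>2 / 2)"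
  have "norm (exp ((x \<bullet> b) *\<^sub>R X) - exp ((y \<bullet> b) *\<^sub>R X) - ((x - y) \<bullet> b) *\<^sub>R X) \<le> e * norm (x - y)"
    if "norm x < \<rho>" "norm y < \<rho>" for x y
  proof -
    define s where "s = x \<bullet> b"
    define t where "t = y \<bullet> b"
    define u where "u = s - t"
    have le: "\<bar>z \<bullet> b\<bar> \<le> norm z" for z using Cauchy_Schwarz_ineq2[of z b] assms by simp
    have st: "\<bar>s\<bar> < \<rho>" "\<bar>t\<bar> < \<rho>" using le[of x] le[of y] that by (auto simp: s_def t_def)
    have u: "\<bar>u\<bar> \<le> norm (x - y)" using le[of "x - y"] by (simp add: u_def s_def t_def inner_diff_left)
    have "\<bar>u\<bar> < \<rho>2" using st by (auto simp: u_def \<rho>_def)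
    then have 1: "norm (exp (u *\<^sub>R X) - 1 - u *\<^sub>R X) \<le> e / 4 * \<bar>u\<bar>" using \<rho>2(2)[of u] by simp
    have 2: "norm (exp (t *\<^sub>R X) - 1) \<le> \<delta>" using small st(2) by (simp add: \<rho>_def)
    have 3: "norm (exp (t *\<^sub>R X)) \<le> 2"
      using 2 \<delta>(2) norm_triangle_ineq[of "exp (t *\<^sub>R X) - 1" 1] by simp
    have "exp (s *\<^sub>R X) = exp (t *\<^sub>R X + u *\<^sub>R X)" by (simp add: u_def flip: scaleR_add_left)
    also have "\<dots> = exp (t *\<^sub>R X) * exp (u *\<^sub>R X)" by (rule exp_add_commuting) simp
    finally have "exp (s *\<^sub>R X) - exp (t *\<^sub>R X) - u *\<^sub>R X =
        exp (t *\<^sub>R X) * (exp (u *\<^sub>R X) - 1 - u *\<^sub>R X) + (exp (t *\<^sub>R X) - 1) * (u *\<^sub>R X)"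
      by (simp add: right_diff_distrib left_diff_distrib scaleR_diff_right)
    also have "norm \<dots> \<le> norm (exp (t *\<^sub>R X)) * norm (exp (u *\<^sub>R X) - 1 - u *\<^sub>R X) + norm (exp (t *\<^sub>R X) - 1) * norm (u *\<^sub>R X)"
      by (intro norm_triangle_mono norm_mult_ineq)
    also have "\<dots> \<le> 2 * (e / 4 * \<bar>u\<bar>) + \<delta> * (\<bar>u\<bar> * norm X)"
      using 1 2 3 \<delta> e by (intro add_mono mult_mono) auto
    also have "\<dots> \<le> 2 * (e / 4 * \<bar>u\<bar>) + e / 2 * \<bar>u\<bar>"
      using mult_right_mono[OF \<delta>(3), of "\<bar>u\<bar>"] by (simp add: mult_ac)
    also have "\<dots> = e * \<bar>u\<bar>" by simp
    also have "\<dots> \<le> e * norm (x - y)" using u e by (simp add: mult_left_mono)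
    finally show ?thesis by (simp add: s_def t_def u_def inner_diff_left)
  qed
  moreover have "\<rho> > 0" using \<rho>1 \<rho>2 by (simp add: \<rho>_def)
  ultimately show "\<exists>\<rho>>0. \<forall>x y. norm x < \<rho> \<longrightarrow> norm y < \<rho> \<longrightarrow>
     norm (exp ((x \<bullet> b) *\<^sub>R X) - exp ((y \<bullet> b) *\<^sub>R X) - ((x - y) \<bullet> b) *\<^sub>R X) \<le> e * norm (x - y)" by blast
qed

text \<open>Since both values at \<open>0\<close> are \<open>1\<close>, the derivative of the
  product is the plain sum; this is all that a product of one-parameter groups asks for.\<close>

lemma strict_deriv0_mult:
  fixes f g :: "'a::real_normed_vector \<Rightarrow> 'b::real_normed_algebra_1"
  assumes f: "strict_deriv0 f Df" "bounded_linear Df" "f 0 = 1"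
    and g: "strict_deriv0 g Dg" "bounded_linear Dg" "g 0 = 1"
  shows "strict_deriv0 (\<lambda>x. f x * g x) (\<lambda>h. Df h + Dg h)"
  unfolding strict_deriv0_def
proof (intro allI impI)
  fix e :: real assume e: "e > 0"
  obtain Kf where Kf: "Kf \<ge> 0" "\<And>h. norm (Df h) \<le> norm h * Kf"
    using bounded_linear.nonneg_bounded[OF f(2)] by blast
  obtain Kg where Kg: "Kg \<ge> 0" "\<And>h. norm (Dg h) \<le> norm h * Kg"
    using bounded_linear.nonneg_bounded[OF g(2)] by blast
  \<comment> \<open>The four error terms below add up to
    \<open>(3 * e1 + (Kf + Kg + 1) * \<delta>) * norm h\<close>; this choice of \<open>e1\<close>
    and the following one of \<open>\<delta>\<close> leave at most five eighths of
    \<open>e\<close>.\<close>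
  define e1 where "e1 = min 1 (e / 8)"
  have e1: "e1 > 0" "e1 \<le> 1" "e1 \<le> e / 8" using e by (auto simp: e1_def)
  define \<delta> where "\<delta> = min 1 (e / (4 * (Kf + Kg + 1)))"
  have \<delta>: "\<delta> > 0" "\<delta> \<le> 1" "(Kf + Kg + 1) * \<delta> \<le> e / 4"
  proof -
    have K1: "Kf + Kg + 1 > 0" using Kf(1) Kg(1) by linarith
    then show "\<delta> > 0" "\<delta> \<le> 1" using e by (auto simp: \<delta>_def)
    have "(Kf + Kg + 1) * \<delta> \<le> (Kf + Kg + 1) * (e / (4 * (Kf + Kg + 1)))"
      using K1 by (intro mult_left_mono) (auto simp: \<delta>_def)
    also have "c * (e / (4 * c)) = e / 4" if "c > 0" for c :: real using that by simp
    finally show "(Kf + Kg + 1) * \<delta> \<le> e / 4" using K1 by simp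
  qed
  obtain \<rho>1 where \<rho>1: "\<rho>1 > 0" "\<And>x. norm x < \<rho>1 \<Longrightarrow> norm (f x - f 0) \<le> \<delta>"
    using strict_deriv0_isCont[OF f(1,2) \<delta>(1)] by blast
  obtain \<rho>2 where \<rho>2: "\<rho>2 > 0" "\<And>x. norm x < \<rho>2 \<Longrightarrow> norm (g x - g 0) \<le> \<delta>"
    using strict_deriv0_isCont[OF g(1,2) \<delta>(1)] by blast
  obtain \<rho>3 where \<rho>3: "\<rho>3 > 0" "\<And>x y. norm x < \<rho>3 \<Longrightarrow> norm y < \<rho>3 \<Longrightarrow> norm (f x - f y - Df (x - y)) \<le> e1 * norm (x - y)"
    using f(1) e1(1) unfolding strict_deriv0_def by metis
  obtain \<rho>4 where \<rho>4: "\<rho>4 > 0" "\<And>x y. norm x < \<rho>4 \<Longrightarrow> norm y < \<rho>4 \<Longrightarrow> norm (g x - g y - Dg (x - y)) \<le> e1 * norm (x - y)"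
    using g(1) e1(1) unfolding strict_deriv0_def by metis
  define \<rho> where "\<rho> = min (min \<rho>1 \<rho>2) (min \<rho>3 \<rho>4)"
  have "norm (f x * g x - f y * g y - (Df (x - y) + Dg (x - y))) \<le> e * norm (x - y)"
    if xy: "norm x < \<rho>" "norm y < \<rho>" for x y
  proof -
    define h where "h = x - y"
    have F: "norm (f x - f y - Df h) \<le> e1 * norm h" and G: "norm (g x - g y - Dg h) \<le> e1 * norm h"
      using \<rho>3 \<rho>4 xy by (auto simp: \<rho>_def h_def)
    have gx: "norm (g x - 1) \<le> \<delta>" and fy: "norm (f y - 1) \<le> \<delta>"
      using \<rho>1(2)[of y] \<rho>2(2)[of x] xy f(3) g(3) by (auto simp: \<rho>_def)
    have gx2: "norm (g x) \<le> 2" using gx \<delta>(2) norm_triangle_ineq[of "g x - 1" 1] by simp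
    have gxy: "norm (g x - g y) \<le> (1 + Kg) * norm h"
    proof -
      have "norm (g x - g y) \<le> norm (g x - g y - Dg h) + norm (Dg h)"
        using norm_triangle_ineq[of "g x - g y - Dg h" "Dg h"] by simp
      also have "\<dots> \<le> e1 * norm h + norm h * Kg" using G Kg by (intro add_mono) auto
      also have "\<dots> \<le> 1 * norm h + norm h * Kg" using e1(2) by (intro add_right_mono mult_right_mono) auto
      finally show ?thesis by (simp add: algebra_simps)
    qed
    have "f x * g x - f y * g y - (Df h + Dg h) = 
       ((f x - f y - Df h) * g x + Df h * (g x - 1)) + ((f y - 1) * (g x - g y) + (g x - g y - Dg h))"
      by (simp add: algebra_simps)
    also have "norm \<dots> \<le> (norm (f x - f y - Df h) * norm (g x) + norm (Df h) * norm (g x - 1))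
        + (norm (f y - 1) * norm (g x - g y) + norm (g x - g y - Dg h))"
      by (intro norm_triangle_mono norm_mult_ineq order_refl)
    also have "\<dots> \<le> (e1 * norm h * 2 + norm h * Kf * \<delta>) + (\<delta> * ((1 + Kg) * norm h) + e1 * norm h)"
      using F G gx fy gx2 gxy Kf Kg \<delta> e1 by (intro add_mono mult_mono) (auto intro: mult_nonneg_nonneg)
    also have "\<dots> = (3 * e1 + (Kf + Kg + 1) * \<delta>) * norm h" by (simp add: algebra_simps)
    also have "\<dots> \<le> e * norm h" using e1 \<delta> e by (intro mult_right_mono) auto
    finally show ?thesis by (simp add: h_def)
  qed
  moreover have "\<rho> > 0" using \<rho>1 \<rho>2 \<rho>3 \<rho>4 by (simp add: \<rho>_def)
  ultimately show "\<exists>\<rho>>0. \<forall>x y. norm x < \<rho> \<longrightarrow> norm y < \<rho> \<longrightarrow>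
     norm (f x * g x - f y * g y - (Df (x - y) + Dg (x - y))) \<le> e * norm (x - y)" by blast
qed

text \<open>Canonical coordinates of the second kind: one exponential per generator, multiplied in
  the order of the list, since the factors need not commute. Differentiation can proceed factor by
  factor, as it could not for the exponential of a sum.\<close>

definition exp_chain :: "('a::euclidean_space \<Rightarrow> 'a endo) \<Rightarrow> 'a list \<Rightarrow> 'a \<Rightarrow> 'a endo" where
  "exp_chain A bs z = prod_list (map (\<lambda>b. exp ((z \<bullet> b) *\<^sub>R A b)) bs)"

lemma exp_chain_0: "exp_chain A bs 0 = 1"
  unfolding exp_chain_def by (induction bs) auto

lemma Ck_on_exp_chain_action:
  assumes "Ck_on n UNIV w"
  shows "Ck_on n UNIV (\<lambda>z. endo_apply (exp_chain A bs z) (w z))"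
  unfolding exp_chain_def
  using assms by (induction bs) (simp_all add: Ck_on_exp_action)

lemma bounded_linear_inner_scaleR_sum:
  "bounded_linear (\<lambda>h. \<Sum>b\<leftarrow>bs. (h \<bullet> b) *\<^sub>R A b)"
proof (induction bs)
  case (Cons b bs)
  then show ?case
    by (simp add: bounded_linear_add bounded_linear_scaleR_const bounded_linear_inner_left)
qed (simp add: bounded_linear_zero)

lemma strict_deriv0_exp_chain:
  assumes "\<And>b. b \<in> set bs \<Longrightarrow> norm b = 1"
  shows "strict_deriv0 (exp_chain A bs) (\<lambda>h. \<Sum>b\<leftarrow>bs. (h \<bullet> b) *\<^sub>R A b)"
  using assms
proof (induction bs)
  case Nil
  then show ?case by (auto simp: strict_deriv0_def exp_chain_def intro: exI[of _ 1])
next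
  case (Cons b bs)
  have "strict_deriv0 (\<lambda>z. exp ((z \<bullet> b) *\<^sub>R A b) * exp_chain A bs z) (\<lambda>h. (h \<bullet> b) *\<^sub>R A b + (\<Sum>b\<leftarrow>bs. (h \<bullet> b) *\<^sub>R A b))"
    using Cons by (intro strict_deriv0_mult strict_deriv0_exp bounded_linear_inner_scaleR_sum
        bounded_linear_scaleR_const bounded_linear_inner_left)
      (auto simp: exp_chain_0)
  then show ?case by (simp add: exp_chain_def[abs_def])
qed

section \<open>Orbits as submanifolds\<close>

text \<open>The change of charts at a common point maps a nonempty relatively open piece of
  \<open>L\<close> continuously and injectively into \<open>L'\<close>; invariance of dimension does
  the rest. It makes the description in \<open>orbit_dim\<close> unique.\<close>

lemma submanifold_of_dim_le:
  fixes S :: "'a::euclidean_space set"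
  assumes "submanifold_of_dim d S" "submanifold_of_dim d' S" "S \<noteq> {}"
  shows "d \<le> d'"
proof -
  obtain p where p: "p \<in> S" using assms(3) by blast
  obtain U V L and \<Phi> \<Psi> :: "'a \<Rightarrow> 'a" where 1: "open U" "p \<in> U" "open V" "homeomorphism U V \<Phi> \<Psi>"
    "subspace L" "dim L = d" "\<Phi> ` (S \<inter> U) = L \<inter> V"
    using assms(1) p unfolding submanifold_of_dim_def by meson
  obtain U' V' L' and \<Phi>' \<Psi>' :: "'a \<Rightarrow> 'a" where 2: "open U'" "p \<in> U'" "open V'" "homeomorphism U' V' \<Phi>' \<Psi>'"
    "subspace L'" "dim L' = d'" "\<Phi>' ` (S \<inter> U') = L' \<inter> V'"
    using assms(2) p unfolding submanifold_of_dim_def by meson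
  have cont: "continuous_on V \<Psi>" "continuous_on U' \<Phi>'" using 1(4) 2(4) by (auto simp: homeomorphism_def)
  define W where "W = V \<inter> \<Psi> -` U'"
  have "open W" unfolding W_def by (rule continuous_open_preimage[OF cont(1) 1(3) 2(1)])
  have mem: "\<Psi> y \<in> S \<inter> U \<inter> U'" if "y \<in> L \<inter> W" for y
  proof -
    have "y \<in> \<Phi> ` (S \<inter> U)" using that 1(7) by (auto simp: W_def)
    then show ?thesis using that 1(4) by (auto simp: W_def homeomorphism_def)
  qed
  have "dim L \<le> dim L'"
  proof (rule invariance_of_dimension_subspaces[of L "L \<inter> W" L' "\<lambda>y. \<Phi>' (\<Psi> y)"])
    show "openin (top_of_set L) (L \<inter> W)" using \<open>open W\<close> by (simp add: openin_open_Int)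
    show "continuous_on (L \<inter> W) (\<lambda>y. \<Phi>' (\<Psi> y))"
      by (rule continuous_on_compose2[OF cont(2) continuous_on_subset[OF cont(1)]]) (auto simp: W_def)
    show "(\<lambda>y. \<Phi>' (\<Psi> y)) \<in> L \<inter> W \<rightarrow> L'" using mem 2(7) by fastforce
    show "inj_on (\<lambda>y. \<Phi>' (\<Psi> y)) (L \<inter> W)"
    proof (rule inj_onI)
      fix y z assume yz: "y \<in> L \<inter> W" "z \<in> L \<inter> W" "\<Phi>' (\<Psi> y) = \<Phi>' (\<Psi> z)"
      then have "\<Psi> y = \<Psi> z" using mem[OF yz(1)] mem[OF yz(2)] 2(4) by (metis IntE homeomorphism_apply1)
      then show "y = z" using yz(1,2) 1(4) by (metis IntE W_def homeomorphism_apply2)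
    qed
    have "\<Phi> p \<in> L \<inter> V" using 1(2,7) p by blast
    moreover have "\<Psi> (\<Phi> p) = p" using 1(2,4) by (simp add: homeomorphism_apply1)
    ultimately show "L \<inter> W \<noteq> {}" using 2(2) by (auto simp: W_def)
  qed (use 1 2 in auto)
  then show ?thesis using 1 2 by simp
qed

context compact_endo_group begin

lemma exp_chain_G:
  assumes "\<And>b. b \<in> set bs \<Longrightarrow> A b \<in> lie"
  shows "exp_chain A bs z \<in> G"
  unfolding exp_chain_def using assms by (induction bs) (auto intro: one_G mult_G exp_lie)

text \<open>An orthonormal basis of the tangent space, each vector lifted to a generator in the
  algebra that produces it at \<open>p\<close>. Both the charts and the packing of the orbit start
  from this frame.\<close>

lemma tangent_frame:
  "\<exists>bs A. distinct bs \<and> length bs = dim (tangent p) \<and> pairwise orthogonal (set bs) \<and>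
    (\<forall>b\<in>set bs. norm b = 1) \<and> span (set bs) = tangent p \<and>
    (\<forall>b\<in>set bs. A b \<in> lie) \<and> (\<forall>b\<in>set bs. endo_apply (A b) p = b)"
proof -
  obtain B where B: "B \<subseteq> tangent p" "pairwise orthogonal B" "\<And>x. x \<in> B \<Longrightarrow> norm x = 1"
    "independent B" "card B = dim (tangent p)" "span B = tangent p"
    using orthonormal_basis_subspace[OF subspace_tangent] by metis
  obtain bs where bs: "set bs = B" "distinct bs"
    using finite_distinct_list[OF finiteI_independent[OF B(4)]] by blast
  have "\<forall>b\<in>B. \<exists>X. X \<in> lie \<and> endo_apply X p = b" using B(1) by (auto simp: tangent_def)
  then obtain A where "\<And>b. b \<in> B \<Longrightarrow> A b \<in> lie \<and> endo_apply (A b) p = b" by metis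
  then show ?thesis using B bs distinct_card[OF bs(2)] by (intro exI[of _ bs] exI[of _ A]) auto
qed

end

text \<open>In finite dimension continuity in each direction is continuity in the operator norm,
  which is the form that the inverse function theorem asks for.\<close>

lemma Ck_on_continuous_frechet:
  assumes "open S" "Ck_on 1 S f"
  shows "continuous_on S (\<lambda>x. Blinfun (frechet_derivative f (at x)))"
    and "\<And>x. x \<in> S \<Longrightarrow> blinfun_apply (Blinfun (frechet_derivative f (at x))) = frechet_derivative f (at x)"
proof -
  show eq: "blinfun_apply (Blinfun (frechet_derivative f (at x))) = frechet_derivative f (at x)" if "x \<in> S" for x
    using Ck_on_Suc_has_derivative[of 0 S f x] assms(2) that
    by (intro bounded_linear_Blinfun_apply has_derivative_bounded_linear) auto
  show "continuous_on S (\<lambda>x. Blinfun (frechet_derivative f (at x)))"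
  proof (rule continuous_on_blinfun_componentwise)
    fix i :: 'a
    have "continuous_on S (\<lambda>x. frechet_derivative f (at x) i)" using assms(2) by simp
    then show "continuous_on S (\<lambda>x. blinfun_apply (Blinfun (frechet_derivative f (at x))) i)"
      by (rule continuous_on_eq) (simp add: eq)
  qed
qed

text \<open>Coordinates are fixed here because smoothness of the inverse chart goes through
  determinants in \<open>Ck_on_inverse_function\<close>.\<close>

locale compact_matrix_group = compact_endo_group G for G :: "(real^'m) endo set"
begin

text \<open>The map \<open>F\<close> moves the tangential part of \<open>z\<close> along the group
  and the normal part straight off the orbit. Its derivative at \<open>0\<close> is the identity, so
  its local inverse is a chart; it flattens the orbit because the orbit does not return to
  \<open>p\<close> from a small normal direction.\<close>

lemma orbit_chart:
  fixes p :: "real^'m"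
  shows "\<exists>U V (\<Phi> :: real^'m \<Rightarrow> real^'m) \<Psi> L. open U \<and> p \<in> U \<and> open V \<and> homeomorphism U V \<Phi> \<Psi> \<and>
     smooth_on U \<Phi> \<and> smooth_on V \<Psi> \<and> subspace L \<and> dim L = dim (tangent p) \<and> \<Phi> ` (orb p \<inter> U) = L \<inter> V"
proof -
  obtain bs and A :: "real^'m \<Rightarrow> (real^'m) endo" where bs: "distinct bs" "length bs = dim (tangent p)" "pairwise orthogonal (set bs)"
    "\<And>b. b \<in> set bs \<Longrightarrow> norm b = 1" "span (set bs) = tangent p"
    "\<And>b. b \<in> set bs \<Longrightarrow> A b \<in> lie" "\<And>b. b \<in> set bs \<Longrightarrow> endo_apply (A b) p = b"
    using tangent_frame[of p] by blast
  define P where "P z = (\<Sum>b\<in>set bs. (z \<bullet> b) *\<^sub>R b)" for z :: "real^'m"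
  define E where "E = exp_chain A bs"
  define F where "F z = endo_apply (E z) (p + z - P z)" for z
  have P_lin: "bounded_linear P"
    unfolding P_def by (intro bounded_linear_sum bounded_linear_scaleR_const bounded_linear_inner_left)
  have P_T: "P z \<in> tangent p" for z
    unfolding P_def bs(5)[symmetric] by (intro span_sum span_scale span_base)
  have P_id: "P z = z" if "z \<in> tangent p" for z
    unfolding P_def using that bs(3,4,5) by (intro orthonormal_basis_expand) auto
  have P_inner: "P z \<bullet> b = z \<bullet> b" if "b \<in> set bs" for z b
  proof -
    have "P z \<bullet> b = (\<Sum>c\<in>set bs. (z \<bullet> c) * (c \<bullet> b))" by (simp add: P_def inner_sum_left)
    also have "\<dots> = (\<Sum>c\<in>set bs. if c = b then z \<bullet> c else 0)"
      using bs(3,4) that by (intro sum.cong) (auto simp: pairwise_def orthogonal_def dot_square_norm)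
    also have "\<dots> = z \<bullet> b" using that by simp
    finally show ?thesis .
  qed
  have P_perp: "(z - P z) \<bullet> v = 0" if "v \<in> tangent p" for z v
  proof -
    have "orthogonal (z - P z) v"
      using that unfolding bs(5)[symmetric]
      by (rule orthogonal_to_span) (simp add: orthogonal_def inner_diff_left P_inner)
    then show ?thesis by (simp add: orthogonal_def)
  qed
  have P_norm: "norm (z - P z) \<le> norm z" for z
  proof -
    have "(norm z)\<^sup>2 = (norm (z - P z))\<^sup>2 + (norm (P z))\<^sup>2"
      using norm_add_Pythagorean[of "z - P z" "P z"] P_perp[OF P_T] by (simp add: orthogonal_def)
    then have "(norm (z - P z))\<^sup>2 \<le> (norm z)\<^sup>2" by simp
    then show ?thesis by (rule power2_le_imp_le) simp
  qed
  have F_smooth: "Ck_on n UNIV F" for n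
    unfolding F_def E_def
    by (intro Ck_on_exp_chain_action Ck_on_diff Ck_on_add Ck_on_const Ck_on_bounded_linear P_lin
        bounded_linear_ident open_UNIV)
  have F_der: "(F has_derivative frechet_derivative F (at z)) (at z)" for z
    by (rule Ck_on_Suc_has_derivative[OF F_smooth UNIV_I])
  have E0: "E 0 = 1" by (simp add: E_def exp_chain_0)
  have P0: "P 0 = 0" by (simp add: P_def)
  have F0: "F 0 = p" by (simp add: F_def E0 P0)
  \<comment> \<open>The generators satisfy \<open>endo_apply (A b) p = b\<close>, so the group
    factor contributes \<open>P h\<close>; the translated argument contributes
    \<open>h - P h\<close>.\<close>
  have F_der0: "frechet_derivative F (at 0) = id"
  proof -
    define D where "D h = (\<Sum>b\<leftarrow>bs. (h \<bullet> b) *\<^sub>R A b)" for h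
    have D: "D h = (\<Sum>b\<in>set bs. (h \<bullet> b) *\<^sub>R A b)" for h
      unfolding D_def by (rule sum_list_distinct_conv_sum_set[OF bs(1)])
    have "(E has_derivative D) (at 0)"
      unfolding E_def D_def
      by (intro strict_deriv0_has_derivative strict_deriv0_exp_chain bounded_linear_inner_scaleR_sum bs(4))
    moreover have "((\<lambda>z. p + z - P z) has_derivative (\<lambda>h. h - P h)) (at 0)"
      by (auto intro!: derivative_eq_intros bounded_linear.has_derivative[OF P_lin])
    ultimately have "(F has_derivative (\<lambda>h. endo_apply (E 0) (h - P h) + endo_apply (D h) (p + 0 - P 0))) (at 0)"
      unfolding F_def by (rule endo_apply.FDERIV)
    moreover have "endo_apply (D h) p = P h" for h
      unfolding D endo_apply.sum_left P_def
      by (intro sum.cong refl) (simp add: endo_apply.scaleR_left bs(7))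
    ultimately have "(F has_derivative id) (at 0)" by (simp add: E0 P0 id_def)
    then show ?thesis using frechet_derivative_at by metis
  qed
  note F1 = Ck_on_continuous_frechet[OF open_UNIV F_smooth[of 1]]
  define F' where "F' z = Blinfun (frechet_derivative F (at z))" for z
  have F': "blinfun_apply (F' z) = frechet_derivative F (at z)" for z
    unfolding F'_def using F1(2) by simp
  have 1: "id_blinfun o\<^sub>L F' 0 = id_blinfun"
    by (rule blinfun_eqI) (simp add: F' F_der0)
  have 2: "(F has_derivative blinfun_apply (F' z)) (at z)" for z
    using F_der F' by simp
  have 3: "continuous_on UNIV F'" using F1(1) by (simp add: F'_def[abs_def])
  obtain U' V g g' where inv: "open U'" "0 \<in> U'" "open V" "F 0 \<in> V" "homeomorphism U' V F g"
    "\<And>y. y \<in> V \<Longrightarrow> (g has_derivative (g' y)) (at y)"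
    "\<And>y. y \<in> V \<Longrightarrow> g' y = inv (blinfun_apply (F' (g y)))"
    "\<And>y. y \<in> V \<Longrightarrow> bij (blinfun_apply (F' (g y)))"
    by (rule inverse_function_theorem[OF open_UNIV 2 3 UNIV_I 1]) metis
  have g_smooth: "Ck_on n V g" for n
    by (rule Ck_on_inverse_function[OF inv(3) _ F_smooth inv(6)]) (use inv(7,8) in \<open>auto simp: F'\<close>)
  obtain \<eta> where \<eta>: "\<eta> > 0" "\<And>n. norm n < \<eta> \<Longrightarrow> (\<And>v. v \<in> tangent p \<Longrightarrow> n \<bullet> v = 0) \<Longrightarrow> p + n \<in> orb p \<Longrightarrow> n = 0"
    using orbit_transversal[of p] by meson
  \<comment> \<open>The radius \<open>\<eta>\<close> keeps the normal part of \<open>z\<close> small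
    enough for \<open>orbit_transversal\<close>.\<close>
  define W where "W = U' \<inter> ball 0 \<eta>"
  define U where "U = V \<inter> g -` W"
  have cont: "continuous_on V g" using inv(5) by (simp add: homeomorphism_def)
  have gF: "g (F z) = z" "F z \<in> V" if "z \<in> U'" for z
    using inv(5) that by (auto simp: homeomorphism_def)
  have Fg: "F (g y) = y" "g y \<in> U'" if "y \<in> V" for y
    using inv(5) that by (auto simp: homeomorphism_def)
  have "open W" using inv(1) by (simp add: W_def open_Int)
  have "open U" unfolding U_def by (rule continuous_open_preimage[OF cont inv(3) \<open>open W\<close>])
  have "p \<in> U" using inv(2,4) \<eta>(1) gF[of 0] by (simp add: U_def W_def F0)
  have hom: "homeomorphism U W g F"
  proof (rule homeomorphism_symD, rule homeomorphismI)
    show "continuous_on W F" using Ck_on_imp_continuous_on[OF F_smooth] continuous_on_subset by blast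
    show "continuous_on U g" by (rule continuous_on_subset[OF cont]) (simp add: U_def)
    show "F ` W \<subseteq> U" using gF by (auto simp: U_def W_def)
    show "g ` U \<subseteq> W" by (auto simp: U_def)
    show "g (F z) = z" if "z \<in> W" for z using gF that by (simp add: W_def)
    show "F (g y) = y" if "y \<in> U" for y using Fg that by (simp add: U_def)
  qed
  have E_G: "E z \<in> G" for z unfolding E_def by (rule exp_chain_G[OF bs(6)])
  have "g ` (orb p \<inter> U) = tangent p \<inter> W"
  proof (intro equalityI subsetI)
    fix z assume "z \<in> g ` (orb p \<inter> U)"
    then obtain y where y: "y \<in> orb p" "y \<in> U" "z = g y" by blast
    have zW: "z \<in> W" and Fz: "F z = y" using y Fg by (auto simp: U_def)
    obtain h where h: "h \<in> G" "h * E z = 1" using inverse_G[OF E_G] by blast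
    obtain k where k: "k \<in> G" "y = endo_apply k p" using y(1) by (auto simp: orb_def)
    \<comment> \<open>Undoing the group element \<open>E z\<close> leaves the point displaced from
      \<open>p\<close> in a purely normal direction and still on the orbit, so that the displacement
      must vanish.\<close>
    have "endo_apply h y = p + (z - P z)"
      unfolding Fz[symmetric] F_def endo_apply_mult[symmetric] h(2) by simp
    then have "p + (z - P z) = endo_apply (h * k) p" using k(2) by simp
    then have "p + (z - P z) \<in> orb p" using mult_G[OF h(1) k(1)] unfolding orb_def by blast
    moreover have "norm (z - P z) < \<eta>" using P_norm[of z] zW by (simp add: W_def)
    ultimately have "z - P z = 0" using \<eta>(2) P_perp by blast
    then show "z \<in> tangent p \<inter> W" using P_T[of z] zW by simp
  next
    fix z assume z: "z \<in> tangent p \<inter> W"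
    then have "F z = endo_apply (E z) p" by (simp add: F_def P_id)
    then have "F z \<in> orb p" using E_G by (auto simp: orb_def)
    moreover have "F z \<in> U" "g (F z) = z" using z hom by (auto simp: homeomorphism_def)
    ultimately show "z \<in> g ` (orb p \<inter> U)" by (metis IntI imageI)
  qed
  moreover have "smooth_on U g"
    unfolding smooth_on_def U_def by (intro allI Ck_on_subset_open[OF g_smooth]) simp
  moreover have "smooth_on W F"
    unfolding smooth_on_def by (intro allI Ck_on_subset_open[OF F_smooth]) simp
  ultimately show ?thesis
    using \<open>open U\<close> \<open>p \<in> U\<close> \<open>open W\<close> hom subspace_tangent by blast
qed

text \<open>At each point \<open>q\<close> of the orbit the chart is built from the tangent space at
  \<open>q\<close> itself; conjugation shows that its dimension does not depend on
  \<open>q\<close>.\<close>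

lemma submanifold_orb: "submanifold_of_dim (dim (tangent p)) (orb p)"
  unfolding submanifold_of_dim_def
proof
  fix q assume q: "q \<in> orb p"
  then have "orb q = orb p" "dim (tangent q) = dim (tangent p)"
    using orb_eq dim_tangent_orbit by (auto simp: orb_def)
  then show "\<exists>U V (\<Phi> :: real^'m \<Rightarrow> real^'m) \<Psi> L. open U \<and> q \<in> U \<and> open V \<and> homeomorphism U V \<Phi> \<Psi> \<and>
     smooth_on U \<Phi> \<and> smooth_on V \<Psi> \<and> subspace L \<and> dim L = dim (tangent p) \<and> \<Phi> ` (orb p \<inter> U) = L \<inter> V"
    using orbit_chart[of q] by simp
qed

lemma orb_ne: "orb p \<noteq> {}" using one_G by (auto simp: orb_def)

lemma the_submanifold_dim: "(THE d. submanifold_of_dim d (orb p)) = dim (tangent p)"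
  using submanifold_of_dim_le[OF submanifold_orb[of p] _ orb_ne] submanifold_of_dim_le[OF _ submanifold_orb[of p] orb_ne]
  by (intro the_equality submanifold_orb) (blast intro: antisym)

end

lemma compact_orthogonal_group_endo:
  fixes G :: "(real^'m^'m) set"
  assumes "compact_orthogonal_group G"
  shows "compact_matrix_group (matrix_endo ` G)"
proof
  note G = assms[unfolded compact_orthogonal_group_def]
  show "compact (matrix_endo ` G)"
    using G by (intro compact_continuous_image continuous_on_matrix_endo) auto
  show "1 \<in> matrix_endo ` G" using G matrix_endo_one by (metis imageI)
  show "a * b \<in> matrix_endo ` G" if "a \<in> matrix_endo ` G" "b \<in> matrix_endo ` G" for a b
    using that G by (auto simp flip: matrix_endo_mult)
  show "\<exists>b\<in>matrix_endo ` G. a * b = 1 \<and> b * a = 1" if a: "a \<in> matrix_endo ` G" for a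
  proof -
    obtain g where g: "g \<in> G" "a = matrix_endo g" using a by blast
    have "invertible g" using G g(1) orthogonal_matrix_def invertible_def by metis
    then have "g ** matrix_inv g = mat 1 \<and> matrix_inv g ** g = mat 1"
      unfolding invertible_def matrix_inv_def by (rule someI_ex)
    moreover have "matrix_inv g \<in> G" using G g(1) by blast
    ultimately show ?thesis
      by (intro bexI[of _ "matrix_endo (matrix_inv g)"]) (simp_all add: g(2) matrix_endo_one flip: matrix_endo_mult)
  qed
  show "norm a \<le> 1" if a: "a \<in> matrix_endo ` G" for a
  proof -
    obtain g where g: "g \<in> G" "a = matrix_endo g" using a by blast
    have "orthogonal_transformation ((*v) g)"
      using G g(1) by (simp add: orthogonal_transformation_matrix)
    then have "norm (endo_apply a x) = norm x" for x
      by (simp add: g(2) orthogonal_transformation_norm)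
    then show ?thesis
      unfolding norm_endo.rep_eq by (intro norm_blinfun_bound) (auto simp: endo_apply.rep_eq)
  qed
qed

section \<open>Separated points on orbits\<close>

context compact_endo_group begin

text \<open>A grid of width \<open>4 * r\<close> in a fixed ball of the tangent space at
  \<open>p\<close> is sent into \<open>G\<close> by \<open>exp_chain\<close>. By strict
  differentiability the action on any \<open>x\<close> near \<open>p\<close> keeps at least half of
  the distances, so about \<open>r ^ - dim\<close> separated points of the orbit of \<open>x\<close>
  result, even if its own tangent space differs from that at \<open>p\<close>.\<close>

lemma orbit_separated_points:
  assumes "k \<le> dim (tangent p)"
  shows "\<exists>\<delta>>0. \<exists>c>0. \<exists>r0>0. \<forall>x r. dist x p < \<delta> \<longrightarrow> 0 < r \<longrightarrow> r < r0 \<longrightarrow>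
    (\<exists>J. finite J \<and> J \<subseteq> G \<and> c / r ^ k \<le> real (card J) \<and>
      (\<forall>a\<in>J. \<forall>b\<in>J. a \<noteq> b \<longrightarrow> 2 * r \<le> dist (endo_apply a x) (endo_apply b x)))"
proof -
  obtain bs and A :: "'a \<Rightarrow> 'a endo" where bs: "distinct bs" "length bs = dim (tangent p)" "pairwise orthogonal (set bs)"
    "\<And>b. b \<in> set bs \<Longrightarrow> norm b = 1" "span (set bs) = tangent p"
    "\<And>b. b \<in> set bs \<Longrightarrow> A b \<in> lie" "\<And>b. b \<in> set bs \<Longrightarrow> endo_apply (A b) p = b"
    using tangent_frame[of p] by blast
  define B where "B = set bs"
  define d where "d = card B"
  have d: "d = dim (tangent p)" using distinct_card[OF bs(1)] bs(2) by (simp add: d_def B_def)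
  have finB: "finite B" by (simp add: B_def)
  define E where "E = exp_chain A bs"
  define D where "D h = (\<Sum>b\<leftarrow>bs. (h \<bullet> b) *\<^sub>R A b)" for h
  have E_G: "E z \<in> G" for z unfolding E_def by (rule exp_chain_G[OF bs(6)])
  have D_lin: "bounded_linear D" unfolding D_def by (rule bounded_linear_inner_scaleR_sum)
  have D_p: "endo_apply (D h) p = h" if "h \<in> tangent p" for h
  proof -
    have "endo_apply (D h) p = (\<Sum>b\<in>B. (h \<bullet> b) *\<^sub>R endo_apply (A b) p)"
      unfolding D_def sum_list_distinct_conv_sum_set[OF bs(1)] endo_apply.sum_left B_def
      by (simp add: endo_apply.scaleR_left)
    also have "\<dots> = (\<Sum>b\<in>B. (h \<bullet> b) *\<^sub>R b)" by (intro sum.cong) (auto simp: bs(7) B_def)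
    also have "\<dots> = h"
      using that bs(3,4,5) by (intro orthonormal_basis_expand) (auto simp: B_def)
    finally show ?thesis .
  qed
  obtain M where M: "M \<ge> 0" "\<And>h. norm (D h) \<le> norm h * M"
    using bounded_linear.nonneg_bounded[OF D_lin] by blast
  \<comment> \<open>Near \<open>p\<close> one has \<open>norm x \<le> norm p + 1\<close>, so that
    the error of strict differentiability is at most a quarter of \<open>norm h\<close>.\<close>
  define \<kappa> where "\<kappa> = 1 / (4 * (norm p + 1))"
  have p1: "norm p + 1 > 0" using norm_ge_zero[of p] by linarith
  have \<kappa>: "\<kappa> > 0" using p1 by (simp add: \<kappa>_def)
  have "strict_deriv0 E D" unfolding E_def D_def by (rule strict_deriv0_exp_chain[OF bs(4)])
  then obtain \<rho> where \<rho>: "\<rho> > 0"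
    "\<And>x y. norm x < \<rho> \<Longrightarrow> norm y < \<rho> \<Longrightarrow> norm (E x - E y - D (x - y)) \<le> \<kappa> * norm (x - y)"
    using \<kappa> unfolding strict_deriv0_def by blast
  \<comment> \<open>Replacing the base point \<open>p\<close> by \<open>x\<close> costs another
    quarter; half of the distance remains.\<close>
  define \<delta> where "\<delta> = min 1 (1 / (4 * (M + 1)))"
  have \<delta>: "\<delta> > 0" "\<delta> \<le> 1" "M * \<delta> \<le> 1 / 4"
  proof -
    show "\<delta> > 0" "\<delta> \<le> 1" using M(1) by (auto simp: \<delta>_def)
    have "M * \<delta> \<le> (M + 1) * (1 / (4 * (M + 1)))"
      using M(1) by (intro mult_mono) (auto simp: \<delta>_def)
    also have "\<dots> = 1 / 4" using M(1) by simp
    finally show "M * \<delta> \<le> 1 / 4" .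
  qed
  have sep: "norm (z - w) / 2 \<le> dist (endo_apply (E z) x) (endo_apply (E w) x)"
    if x: "dist x p < \<delta>" and zw: "z \<in> tangent p" "w \<in> tangent p" "norm z < \<rho>" "norm w < \<rho>" for x z w
  proof -
    define h where "h = z - w"
    have h: "h \<in> tangent p" unfolding h_def by (rule subspace_diff[OF subspace_tangent zw(1,2)])
    have 1: "norm (endo_apply (E z - E w - D h) x) \<le> norm h / 4"
    proof -
      have "norm x \<le> norm p + 1"
        using x \<delta>(2) norm_triangle_ineq[of "x - p" p] by (simp add: dist_norm)
      then have "norm (E z - E w - D h) * norm x \<le> (\<kappa> * norm h) * (norm p + 1)"
        using \<rho>(2)[OF zw(3,4)] \<kappa> by (intro mult_mono) (auto simp: h_def)
      also have "(1 / (4 * c) * a) * c = a / 4" if "c > 0" for a c :: real using that by simp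
      then have "(\<kappa> * norm h) * (norm p + 1) = norm h / 4" using p1 unfolding \<kappa>_def by blast
      finally show ?thesis using norm_endo_apply[of "E z - E w - D h" x] by linarith
    qed
    have 2: "norm (endo_apply (D h) (x - p)) \<le> norm h / 4"
    proof -
      have "norm (D h) * norm (x - p) \<le> (norm h * M) * \<delta>"
        using M x by (intro mult_mono) (auto simp: dist_norm)
      also have "\<dots> \<le> norm h * (1 / 4)" using mult_left_mono[OF \<delta>(3), of "norm h"] by (simp add: mult.assoc)
      finally show ?thesis using norm_endo_apply[of "D h" "x - p"] by simp
    qed
    have "endo_apply (E z) x - endo_apply (E w) x =
        endo_apply (D h) p + endo_apply (D h) (x - p) + endo_apply (E z - E w - D h) x"
      by (simp add: endo_apply.diff_left endo_apply.diff_right)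
    then have "endo_apply (E z) x - endo_apply (E w) x = h + endo_apply (D h) (x - p) + endo_apply (E z - E w - D h) x"
      by (simp add: D_p[OF h])
    then have "h = (endo_apply (E z) x - endo_apply (E w) x) - endo_apply (D h) (x - p) - endo_apply (E z - E w - D h) x"
      by (simp add: algebra_simps)
    then have "norm h = norm ((endo_apply (E z) x - endo_apply (E w) x) - endo_apply (D h) (x - p) - endo_apply (E z - E w - D h) x)"
      by (rule arg_cong)
    also have "\<dots> \<le> norm (endo_apply (E z) x - endo_apply (E w) x) + norm (endo_apply (D h) (x - p)) + norm (endo_apply (E z - E w - D h) x)"
      using norm_triangle_ineq4[of "(endo_apply (E z) x - endo_apply (E w) x) - endo_apply (D h) (x - p)" "endo_apply (E z - E w - D h) x"]
        norm_triangle_ineq4[of "endo_apply (E z) x - endo_apply (E w) x" "endo_apply (D h) (x - p)"] by linarith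
    finally have "norm h \<le> norm (endo_apply (E z) x - endo_apply (E w) x) + norm (endo_apply (D h) (x - p)) + norm (endo_apply (E z - E w - D h) x)" .
    then show ?thesis using 1 2 by (simp add: h_def dist_norm)
  qed
  \<comment> \<open>With \<open>r < r0\<close> the quotient \<open>q\<close> exceeds
    \<open>1\<close>, so the grid is not empty. The divisor \<open>real d + 1\<close> keeps the
    whole grid inside the ball of radius \<open>\<rho>\<close> and is nonzero even for
    \<open>d = 0\<close>. The constant \<open>c\<close> is chosen so that
    \<open>c / r ^ k = (q / 2) ^ k\<close>.\<close>
  define r0 where "r0 = \<rho> / (4 * (real d + 1))"
  define c where "c = (\<rho> / (8 * (real d + 1))) ^ k"
  have "\<exists>J. finite J \<and> J \<subseteq> G \<and> c / r ^ k \<le> real (card J) \<and>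
      (\<forall>a\<in>J. \<forall>b\<in>J. a \<noteq> b \<longrightarrow> 2 * r \<le> dist (endo_apply a x) (endo_apply b x))"
    if x: "dist x p < \<delta>" and r: "0 < r" "r < r0" for x r
  proof -
    \<comment> \<open>\<open>sep\<close> halves distances, and \<open>2 * r\<close> has to
      remain.\<close>
    define s where "s = 4 * r"
    define q where "q = \<rho> / (s * (real d + 1))"
    define K where "K = nat \<lfloor>q\<rfloor>"
    have s: "s > 0" using r by (simp add: s_def)
    have "s * (real d + 1) < \<rho>"
      using r(2) by (simp add: s_def r0_def pos_less_divide_eq mult_ac)
    then have q1: "1 < q" using s by (simp add: q_def)
    have K1: "1 \<le> K" using q1 by (simp add: K_def le_nat_iff)
    have K_le: "real K \<le> q" using q1 by (simp add: K_def)
    have K_ge: "q / 2 \<le> real K" 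
    proof -
      have "real K = real_of_int \<lfloor>q\<rfloor>" using q1 by (simp add: K_def)
      then show ?thesis using K1 by linarith
    qed
    define z where "z f = (\<Sum>b\<in>B. (s * real (f b)) *\<^sub>R b)" for f :: "'a \<Rightarrow> nat"
    have zT: "z f \<in> tangent p" for f
      unfolding z_def bs(5)[symmetric] B_def by (intro span_sum span_scale span_base)
    have z_inner: "z f \<bullet> b = s * real (f b)" if "b \<in> B" for f b
    proof -
      have "z f \<bullet> b = (\<Sum>a\<in>B. (s * real (f a)) * (a \<bullet> b))" by (simp add: z_def inner_sum_left)
      also have "\<dots> = (\<Sum>a\<in>B. if a = b then s * real (f a) else 0)"
        using bs(3,4) that by (intro sum.cong) (auto simp: pairwise_def orthogonal_def dot_square_norm B_def)
      also have "\<dots> = s * real (f b)" using that finB by simp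
      finally show ?thesis .
    qed
    define F where "F = PiE B (\<lambda>_. {..<K})"
    have z_norm: "norm (z f) < \<rho>" if "f \<in> F" for f
    proof -
      have "norm (z f) \<le> (\<Sum>b\<in>B. s * q)"
        unfolding z_def
      proof (rule sum_norm_le)
        fix b assume b: "b \<in> B"
        have "real (f b) \<le> q" using that b K_le by (auto simp: F_def PiE_def Pi_def intro: order_trans[OF less_imp_le])
        then show "norm ((s * real (f b)) *\<^sub>R b) \<le> s * q" using s b bs(4) by (simp add: B_def mult_left_mono)
      qed
      also have "\<dots> = real d * \<rho> / (real d + 1)" using s by (simp add: d_def q_def)
      also have "\<dots> < \<rho>" using \<rho>(1) by (simp add: field_simps)
      finally show ?thesis .
    qed
    have z_sep: "s \<le> norm (z f - z g)" if fg: "f \<in> F" "g \<in> F" "f \<noteq> g" for f g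
    proof -
      have "\<exists>b\<in>B. f b \<noteq> g b"
        using PiE_ext[OF fg(1,2)[unfolded F_def]] fg(3) by blast
      then obtain b where b: "b \<in> B" "f b \<noteq> g b" by blast
      have "1 \<le> \<bar>real (f b) - real (g b)\<bar>" using b(2) by linarith
      then have "s \<le> \<bar>s * real (f b) - s * real (g b)\<bar>"
        using s by (simp add: abs_mult right_diff_distrib[symmetric] del: right_diff_distrib)
      also have "\<dots> = \<bar>(z f - z g) \<bullet> b\<bar>" by (simp add: inner_diff_left z_inner b(1))
      also have "\<dots> \<le> norm (z f - z g)" using Cauchy_Schwarz_ineq2[of "z f - z g" b] bs(4) b(1) by (simp add: B_def)
      finally show ?thesis .
    qed
    have E_sep: "2 * r \<le> dist (endo_apply (E (z f)) x) (endo_apply (E (z g)) x)" if "f \<in> F" "g \<in> F" "f \<noteq> g" for f g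
      using sep[OF x zT zT z_norm[OF that(1)] z_norm[OF that(2)]] z_sep[OF that] by (simp add: s_def)
    have inj: "inj_on (\<lambda>f. E (z f)) F"
    proof (rule inj_onI, rule ccontr)
      fix f g assume "f \<in> F" "g \<in> F" "E (z f) = E (z g)" "f \<noteq> g"
      then show False using E_sep[of f g] r(1) by simp
    qed
    have "\<rho> / (8 * D) / r = \<rho> / (4 * r * D) / 2" for D :: real
      by (simp add: mult_ac)
    from this[of "real d + 1"] have "c / r ^ k = (q / 2) ^ k"
      unfolding c_def q_def s_def power_divide[symmetric] by (rule arg_cong)
    also have "\<dots> \<le> real K ^ k" using K_ge q1 by (intro power_mono) auto
    \<comment> \<open>Tangent directions beyond the first \<open>k\<close> only add points, because
      \<open>K \<ge> 1\<close>.\<close>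
    also have "\<dots> \<le> real K ^ d" using K1 assms d by (intro power_increasing) auto
    also have "\<dots> = real (card ((\<lambda>f. E (z f)) ` F))"
      using card_image[OF inj] finB by (simp add: F_def card_PiE d_def)
    finally have "c / r ^ k \<le> real (card ((\<lambda>f. E (z f)) ` F))" .
    moreover have "finite ((\<lambda>f. E (z f)) ` F)" using finB by (simp add: F_def finite_PiE)
    moreover have "\<forall>a\<in>(\<lambda>f. E (z f)) ` F. \<forall>b\<in>(\<lambda>f. E (z f)) ` F. a \<noteq> b \<longrightarrow> 2 * r \<le> dist (endo_apply a x) (endo_apply b x)"
    proof (intro ballI impI; elim imageE)
      fix a b f g assume "a \<noteq> b" "a = E (z f)" "b = E (z g)" "f \<in> F" "g \<in> F"
      then show "2 * r \<le> dist (endo_apply a x) (endo_apply b x)" using E_sep[of f g] by blast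
    qed
    moreover have "(\<lambda>f. E (z f)) ` F \<subseteq> G" using E_G by blast
    ultimately show ?thesis by blast
  qed
  moreover have "r0 > 0" "c > 0" using \<rho>(1) by (auto simp: r0_def c_def)
  ultimately show ?thesis using \<delta>(1) by (intro exI[of _ \<delta>] exI[of _ c] exI[of _ r0] conjI allI impI) assumption+
qed

text \<open>The constants at \<open>p\<close> serve a whole neighbourhood of \<open>p\<close>, so a
  finite subcover and the smallest of its constants suffice.\<close>

lemma uniform_orbit_separated_points:
  assumes "compact K" "\<And>p. p \<in> K \<Longrightarrow> k \<le> dim (tangent p)"
  obtains c r0 where "c > 0" "r0 > 0"
    "\<And>x r. x \<in> K \<Longrightarrow> 0 < r \<Longrightarrow> r < r0 \<Longrightarrow> \<exists>J. finite J \<and> J \<subseteq> G \<and> c / r ^ k \<le> real (card J) \<and>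
      (\<forall>a\<in>J. \<forall>b\<in>J. a \<noteq> b \<longrightarrow> 2 * r \<le> dist (endo_apply a x) (endo_apply b x))"
proof -
  define Q where "Q x r c \<longleftrightarrow> (\<exists>J. finite J \<and> J \<subseteq> G \<and> c / r ^ k \<le> real (card J) \<and>
      (\<forall>a\<in>J. \<forall>b\<in>J. a \<noteq> b \<longrightarrow> 2 * r \<le> dist (endo_apply a x) (endo_apply b x)))" for x and r c :: real
  have "\<exists>\<delta>>0. \<exists>c>0. \<exists>r0>0. \<forall>x r. dist x p < \<delta> \<longrightarrow> 0 < r \<longrightarrow> r < r0 \<longrightarrow> Q x r c" if "p \<in> K" for p
    using orbit_separated_points[OF assms(2)[OF that]] unfolding Q_def .
  then have "\<forall>p\<in>K. \<exists>\<delta> c r0. \<delta> > 0 \<and> c > 0 \<and> r0 > 0 \<and> (\<forall>x r. dist x p < \<delta> \<longrightarrow> 0 < r \<longrightarrow> r < r0 \<longrightarrow> Q x r c)"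
    by blast
  then obtain \<delta> c r0 where *: "\<And>p. p \<in> K \<Longrightarrow> \<delta> p > 0 \<and> c p > 0 \<and> r0 p > 0 \<and>
      (\<forall>x r. dist x p < \<delta> p \<longrightarrow> 0 < r \<longrightarrow> r < r0 p \<longrightarrow> Q x r (c p))"
    unfolding bchoice_iff by blast
  have "K \<subseteq> (\<Union>p\<in>K. ball p (\<delta> p))" using * by force
  from compactE_image[OF assms(1) open_ball this] obtain C where C: "C \<subseteq> K" "finite C" "K \<subseteq> (\<Union>p\<in>C. ball p (\<delta> p))"
    by metis
  \<comment> \<open>The element \<open>1\<close> keeps the minimum meaningful when the cover is
    empty.\<close>
  define c' where "c' = Min (insert 1 (c ` C))"
  define r' where "r' = Min (insert 1 (r0 ` C))"
  have "c' > 0" "r' > 0" using * C(1,2) by (auto simp: c'_def r'_def Min_gr_iff)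
  moreover have "Q x r c'" if x: "x \<in> K" "0 < r" "r < r'" for x r
  proof -
    obtain p where p: "p \<in> C" "x \<in> ball p (\<delta> p)" using C(3) x(1) by blast
    have "r' \<le> r0 p" "c' \<le> c p" using C(2) p(1) by (auto simp: r'_def c'_def intro!: Min_le)
    then have "Q x r (c p)" using *[of p] p C(1) x by (auto simp: dist_commute)
    moreover have "c' / r ^ k \<le> c p / r ^ k" using \<open>c' \<le> c p\<close> x(2) by (simp add: divide_right_mono)
    ultimately show ?thesis unfolding Q_def by (meson order_trans)
  qed
  ultimately show thesis unfolding Q_def by (rule that)
qed

end

section \<open>Integrability and compactness of concentrated families\<close>

lemma nn_integral_translate:
  fixes f :: "'a::euclidean_space \<Rightarrow> ennreal"
  assumes [measurable]: "f \<in> borel_measurable borel"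
  shows "(\<integral>\<^sup>+z. f (x + z) \<partial>lborel) = (\<integral>\<^sup>+y. f y \<partial>lborel)"
proof -
  have "(\<integral>\<^sup>+y. f y \<partial>lborel) = (\<integral>\<^sup>+y. f y \<partial>(distr lborel borel ((+) x)))"
    by (simp add: lborel_distr_plus)
  also have "\<dots> = (\<integral>\<^sup>+z. f (x + z) \<partial>lborel)"
    by (subst nn_integral_distr) auto
  finally show ?thesis by simp
qed

lemma emeasure_lborel_ball:
  "0 \<le> r \<Longrightarrow> emeasure lborel (ball (x::'a::euclidean_space) r) = ennreal (unit_ball_vol (real DIM('a)) * r ^ DIM('a))"
  by (rule emeasure_ball)

text \<open>Stands in for Hoelder's inequality: integrated over a ball it bounds the mean of
  \<open>\<bar>y\<bar>\<close> by the mass of its \<open>p\<close>-th power, with a level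
  \<open>\<mu>\<close> that can be chosen to suit.\<close>

lemma abs_le_plus_powr:
  fixes y \<mu> p :: real
  assumes "\<mu> > 0" "p \<ge> 1"
  shows "\<bar>y\<bar> \<le> \<mu> + \<mu> powr (1 - p) * \<bar>y\<bar> powr p"
proof (cases "\<bar>y\<bar> \<le> \<mu>")
  case False
  then have "\<bar>y\<bar> = \<bar>y\<bar> powr (1 - p) * \<bar>y\<bar> powr p"
    using assms by (simp flip: powr_add)
  also have "\<dots> \<le> \<mu> powr (1 - p) * \<bar>y\<bar> powr p"
    using False assms by (intro mult_right_mono powr_mono2') auto
  finally show ?thesis using assms by simp
qed (use assms in \<open>simp add: add_increasing2\<close>)

text \<open>Start from \<open>a^2 \<le> (y - a)^2 + 2 a y\<close> and bound
  \<open>\<bar>y\<bar>\<close> by \<open>abs_le_plus_powr\<close>. The condition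
  \<open>8 * \<mu> \<le> \<bar>a\<bar>\<close> makes the term with \<open>\<mu>\<close> at most
  \<open>a^2 / 4\<close>, which leaves the factor \<open>3 / 4\<close>.\<close>

lemma square_le_diff_square_plus_powr:
  fixes a y \<mu> p :: real
  assumes "\<mu> > 0" "p \<ge> 1" "8 * \<mu> \<le> \<bar>a\<bar>"
  shows "3 / 4 * a\<^sup>2 \<le> (y - a)\<^sup>2 + 2 * \<bar>a\<bar> * \<mu> powr (1 - p) * \<bar>y\<bar> powr p"
proof -
  have "a * y \<le> \<bar>a\<bar> * \<bar>y\<bar>" by (simp flip: abs_mult)
  also have "\<dots> \<le> \<bar>a\<bar> * (\<mu> + \<mu> powr (1 - p) * \<bar>y\<bar> powr p)"
    by (intro mult_left_mono abs_le_plus_powr assms) auto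
  finally have "2 * (a * y) \<le> 2 * \<bar>a\<bar> * \<mu> + 2 * \<bar>a\<bar> * \<mu> powr (1 - p) * \<bar>y\<bar> powr p"
    by (simp add: algebra_simps)
  moreover have "2 * \<bar>a\<bar> * \<mu> \<le> a\<^sup>2 / 4"
  proof -
    have "2 * \<bar>a\<bar> * \<mu> = \<bar>a\<bar> * (8 * \<mu>) / 4" by simp
    also have "\<dots> \<le> \<bar>a\<bar> * \<bar>a\<bar> / 4" using assms(3) by (intro divide_right_mono mult_left_mono) auto
    finally show ?thesis by (simp add: power2_eq_square)
  qed
  moreover have "a\<^sup>2 \<le> (y - a)\<^sup>2 + 2 * (a * y)" by (simp add: power2_eq_square algebra_simps)
  ultimately show ?thesis by linarith
qed

text \<open>The first dyadic level not exceeded by \<open>\<bar>t\<bar>\<close> already provides a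
  sufficient summand. Superlevel sets are used in place of dyadic shells, since those are the sets
  that \<open>tail_bound\<close> estimates; the overlap only enlarges the right-hand side.\<close>

lemma powr_le_dyadic_sum:
  fixes t q l0 :: real
  assumes "q > 2" "l0 > 0"
  shows "ennreal (\<bar>t\<bar> powr q) \<le> ennreal (l0 powr (q - 2)) * ennreal (t\<^sup>2) +
    (\<Sum>i. ennreal ((l0 * 2 ^ Suc i) powr (q - 2)) * (ennreal (t\<^sup>2) * indicator {x. l0 * 2 ^ i < \<bar>x\<bar>} t))"
proof -
  have eq: "\<bar>t\<bar> powr q = \<bar>t\<bar> powr (q - 2) * t\<^sup>2"
  proof (cases "t = 0")
    case False
    have "\<bar>t\<bar> powr q = \<bar>t\<bar> powr (q - 2) * \<bar>t\<bar> powr 2" using powr_add[of "\<bar>t\<bar>" "q - 2" 2] by simp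
    moreover have "\<bar>t\<bar> powr 2 = t\<^sup>2" using False powr_realpow[of "\<bar>t\<bar>" 2] by simp
    ultimately show ?thesis by simp
  qed simp
  show ?thesis
  proof (cases "\<bar>t\<bar> \<le> l0")
    case True
    have "\<bar>t\<bar> powr q \<le> l0 powr (q - 2) * t\<^sup>2"
      unfolding eq using True assms by (intro mult_right_mono powr_mono2) auto
    then have "ennreal (\<bar>t\<bar> powr q) \<le> ennreal (l0 powr (q - 2)) * ennreal (t\<^sup>2)"
      by (simp add: ennreal_leI flip: ennreal_mult)
    then show ?thesis by (simp add: add_increasing2)
  next
    case False
    have "\<exists>j. \<bar>t\<bar> \<le> l0 * 2 ^ j"
    proof -
      obtain j where "\<bar>t\<bar> / l0 < 2 ^ j" using real_arch_pow[of 2 "\<bar>t\<bar> / l0"] by auto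
      then show ?thesis using assms(2) by (auto simp: field_simps intro!: exI[of _ j])
    qed
    then obtain j where j: "\<bar>t\<bar> \<le> l0 * 2 ^ j" "\<And>i. i < j \<Longrightarrow> \<not> \<bar>t\<bar> \<le> l0 * 2 ^ i"
      using exists_least_iff[of "\<lambda>j. \<bar>t\<bar> \<le> l0 * 2 ^ j"] by blast
    obtain i where i: "j = Suc i" using j(1) False by (cases j) auto
    have "\<bar>t\<bar> powr q \<le> (l0 * 2 ^ Suc i) powr (q - 2) * t\<^sup>2"
      unfolding eq using j(1) assms i by (intro mult_right_mono powr_mono2) auto
    then have "ennreal (\<bar>t\<bar> powr q) \<le> ennreal ((l0 * 2 ^ Suc i) powr (q - 2)) * ennreal (t\<^sup>2)"
      by (simp add: ennreal_leI flip: ennreal_mult)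
    also have "\<dots> = ennreal ((l0 * 2 ^ Suc i) powr (q - 2)) * (ennreal (t\<^sup>2) * indicator {x. l0 * 2 ^ i < \<bar>x\<bar>} t)"
      using j(2)[of i] i by simp
    also have "\<dots> \<le> (\<Sum>i. ennreal ((l0 * 2 ^ Suc i) powr (q - 2)) * (ennreal (t\<^sup>2) * indicator {x. l0 * 2 ^ i < \<bar>x\<bar>} t))"
      using sum_le_suminf[of "\<lambda>i. ennreal ((l0 * 2 ^ Suc i) powr (q - 2)) * (ennreal (t\<^sup>2) * indicator {x. l0 * 2 ^ i < \<bar>x\<bar>} t)" "{i}"]
      by (simp add: summableI)
    finally show ?thesis by (simp add: add_increasing)
  qed
qed

section \<open>Higher integrability of concentrated families\<close>

text \<open>All that is kept of the Sobolev space and of the group. \<open>shift_le\<close> is the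
  trace of the gradient bound and \<open>concentration\<close> that of the symmetry;
  \<open>c\<close> will be the reciprocal of the packing constant. Both bounds are normalised to
  constant \<open>1\<close>, so one family serves all functions after scaling.\<close>

locale concentrated_family =
  fixes \<U> :: "('a::euclidean_space \<Rightarrow> real) set" and \<Omega> :: "'a set" and c r0 :: real and k :: nat
  assumes c_pos: "c > 0" and r0_pos: "r0 > 0" and k_small: "k + 2 < DIM('a)"
    and meas: "\<And>u. u \<in> \<U> \<Longrightarrow> u \<in> borel_measurable borel"
    and supp: "\<And>u x. u \<in> \<U> \<Longrightarrow> x \<notin> \<Omega> \<Longrightarrow> u x = 0"
    and L2_le: "\<And>u. u \<in> \<U> \<Longrightarrow> (\<integral>\<^sup>+x. ennreal ((u x)\<^sup>2) \<partial>lborel) \<le> 1"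
    and shift_le: "\<And>u z. u \<in> \<U> \<Longrightarrow> (\<integral>\<^sup>+x. ennreal ((u (x + z) - u x)\<^sup>2) \<partial>lborel) \<le> ennreal ((norm z)\<^sup>2)"
    and concentration: "\<And>u x r p. u \<in> \<U> \<Longrightarrow> x \<in> \<Omega> \<Longrightarrow> 0 < r \<Longrightarrow> r < r0 \<Longrightarrow> 1 \<le> p \<Longrightarrow>
      (\<integral>\<^sup>+y. ennreal (\<bar>u y\<bar> powr p) * indicator (ball x r) y \<partial>lborel)
        \<le> ennreal (c * r ^ k) * (\<integral>\<^sup>+y. ennreal (\<bar>u y\<bar> powr p) \<partial>lborel)"
begin

definition n :: real where "n = real DIM('a) - real k"

lemma n_gt: "n > 2" using k_small by (simp add: n_def)

text \<open>Fubini turns the lower bound for the oscillation around each point of the superlevel set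
  into translation integrals with a fixed displacement \<open>z\<close>, to which
  \<open>shift_le\<close> applies.\<close>

lemma tail_bound:
  assumes p: "p \<ge> 2" and K: "K > 0" "\<And>u. u \<in> \<U> \<Longrightarrow> (\<integral>\<^sup>+x. ennreal (\<bar>u x\<bar> powr p) \<partial>lborel) \<le> ennreal K"
  shows "\<exists>C>0. \<exists>l0>0. \<forall>u\<in>\<U>. \<forall>l\<ge>l0.
    (\<integral>\<^sup>+x. ennreal ((u x)\<^sup>2) * indicator {x. l < \<bar>u x\<bar>} x \<partial>lborel) \<le> ennreal (C * l powr (- (2 * p / n)))"
proof -
  define v where "v = unit_ball_vol (real DIM('a))"
  \<comment> \<open>Chosen so that \<open>key\<close> below is an exact identity; the factor
    \<open>8 powr p\<close> comes from \<open>\<mu> = l / 8\<close>.\<close>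
  define a where "a = c * K * 8 powr p / v"
  \<comment> \<open>Large \<open>l\<close> means small \<open>r\<close>; beyond this threshold
    \<open>r < r0\<close>, as \<open>concentration\<close> requires. The summand \<open>1\<close>
    makes the inequality strict.\<close>
  define l0 where "l0 = (a / r0 powr n) powr (1 / p) + 1"
  define C where "C = 2 * a powr (2 / n)"
  have v: "v > 0" by (simp add: v_def unit_ball_vol_pos)
  have a: "a > 0" using v c_pos K(1) by (simp add: a_def)
  have n: "n > 0" using n_gt by simp
  have "(\<integral>\<^sup>+x. ennreal ((u x)\<^sup>2) * indicator {x. l < \<bar>u x\<bar>} x \<partial>lborel) \<le> ennreal (C * l powr (- (2 * p / n)))"
    if u: "u \<in> \<U>" and l: "l \<ge> l0" for u l
  proof -
    note [measurable] = meas[OF u]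
    have l_pos: "l > 0" using l unfolding l0_def using powr_ge_zero[of "a / r0 powr n" "1 / p"] by linarith
    define r where "r = (a * l powr (- p)) powr (1 / n)"
    define B where "B = ball (0::'a) r"
    define V where "V = v * r ^ DIM('a)"
    define \<mu> where "\<mu> = l / 8"
    have r_pos: "r > 0" using a l_pos by (simp add: r_def)
    have r_n: "r powr n = a * l powr (- p)"
      using a l_pos n by (simp add: r_def powr_powr)
    have r_lt: "r < r0"
    proof (rule ccontr)
      assume "\<not> r < r0"
      then have "r0 powr n \<le> r powr n" using n r0_pos by (intro powr_mono2) auto
      then have "r0 powr n * l powr p \<le> a"
        using l_pos by (simp add: r_n powr_minus field_simps)
      then have "l powr p \<le> a / r0 powr n" using r0_pos by (simp add: field_simps)
      then have "(l powr p) powr (1 / p) \<le> (a / r0 powr n) powr (1 / p)"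
        using p l_pos by (intro powr_mono2) auto
      then have "l \<le> (a / r0 powr n) powr (1 / p)" using p l_pos by (simp add: powr_powr)
      then show False using l by (simp add: l0_def)
    qed
    have r_DIM: "r ^ DIM('a) = r powr n * r ^ k"
      using r_pos by (simp add: n_def powr_realpow[symmetric] powr_add[symmetric])
    have V: "V > 0" using v r_pos by (simp add: V_def)
    have [measurable]: "B \<in> sets borel" "\<And>x. ball x r \<in> sets borel" by (auto simp: B_def)
    have emB: "emeasure lborel B = ennreal V"
      unfolding B_def V_def v_def by (rule emeasure_lborel_ball) (use r_pos in simp)
    have \<mu>: "\<mu> > 0" using l_pos by (simp add: \<mu>_def)
    \<comment> \<open>Dividing the mass bound \<open>c * r ^ k * K\<close> by the volume leaves the
      power \<open>n\<close> of \<open>r\<close>, which \<open>r_n\<close> turns into a power of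
      \<open>l\<close>.\<close>
    have key: "\<mu> powr (1 - p) * (c * r ^ k * K) = \<mu> * V"
    proof -
      have "\<mu> powr (1 - p) = \<mu> * \<mu> powr (- p)" using \<mu> by (simp add: powr_diff powr_minus field_simps)
      also have "\<mu> powr (- p) = 8 powr p * l powr (- p)"
        using l_pos by (simp add: \<mu>_def powr_divide powr_minus field_simps)
      finally show ?thesis
        unfolding V_def r_DIM r_n using v by (simp add: a_def field_simps)
    qed
    \<comment> \<open>Of the factor \<open>3 / 4\<close> in the pointwise inequality,
      \<open>1 / 4\<close> is used up by the \<open>p\<close>-mass term because
      \<open>8 * \<mu> = l\<close> is below \<open>\<bar>u x\<bar>\<close>.\<close>
    have half: "ennreal (V / 2) * ennreal ((u x)\<^sup>2) \<le> (\<integral>\<^sup>+z. ennreal ((u (x + z) - u x)\<^sup>2) * indicator B z \<partial>lborel)" (is "_ \<le> ?T")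
      if x: "l < \<bar>u x\<bar>" for x
    proof -
      have x\<Omega>: "x \<in> \<Omega>" using supp[OF u, of x] x l_pos by force
      have "(\<integral>\<^sup>+z. ennreal (\<bar>u (x + z)\<bar> powr p) * indicator B z \<partial>lborel) =
          (\<integral>\<^sup>+z. ennreal (\<bar>u (x + z)\<bar> powr p) * indicator (ball x r) (x + z) \<partial>lborel)"
        by (intro nn_integral_cong) (auto simp: B_def indicator_def dist_norm)
      also have "\<dots> = (\<integral>\<^sup>+y. ennreal (\<bar>u y\<bar> powr p) * indicator (ball x r) y \<partial>lborel)"
        by (rule nn_integral_translate) measurable
      also have "\<dots> \<le> ennreal (c * r ^ k) * (\<integral>\<^sup>+y. ennreal (\<bar>u y\<bar> powr p) \<partial>lborel)"
        using concentration[OF u x\<Omega> r_pos r_lt] p by simp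
      also have "\<dots> \<le> ennreal (c * r ^ k) * ennreal K"
        by (intro mult_left_mono K(2)[OF u]) simp
      also have "\<dots> = ennreal (c * r ^ k * K)" using c_pos K(1) r_pos by (intro ennreal_mult[symmetric]) auto
      finally have 1: "(\<integral>\<^sup>+z. ennreal (\<bar>u (x + z)\<bar> powr p) * indicator B z \<partial>lborel) \<le> ennreal (c * r ^ k * K)" .
      define b where "b = 2 * \<bar>u x\<bar> * \<mu> powr (1 - p)"
      have b: "b \<ge> 0" by (simp add: b_def)
      have "ennreal (3 / 4 * (u x)\<^sup>2 * V) = (\<integral>\<^sup>+z. ennreal (3 / 4 * (u x)\<^sup>2) * indicator B z \<partial>lborel)"
      proof -
        have "(\<integral>\<^sup>+z. ennreal (3 / 4 * (u x)\<^sup>2) * indicator B z \<partial>lborel) = ennreal (3 / 4 * (u x)\<^sup>2) * ennreal V"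
          by (simp add: nn_integral_cmult_indicator emB)
        also have "\<dots> = ennreal (3 / 4 * (u x)\<^sup>2 * V)" using V by (intro ennreal_mult[symmetric]) auto
        finally show ?thesis by simp
      qed
      also have "\<dots> \<le> (\<integral>\<^sup>+z. ennreal ((u (x + z) - u x)\<^sup>2) * indicator B z + ennreal b * (ennreal (\<bar>u (x + z)\<bar> powr p) * indicator B z) \<partial>lborel)"
      proof (intro nn_integral_mono)
        fix z
        have "3 / 4 * (u x)\<^sup>2 \<le> (u (x + z) - u x)\<^sup>2 + b * \<bar>u (x + z)\<bar> powr p"
          unfolding b_def using x p by (intro square_le_diff_square_plus_powr \<mu>) (auto simp: \<mu>_def)
        then have "ennreal (3 / 4 * (u x)\<^sup>2) \<le> ennreal ((u (x + z) - u x)\<^sup>2) + ennreal b * ennreal (\<bar>u (x + z)\<bar> powr p)"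
          using b by (simp add: ennreal_leI flip: ennreal_mult ennreal_plus)
        then show "ennreal (3 / 4 * (u x)\<^sup>2) * indicator B z \<le> ennreal ((u (x + z) - u x)\<^sup>2) * indicator B z + ennreal b * (ennreal (\<bar>u (x + z)\<bar> powr p) * indicator B z)"
          by (auto simp: indicator_def)
      qed
      also have "\<dots> = ?T + ennreal b * (\<integral>\<^sup>+z. ennreal (\<bar>u (x + z)\<bar> powr p) * indicator B z \<partial>lborel)"
        unfolding B_def by (subst nn_integral_add, measurable, subst nn_integral_cmult, measurable)
      also have "\<dots> \<le> ?T + ennreal b * ennreal (c * r ^ k * K)"
        by (intro add_left_mono mult_left_mono 1) simp
      also have "ennreal b * ennreal (c * r ^ k * K) = ennreal (2 * \<bar>u x\<bar> * (\<mu> * V))"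
      proof -
        have "ennreal b * ennreal (c * r ^ k * K) = ennreal (b * (c * r ^ k * K))"
          using b c_pos K(1) r_pos by (intro ennreal_mult[symmetric]) auto
        also have "b * (c * r ^ k * K) = 2 * \<bar>u x\<bar> * (\<mu> powr (1 - p) * (c * r ^ k * K))"
          by (simp add: b_def)
        finally show ?thesis by (simp only: key)
      qed
      also have "\<dots> \<le> ennreal ((u x)\<^sup>2 * V / 4)"
      proof (rule ennreal_leI)
        have "2 * \<bar>u x\<bar> * (\<mu> * V) = \<bar>u x\<bar> * l * V / 4" by (simp add: \<mu>_def)
        also have "\<dots> \<le> \<bar>u x\<bar> * \<bar>u x\<bar> * V / 4"
          using x V by (intro divide_right_mono mult_right_mono mult_left_mono) auto
        finally show "2 * \<bar>u x\<bar> * (\<mu> * V) \<le> (u x)\<^sup>2 * V / 4" by (simp add: power2_eq_square)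
      qed
      finally have 2: "ennreal (3 / 4 * (u x)\<^sup>2 * V) \<le> ?T + ennreal ((u x)\<^sup>2 * V / 4)" by (simp add: add_left_mono)
      show ?thesis
      proof (cases ?T rule: ennreal_cases)
        case (real t)
        have "3 / 4 * (u x)\<^sup>2 * V \<le> t + (u x)\<^sup>2 * V / 4"
          using 2 V real by (simp add: ennreal_le_iff flip: ennreal_plus)
        then have "V / 2 * (u x)\<^sup>2 \<le> t" by (simp add: field_simps)
        then show ?thesis using V real by (simp add: ennreal_leI flip: ennreal_mult)
      qed simp
    qed
    have "ennreal (V / 2) * (\<integral>\<^sup>+x. ennreal ((u x)\<^sup>2) * indicator {x. l < \<bar>u x\<bar>} x \<partial>lborel) =
        (\<integral>\<^sup>+x. ennreal (V / 2) * (ennreal ((u x)\<^sup>2) * indicator {x. l < \<bar>u x\<bar>} x) \<partial>lborel)"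
      by (subst nn_integral_cmult) measurable
    also have "\<dots> \<le> (\<integral>\<^sup>+x. \<integral>\<^sup>+z. ennreal ((u (x + z) - u x)\<^sup>2) * indicator B z \<partial>lborel \<partial>lborel)"
      by (intro nn_integral_mono) (use half in \<open>auto simp: indicator_def\<close>)
    also have "\<dots> = (\<integral>\<^sup>+z. \<integral>\<^sup>+x. ennreal ((u (x + z) - u x)\<^sup>2) * indicator B z \<partial>lborel \<partial>lborel)"
      unfolding B_def by (rule lborel_pair.Fubini'[symmetric]) measurable
    also have "\<dots> = (\<integral>\<^sup>+z. (\<integral>\<^sup>+x. ennreal ((u (x + z) - u x)\<^sup>2) \<partial>lborel) * indicator B z \<partial>lborel)"
      by (intro nn_integral_cong nn_integral_multc) measurable
    also have "\<dots> \<le> (\<integral>\<^sup>+z. ennreal (r\<^sup>2) * indicator B z \<partial>lborel)"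
    proof (intro nn_integral_mono)
      fix z :: 'a
      have "(\<integral>\<^sup>+x. ennreal ((u (x + z) - u x)\<^sup>2) \<partial>lborel) \<le> ennreal (r\<^sup>2)" if "z \<in> B"
        using shift_le[OF u, of z] that power_mono[of "norm z" r 2]
        by (auto simp: B_def intro: order_trans ennreal_leI)
      then show "(\<integral>\<^sup>+x. ennreal ((u (x + z) - u x)\<^sup>2) \<partial>lborel) * indicator B z \<le> ennreal (r\<^sup>2) * indicator B z"
        by (auto simp: indicator_def)
    qed
    also have "\<dots> = ennreal (V / 2) * ennreal (2 * r\<^sup>2)"
    proof -
      have "(\<integral>\<^sup>+z. ennreal (r\<^sup>2) * indicator B z \<partial>lborel) = ennreal (r\<^sup>2) * ennreal V"
        by (simp add: nn_integral_cmult_indicator emB)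
      also have "\<dots> = ennreal (V / 2) * ennreal (2 * r\<^sup>2)" using V by (simp add: mult.commute flip: ennreal_mult)
      finally show ?thesis .
    qed
    finally have "(\<integral>\<^sup>+x. ennreal ((u x)\<^sup>2) * indicator {x. l < \<bar>u x\<bar>} x \<partial>lborel) \<le> ennreal (2 * r\<^sup>2)"
      using V by (simp add: ennreal_mult_le_mult_iff)
    also have "2 * r\<^sup>2 = C * l powr (- (2 * p / n))"
    proof -
      have "r\<^sup>2 = (a * l powr (- p)) powr (2 / n)"
        using r_pos a l_pos by (simp add: r_def powr_powr flip: powr_numeral)
      also have "\<dots> = a powr (2 / n) * l powr (- (2 * p / n))"
        using a l_pos by (simp add: powr_mult powr_powr mult.commute)
      finally show ?thesis by (simp add: C_def)
    qed
    finally show ?thesis .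
  qed
  moreover have "C > 0" using a by (simp add: C_def)
  moreover have "l0 > 0" unfolding l0_def using powr_ge_zero[of "a / r0 powr n" "1 / p"] by linarith
  ultimately show ?thesis by blast
qed

lemma integrability_step:
  assumes p: "p \<ge> 2" and K: "K > 0" "\<And>u. u \<in> \<U> \<Longrightarrow> (\<integral>\<^sup>+x. ennreal (\<bar>u x\<bar> powr p) \<partial>lborel) \<le> ennreal K"
    and q: "2 < q" "q < 2 + 2 * p / n"
  shows "\<exists>K>0. \<forall>u\<in>\<U>. (\<integral>\<^sup>+x. ennreal (\<bar>u x\<bar> powr q) \<partial>lborel) \<le> ennreal K"
proof -
  obtain C l0 where C: "C > 0" "l0 > 0"
    "\<And>u l. u \<in> \<U> \<Longrightarrow> l \<ge> l0 \<Longrightarrow> (\<integral>\<^sup>+x. ennreal ((u x)\<^sup>2) * indicator {x. l < \<bar>u x\<bar>} x \<partial>lborel) \<le> ennreal (C * l powr (- (2 * p / n)))"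
    using tail_bound[OF p K] by blast
  define s where "s = 2 * p / n"
  define \<rho> where "\<rho> = 2 powr (q - 2 - s)"
  define b where "b = (2 * l0) powr (q - 2) * C * l0 powr (- s)"
  have b: "b > 0" using C by (simp add: b_def)
  have \<rho>: "0 < \<rho>" "\<rho> < 1" using q by (auto simp: \<rho>_def s_def intro!: powr_less_one)
  have term_eq: "(l0 * 2 ^ Suc i) powr (q - 2) * (C * (l0 * 2 ^ i) powr (- s)) = b * \<rho> ^ i" for i
  proof -
    have 1: "(2 ^ i) powr t = (2 powr t) ^ i" for t :: real
      by (simp add: powr_power powr_realpow[symmetric] powr_powr mult.commute)
    have "(l0 * 2 ^ Suc i) powr (q - 2) = (2 * l0) powr (q - 2) * (2 powr (q - 2)) ^ i"
      using C(2) by (simp add: powr_mult 1[symmetric])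
    moreover have "(l0 * 2 ^ i) powr (- s) = l0 powr (- s) * (2 powr (- s)) ^ i"
      using C(2) by (simp add: powr_mult 1[symmetric])
    moreover have "\<rho> ^ i = (2 powr (q - 2)) ^ i * (2 powr (- s)) ^ i"
      unfolding power_mult_distrib[symmetric] \<rho>_def by (simp flip: powr_add)
    ultimately show ?thesis by (simp add: b_def)
  qed
  define K' where "K' = l0 powr (q - 2) + b * (1 / (1 - \<rho>))"
  have "(\<integral>\<^sup>+x. ennreal (\<bar>u x\<bar> powr q) \<partial>lborel) \<le> ennreal K'" if u: "u \<in> \<U>" for u
  proof -
    note [measurable] = meas[OF u]
    have "(\<integral>\<^sup>+x. ennreal (\<bar>u x\<bar> powr q) \<partial>lborel) \<le> (\<integral>\<^sup>+x. ennreal (l0 powr (q - 2)) * ennreal ((u x)\<^sup>2) +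
      (\<Sum>i. ennreal ((l0 * 2 ^ Suc i) powr (q - 2)) * (ennreal ((u x)\<^sup>2) * indicator {x. l0 * 2 ^ i < \<bar>u x\<bar>} x)) \<partial>lborel)"
    proof (rule nn_integral_mono)
      fix x
      show "ennreal (\<bar>u x\<bar> powr q) \<le> ennreal (l0 powr (q - 2)) * ennreal ((u x)\<^sup>2) +
         (\<Sum>i. ennreal ((l0 * 2 ^ Suc i) powr (q - 2)) * (ennreal ((u x)\<^sup>2) * indicator {x. l0 * 2 ^ i < \<bar>u x\<bar>} x))"
        using powr_le_dyadic_sum[OF q(1) C(2), of "u x"] by (simp add: indicator_def)
    qed
    also have "\<dots> = (\<integral>\<^sup>+x. ennreal (l0 powr (q - 2)) * ennreal ((u x)\<^sup>2) \<partial>lborel) +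
      (\<integral>\<^sup>+x. (\<Sum>i. ennreal ((l0 * 2 ^ Suc i) powr (q - 2)) * (ennreal ((u x)\<^sup>2) * indicator {x. l0 * 2 ^ i < \<bar>u x\<bar>} x)) \<partial>lborel)"
      by (rule nn_integral_add) measurable
    also have "(\<integral>\<^sup>+x. (\<Sum>i. ennreal ((l0 * 2 ^ Suc i) powr (q - 2)) * (ennreal ((u x)\<^sup>2) * indicator {x. l0 * 2 ^ i < \<bar>u x\<bar>} x)) \<partial>lborel)
      = (\<Sum>i. \<integral>\<^sup>+x. ennreal ((l0 * 2 ^ Suc i) powr (q - 2)) * (ennreal ((u x)\<^sup>2) * indicator {x. l0 * 2 ^ i < \<bar>u x\<bar>} x) \<partial>lborel)"
      by (rule nn_integral_suminf) measurable
    also have "\<dots> \<le> (\<Sum>i. ennreal (b * \<rho> ^ i))"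
    proof (intro suminf_le summableI)
      fix i
      have "(\<integral>\<^sup>+x. ennreal ((l0 * 2 ^ Suc i) powr (q - 2)) * (ennreal ((u x)\<^sup>2) * indicator {x. l0 * 2 ^ i < \<bar>u x\<bar>} x) \<partial>lborel)
        = ennreal ((l0 * 2 ^ Suc i) powr (q - 2)) * (\<integral>\<^sup>+x. ennreal ((u x)\<^sup>2) * indicator {x. l0 * 2 ^ i < \<bar>u x\<bar>} x \<partial>lborel)"
        by (rule nn_integral_cmult) measurable
      also have "\<dots> \<le> ennreal ((l0 * 2 ^ Suc i) powr (q - 2)) * ennreal (C * (l0 * 2 ^ i) powr (- s))"
        unfolding s_def using C(2) by (intro mult_left_mono C(3)[OF u]) auto
      also have "\<dots> = ennreal (b * \<rho> ^ i)"
        using C by (simp only: term_eq[symmetric]) (simp add: ennreal_mult)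
      finally show "(\<integral>\<^sup>+x. ennreal ((l0 * 2 ^ Suc i) powr (q - 2)) * (ennreal ((u x)\<^sup>2) * indicator {x. l0 * 2 ^ i < \<bar>u x\<bar>} x) \<partial>lborel)
        \<le> ennreal (b * \<rho> ^ i)" .
    qed
    also have "\<dots> = ennreal (b * (1 / (1 - \<rho>)))"
      using b \<rho> by (intro suminf_ennreal_eq sums_mult geometric_sums) auto
    also have "(\<integral>\<^sup>+x. ennreal (l0 powr (q - 2)) * ennreal ((u x)\<^sup>2) \<partial>lborel) \<le> ennreal (l0 powr (q - 2))"
      using mult_left_mono[OF L2_le[OF u], of "ennreal (l0 powr (q - 2))"] by (subst nn_integral_cmult) auto
    finally show ?thesis
      using b \<rho> by (simp add: K'_def add_right_mono ennreal_plus[symmetric] del: ennreal_plus)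
  qed
  moreover have "K' > 0" using b \<rho> C(2) by (auto simp: K'_def intro!: add_pos_pos)
  ultimately show ?thesis by blast
qed

text \<open>The gain \<open>2 + 2 p / n - p\<close> decreases in \<open>p\<close>, so on the
  interval from \<open>2\<close> to \<open>q\<close> it is at least its value
  \<open>\<delta>\<close> at \<open>q\<close>. Steps of fixed length therefore reach
  \<open>q\<close>.\<close>

lemma Lq_bound:
  assumes q: "2 \<le> q" "q < 2 * n / (n - 2)"
  shows "\<exists>K>0. \<forall>u\<in>\<U>. (\<integral>\<^sup>+x. ennreal (\<bar>u x\<bar> powr q) \<partial>lborel) \<le> ennreal K"
proof -
  define P where "P p \<longleftrightarrow> (\<exists>K>0. \<forall>u\<in>\<U>. (\<integral>\<^sup>+x. ennreal (\<bar>u x\<bar> powr p) \<partial>lborel) \<le> ennreal K)" for p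
  define \<delta> where "\<delta> = 2 + 2 * q / n - q"
  have n: "n > 2" by (rule n_gt)
  have \<delta>: "\<delta> > 0"
  proof -
    have "q * (n - 2) < 2 * n" using q(2) n by (simp add: field_simps)
    then show ?thesis using n by (simp add: \<delta>_def field_simps)
  qed
  \<comment> \<open>Steps have length \<open>\<delta> / 2\<close>, not \<open>\<delta>\<close>,
    because \<open>integrability_step\<close> requires a strict inequality.\<close>
  have step: "P p'" if p: "P p" "2 \<le> p" "p \<le> q" "2 < p'" "p' \<le> p + \<delta> / 2" for p p'
  proof -
    have "(q - p) * (2 / n) \<le> (q - p) * 1" using p n by (intro mult_left_mono) auto
    then have "\<delta> \<le> 2 + 2 * p / n - p" by (simp add: \<delta>_def algebra_simps diff_divide_distrib)
    then have "p' < 2 + 2 * p / n" using p(5) \<delta> by linarith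
    then show ?thesis using integrability_step[OF p(2) _ _ p(4)] p(1) unfolding P_def by blast
  qed
  have P2: "P 2" unfolding P_def
  proof (intro exI[of _ 1] conjI ballI)
    fix u assume "u \<in> \<U>"
    moreover have "\<bar>t\<bar> powr 2 = t\<^sup>2" for t :: real
      using powr_realpow[of "\<bar>t\<bar>" 2] by (cases "t = 0") auto
    ultimately show "(\<integral>\<^sup>+x. ennreal (\<bar>u x\<bar> powr 2) \<partial>lborel) \<le> ennreal 1"
      using L2_le by simp
  qed simp
  have "P (min q (2 + real i * (\<delta> / 2)))" for i
  proof (induction i)
    case 0
    then show ?case using P2 q by (simp add: min_def)
  next
    case (Suc i)
    show ?case
    \<comment> \<open>\<open>integrability_step\<close> starts above exponent \<open>2\<close>, so
      no step can be made when the target is \<open>2\<close> itself.\<close>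
    proof (cases "q = 2")
      case True
      then show ?thesis using P2 \<delta> by (simp add: min_def)
    next
      case False
      define t where "t = real i * (\<delta> / 2)"
      have t: "t \<ge> 0" using \<delta> by (simp add: t_def)
      have "real (Suc i) * (\<delta> / 2) = t + \<delta> / 2" by (simp add: t_def field_simps)
      moreover have "P (min q (2 + (t + \<delta> / 2)))"
        by (rule step[OF Suc[folded t_def]]) (use q False \<delta> t in \<open>auto simp: min_def\<close>)
      ultimately show ?thesis by (simp only:)
    qed
  qed
  moreover obtain i :: nat where "q < real i * (\<delta> / 2)"
    using reals_Archimedean3[of "\<delta> / 2"] \<delta> by fastforce
  ultimately have "P q" by (metis add_increasing less_imp_le min.absorb1 zero_le_numeral)
  then show ?thesis by (simp add: P_def)
qed

end

section \<open>Compactness of concentrated families\<close>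

text \<open>Cauchy-Schwarz on a set of finite measure, read off from the fact that the square of
  \<open>f\<close> minus its mean \<open>m\<close> over \<open>S\<close> has nonnegative
  integral.\<close>

lemma integral_square_le:
  fixes f :: "'a::euclidean_space \<Rightarrow> real"
  assumes [measurable]: "f \<in> borel_measurable borel" "S \<in> sets borel"
    and V: "emeasure lborel S = ennreal V" "V > 0"
    and b: "(\<integral>\<^sup>+x. ennreal ((f x)\<^sup>2) * indicator S x \<partial>lborel) \<le> ennreal b" "b \<ge> 0"
  shows "integrable lborel (\<lambda>x. indicator S x * f x)"
    and "(\<integral>x. indicator S x * f x \<partial>lborel)\<^sup>2 \<le> V * b"
proof -
  define g where "g x = indicator S x * (f x)\<^sup>2" for x
  have [measurable]: "g \<in> borel_measurable borel" unfolding g_def by measurable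
  have g_nn: "(\<integral>\<^sup>+x. ennreal (g x) \<partial>lborel) \<le> ennreal b"
    using b(1) by (simp add: g_def ennreal_mult mult.commute ennreal_indicator)
  have g_int: "integrable lborel g"
    by (rule integrableI_nonneg) (use g_nn in \<open>auto simp: g_def le_less_trans[OF _ ennreal_less_top]\<close>)
  have g_le: "(\<integral>x. g x \<partial>lborel) \<le> b"
  proof -
    have "(\<integral>\<^sup>+x. ennreal (g x) \<partial>lborel) = ennreal (\<integral>x. g x \<partial>lborel)"
      by (rule nn_integral_eq_integral[OF g_int]) (simp add: g_def)
    then show ?thesis using g_nn ennreal_le_iff[OF b(2)] by metis
  qed
  have S_int: "integrable lborel (indicator S :: 'a \<Rightarrow> real)"
    using V by (intro integrable_real_indicator) auto
  have S_val: "(\<integral>x. indicator S x \<partial>lborel) = V"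
    using V by (simp add: measure_def)
  show f_int: "integrable lborel (\<lambda>x. indicator S x * f x)"
  proof (rule Bochner_Integration.integrable_bound[OF Bochner_Integration.integrable_add[OF S_int g_int]])
    have "\<bar>t\<bar> \<le> 1 + t\<^sup>2" for t :: real
      using sum_squares_bound[of 1 "\<bar>t\<bar>"] by (simp add: power2_eq_square)
    then show "AE x in lborel. norm (indicator S x * f x) \<le> norm (indicator S x + g x)"
      by (auto simp: g_def indicator_def)
  qed measurable
  define I where "I = (\<integral>x. indicator S x * f x \<partial>lborel)"
  define m where "m = I / V"
  have "0 \<le> (\<integral>x. g x - 2 * m * (indicator S x * f x) + m\<^sup>2 * indicator S x \<partial>lborel)"
  proof (rule integral_nonneg_AE, rule AE_I2)
    fix x
    have "g x - 2 * m * (indicator S x * f x) + m\<^sup>2 * indicator S x = indicator S x * (f x - m)\<^sup>2"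
      by (auto simp: g_def indicator_def power2_eq_square algebra_simps)
    then show "0 \<le> g x - 2 * m * (indicator S x * f x) + m\<^sup>2 * indicator S x" by simp
  qed
  also have "\<dots> = (\<integral>x. g x \<partial>lborel) - 2 * m * I + m\<^sup>2 * V"
    using g_int f_int S_int S_val by (simp add: I_def)
  also have "\<dots> \<le> b - I\<^sup>2 / V"
    using g_le V(2) by (simp add: m_def power2_eq_square field_simps)
  finally show "(\<integral>x. indicator S x * f x \<partial>lborel)\<^sup>2 \<le> V * b"
    using V(2) by (simp add: I_def field_simps)
qed

text \<open>Small values are covered by the constant, large ones by the higher power, and between
  \<open>s\<close> and \<open>L\<close> the function \<open>\<bar>t\<bar> powr q\<close> is bounded
  by a multiple of \<open>t^2\<close>. On a set of finite measure, smallness in mean square and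
  boundedness of the \<open>p\<close>-th powers thus give smallness of the \<open>q\<close>-th
  powers.\<close>

lemma powr_interpolate:
  fixes p q \<delta> :: real
  assumes "0 < q" "q < p" "\<delta> > 0"
  shows "\<exists>C>0. \<forall>t. \<bar>t\<bar> powr q \<le> \<delta> + \<delta> * \<bar>t\<bar> powr p + C * t\<^sup>2"
proof -
  define s where "s = \<delta> powr (1 / q)"
  define L where "L = (1 / \<delta>) powr (1 / (p - q))"
  define C where "C = L powr q / s\<^sup>2 + 1"
  have s: "s > 0" "s powr q = \<delta>" using assms by (auto simp: s_def powr_powr)
  have L: "L > 0" "L powr (p - q) = 1 / \<delta>" using assms by (auto simp: L_def powr_powr)
  have C: "C > 0" using s by (auto simp: C_def intro!: add_nonneg_pos)
  have "\<bar>t\<bar> powr q \<le> \<delta> + \<delta> * \<bar>t\<bar> powr p + C * t\<^sup>2" for t :: real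
  proof -
    have nonneg: "0 \<le> \<delta> * \<bar>t\<bar> powr p" "0 \<le> C * t\<^sup>2" using assms C by auto
    consider "\<bar>t\<bar> \<le> s" | "\<bar>t\<bar> \<ge> L" "\<bar>t\<bar> > s" | "s < \<bar>t\<bar>" "\<bar>t\<bar> < L" by linarith
    then show ?thesis
    proof cases
      case 1
      then have "\<bar>t\<bar> powr q \<le> \<delta>" unfolding s(2)[symmetric] using assms by (intro powr_mono2) auto
      then show ?thesis using nonneg by linarith
    next
      case 2
      have "L powr (p - q) \<le> \<bar>t\<bar> powr (p - q)" using 2 assms L by (intro powr_mono2) auto
      then have "1 \<le> \<delta> * \<bar>t\<bar> powr (p - q)" using L(2) assms(3) by (simp add: field_simps)
      then have "\<bar>t\<bar> powr q * 1 \<le> \<bar>t\<bar> powr q * (\<delta> * \<bar>t\<bar> powr (p - q))" by (intro mult_left_mono) auto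
      also have "\<dots> = \<delta> * \<bar>t\<bar> powr p" by (simp add: mult.left_commute flip: powr_add)
      finally show ?thesis using nonneg assms by linarith
    next
      case 3
      have "\<bar>t\<bar> powr q \<le> L powr q" using 3 assms by (intro powr_mono2) auto
      also have "\<dots> = L powr q / s\<^sup>2 * s\<^sup>2" using s by simp
      also have "\<dots> \<le> C * t\<^sup>2"
        using 3 s power_mono[of s "\<bar>t\<bar>" 2] by (intro mult_mono) (auto simp: C_def)
      finally show ?thesis using nonneg assms by linarith
    qed
  qed
  then show ?thesis using C by blast
qed

lemma powr_diff_le:
  fixes a b p :: real
  assumes "p \<ge> 0"
  shows "\<bar>a - b\<bar> powr p \<le> 2 powr p * (\<bar>a\<bar> powr p + \<bar>b\<bar> powr p)"
proof -
  have "\<bar>a - b\<bar> powr p \<le> (2 * max \<bar>a\<bar> \<bar>b\<bar>) powr p" using assms by (intro powr_mono2) auto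
  also have "\<dots> = 2 powr p * max \<bar>a\<bar> \<bar>b\<bar> powr p" by (simp add: powr_mult)
  also have "\<dots> \<le> 2 powr p * (\<bar>a\<bar> powr p + \<bar>b\<bar> powr p)"
    by (intro mult_left_mono) (auto simp: max_def)
  finally show ?thesis .
qed

lemma square_diff_le: "(a - b)\<^sup>2 \<le> 2 * a\<^sup>2 + 2 * (b::real)\<^sup>2"
  using zero_le_power2[of "a + b"] by (simp add: power2_eq_square algebra_simps)

context concentrated_family begin

text \<open>Left undivided by the volume, so that it is directly an integral of the kind bounded by
  \<open>integral_square_le\<close>.\<close>

definition avg :: "('a \<Rightarrow> real) \<Rightarrow> real \<Rightarrow> 'a \<Rightarrow> real" where
  "avg u r x = (\<integral>z. indicator (ball 0 r) z * u (x + z) \<partial>lborel)"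

definition vol :: "real \<Rightarrow> real" where
  "vol r = unit_ball_vol (real DIM('a)) * r ^ DIM('a)"

lemma vol: "r > 0 \<Longrightarrow> vol r > 0" "r > 0 \<Longrightarrow> emeasure lborel (ball (x::'a) r) = ennreal (vol r)"
  by (simp_all add: vol_def unit_ball_vol_pos emeasure_ball)

lemma avg_bound:
  assumes u: "u \<in> \<U>" and r: "r > 0"
  shows "integrable lborel (\<lambda>z. indicator (ball 0 r) z * u (x + z))"
    and "(avg u r x)\<^sup>2 \<le> vol r"
proof -
  note [measurable] = meas[OF u]
  have "(\<integral>\<^sup>+z. ennreal ((u (x + z))\<^sup>2) * indicator (ball 0 r) z \<partial>lborel) \<le> (\<integral>\<^sup>+z. ennreal ((u (x + z))\<^sup>2) \<partial>lborel)"
    by (intro nn_integral_mono) (auto simp: indicator_def)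
  also have "\<dots> = (\<integral>\<^sup>+y. ennreal ((u y)\<^sup>2) \<partial>lborel)" by (rule nn_integral_translate) measurable
  also have "\<dots> \<le> ennreal 1" using L2_le[OF u] by simp
  finally have b: "(\<integral>\<^sup>+z. ennreal ((u (x + z))\<^sup>2) * indicator (ball 0 r) z \<partial>lborel) \<le> ennreal 1" .
  note * = integral_square_le[OF _ _ vol(2)[OF r, of 0] vol(1)[OF r] b]
  show "integrable lborel (\<lambda>z. indicator (ball 0 r) z * u (x + z))" by (rule *(1)) auto
  show "(avg u r x)\<^sup>2 \<le> vol r" unfolding avg_def using *(2) by simp
qed

text \<open>Cauchy-Schwarz on the ball combined with \<open>shift_le\<close>. The Lipschitz constant
  depends on \<open>r\<close> only, which gives the equicontinuity that Arzela-Ascoli needs;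
  \<open>avg_bound\<close> gives the uniform bound.\<close>

lemma avg_Lipschitz:
  assumes u: "u \<in> \<U>" and r: "r > 0"
  shows "(avg u r x - avg u r y)\<^sup>2 \<le> vol r * (norm (x - y))\<^sup>2"
proof -
  note [measurable] = meas[OF u]
  have "(\<integral>\<^sup>+z. ennreal ((u (x + z) - u (y + z))\<^sup>2) * indicator (ball 0 r) z \<partial>lborel) \<le> (\<integral>\<^sup>+z. ennreal ((u ((y + z) + (x - y)) - u (y + z))\<^sup>2) \<partial>lborel)"
  proof (rule nn_integral_mono)
    fix z
    have "(y + z) + (x - y) = x + z" by simp
    then show "ennreal ((u (x + z) - u (y + z))\<^sup>2) * indicator (ball 0 r) z \<le> ennreal ((u ((y + z) + (x - y)) - u (y + z))\<^sup>2)"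
      by (simp only:) (simp add: indicator_def)
  qed
  also have "\<dots> = (\<integral>\<^sup>+w. ennreal ((u (w + (x - y)) - u w)\<^sup>2) \<partial>lborel)"
    by (rule nn_integral_translate) measurable
  also have "\<dots> \<le> ennreal ((norm (x - y))\<^sup>2)" by (rule shift_le[OF u])
  finally have b: "(\<integral>\<^sup>+z. ennreal ((u (x + z) - u (y + z))\<^sup>2) * indicator (ball 0 r) z \<partial>lborel) \<le> ennreal ((norm (x - y))\<^sup>2)" .
  have "(\<integral>z. indicator (ball 0 r) z * (u (x + z) - u (y + z)) \<partial>lborel)\<^sup>2 \<le> vol r * (norm (x - y))\<^sup>2"
    by (rule integral_square_le(2)[OF _ _ vol(2)[OF r, of 0] vol(1)[OF r] b]) auto
  then show ?thesis
    using avg_bound(1)[OF u r] by (simp add: avg_def right_diff_distrib)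
qed

text \<open>The integral of \<open>w\<close> over a ball around \<open>x\<close> differs from
  \<open>vol r * w x\<close> by the integral of the oscillation \<open>w (x + z) - w x\<close>, to
  which Cauchy-Schwarz applies.\<close>

lemma square_le_avg:
  assumes u: "u \<in> \<U>" "u' \<in> \<U>" and r: "r > 0"
  defines "w \<equiv> \<lambda>x. u x - u' x"
  shows "ennreal (vol r) * ennreal ((w x)\<^sup>2) \<le> 2 * (\<integral>\<^sup>+z. ennreal ((w (x + z) - w x)\<^sup>2) * indicator (ball 0 r) z \<partial>lborel)
     + ennreal (2 * (avg u r x - avg u' r x)\<^sup>2 / vol r)" (is "_ \<le> 2 * ?T + _")
proof -
  note [measurable] = meas[OF u(1)] meas[OF u(2)]
  have [measurable]: "w \<in> borel_measurable borel" unfolding w_def by measurable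
  define V where "V = vol r"
  have V: "V > 0" unfolding V_def by (rule vol(1)[OF r])
  show ?thesis
  proof (cases ?T rule: ennreal_cases)
    case (real t)
    have b: "?T \<le> ennreal t" using real by simp
    note * = integral_square_le[OF _ _ vol(2)[OF r, of 0] vol(1)[OF r] b real(1)]
    define J where "J = (\<integral>z. indicator (ball 0 r) z * (w (x + z) - w x) \<partial>lborel)"
    define A where "A = avg u r x - avg u' r x"
    have J: "J\<^sup>2 \<le> V * t" unfolding J_def V_def by (rule *(2)) auto
    have ind: "integrable lborel (\<lambda>z. indicator (ball (0::'a) r) z :: real)"
      using vol(2)[OF r, of 0] by (intro integrable_real_indicator) auto
    have A_eq: "A = (\<integral>z. indicator (ball 0 r) z * w (x + z) \<partial>lborel)"
      using avg_bound(1)[OF u(1) r, of x] avg_bound(1)[OF u(2) r, of x]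
      by (simp add: A_def avg_def w_def right_diff_distrib)
    have int_w: "integrable lborel (\<lambda>z. indicator (ball 0 r) z * w (x + z))"
      using avg_bound(1)[OF u(1) r, of x] avg_bound(1)[OF u(2) r, of x]
      by (simp add: w_def right_diff_distrib)
    have "J = A - (\<integral>z. indicator (ball (0::'a) r) z * w x \<partial>lborel)"
      unfolding J_def A_eq using int_w ind by (simp add: right_diff_distrib)
    also have "(\<integral>z. indicator (ball (0::'a) r) z * w x \<partial>lborel) = V * w x"
      using vol(2)[OF r, of 0] V ind by (simp add: measure_def V_def)
    finally have "V * w x = A - J" by simp
    then have "(V * w x)\<^sup>2 \<le> 2 * A\<^sup>2 + 2 * J\<^sup>2" using square_diff_le[of A J] by simp
    then have "V * (V * (w x)\<^sup>2) \<le> 2 * A\<^sup>2 + 2 * (V * t)" using J by (simp add: power2_eq_square mult_ac)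
    then have "V * (w x)\<^sup>2 \<le> 2 * t + 2 * A\<^sup>2 / V" using V by (simp add: field_simps)
    then have "ennreal (V * (w x)\<^sup>2) \<le> ennreal (2 * t + 2 * A\<^sup>2 / V)" by (rule ennreal_leI)
    also have "\<dots> = 2 * ennreal t + ennreal (2 * A\<^sup>2 / V)"
      using real V by (simp add: ennreal_plus ennreal_mult)
    finally show ?thesis using V real by (simp add: ennreal_mult V_def A_def)
  qed (simp add: ennreal_mult_top)
qed

text \<open>Integration of \<open>square_le_avg\<close> over \<open>\<Omega>\<close>. Translates of
  a difference of two members cost \<open>4 * (norm z)^2\<close>, which yields
  \<open>8 * r^2\<close>; the averages contribute through the measure of \<open>\<Omega>\<close>
  only.\<close>

lemma L2_diff_le:
  assumes u: "u \<in> \<U>" "u' \<in> \<U>" and r: "r > 0" and \<Omega>: "\<Omega> \<in> sets borel" "emeasure lborel \<Omega> = ennreal M" "M \<ge> 0"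
    and \<tau>: "\<And>x. x \<in> \<Omega> \<Longrightarrow> \<bar>avg u r x - avg u' r x\<bar> \<le> \<tau>"
  shows "(\<integral>\<^sup>+x. ennreal ((u x - u' x)\<^sup>2) \<partial>lborel) \<le> ennreal (8 * r\<^sup>2 + 2 * \<tau>\<^sup>2 * M / (vol r)\<^sup>2)"
proof -
  note [measurable] = meas[OF u(1)] meas[OF u(2)] \<Omega>(1)
  define w where "w x = u x - u' x" for x
  have [measurable]: "w \<in> borel_measurable borel" unfolding w_def by measurable
  have [measurable]: "ball 0 r \<in> sets (borel :: 'a measure)" by simp
  define V where "V = vol r"
  have V: "V > 0" unfolding V_def by (rule vol(1)[OF r])
  have shift: "(\<integral>\<^sup>+x. ennreal ((w (x + z) - w x)\<^sup>2) \<partial>lborel) \<le> ennreal (4 * (norm z)\<^sup>2)" for z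
  proof -
    have "(\<integral>\<^sup>+x. ennreal ((w (x + z) - w x)\<^sup>2) \<partial>lborel) \<le>
        (\<integral>\<^sup>+x. 2 * ennreal ((u (x + z) - u x)\<^sup>2) + 2 * ennreal ((u' (x + z) - u' x)\<^sup>2) \<partial>lborel)"
    proof (rule nn_integral_mono)
      fix x
      have "(w (x + z) - w x)\<^sup>2 \<le> 2 * (u (x + z) - u x)\<^sup>2 + 2 * (u' (x + z) - u' x)\<^sup>2"
        using square_diff_le[of "u (x + z) - u x" "u' (x + z) - u' x"] by (simp add: w_def algebra_simps)
      then have "ennreal ((w (x + z) - w x)\<^sup>2) \<le> ennreal (2 * (u (x + z) - u x)\<^sup>2 + 2 * (u' (x + z) - u' x)\<^sup>2)"
        by (rule ennreal_leI)
      then show "ennreal ((w (x + z) - w x)\<^sup>2) \<le> 2 * ennreal ((u (x + z) - u x)\<^sup>2) + 2 * ennreal ((u' (x + z) - u' x)\<^sup>2)"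
        by (simp add: ennreal_plus ennreal_mult)
    qed
    also have "\<dots> = 2 * (\<integral>\<^sup>+x. ennreal ((u (x + z) - u x)\<^sup>2) \<partial>lborel) + 2 * (\<integral>\<^sup>+x. ennreal ((u' (x + z) - u' x)\<^sup>2) \<partial>lborel)"
      by (subst nn_integral_add, measurable) (simp add: nn_integral_cmult)
    also have "\<dots> \<le> 2 * ennreal ((norm z)\<^sup>2) + 2 * ennreal ((norm z)\<^sup>2)"
      by (intro add_mono mult_left_mono shift_le u) auto
    also have "\<dots> = ennreal (2 * (norm z)\<^sup>2) + ennreal (2 * (norm z)\<^sup>2)" by (simp add: ennreal_mult)
    also have "\<dots> = ennreal (2 * (norm z)\<^sup>2 + 2 * (norm z)\<^sup>2)" by (rule ennreal_plus[symmetric]) auto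
    also have "2 * (norm z)\<^sup>2 + 2 * (norm z)\<^sup>2 = 4 * (norm z)\<^sup>2" by simp
    finally show ?thesis .
  qed
  have "ennreal V * (\<integral>\<^sup>+x. ennreal ((w x)\<^sup>2) \<partial>lborel) = (\<integral>\<^sup>+x. ennreal V * ennreal ((w x)\<^sup>2) \<partial>lborel)"
    by (subst nn_integral_cmult) auto
  also have "\<dots> \<le> (\<integral>\<^sup>+x. 2 * (\<integral>\<^sup>+z. ennreal ((w (x + z) - w x)\<^sup>2) * indicator (ball 0 r) z \<partial>lborel)
      + ennreal (2 * \<tau>\<^sup>2 / V) * indicator \<Omega> x \<partial>lborel)"
  proof (rule nn_integral_mono)
    fix x
    show "ennreal V * ennreal ((w x)\<^sup>2) \<le> 2 * (\<integral>\<^sup>+z. ennreal ((w (x + z) - w x)\<^sup>2) * indicator (ball 0 r) z \<partial>lborel)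
      + ennreal (2 * \<tau>\<^sup>2 / V) * indicator \<Omega> x"
    proof (cases "x \<in> \<Omega>")
      case True
      have "(avg u r x - avg u' r x)\<^sup>2 \<le> \<tau>\<^sup>2" using \<tau>[OF True] by (metis abs_ge_zero power2_abs power_mono)
      then have "ennreal (2 * (avg u r x - avg u' r x)\<^sup>2 / V) \<le> ennreal (2 * \<tau>\<^sup>2 / V)"
        using V by (intro ennreal_leI divide_right_mono) auto
      then show ?thesis
        using square_le_avg[OF u r, of x] True by (simp add: w_def V_def) (meson add_left_mono order_trans)
    next
      case False
      then show ?thesis using supp[OF u(1) False] supp[OF u(2) False] by (simp add: w_def)
    qed
  qed
  also have "\<dots> = 2 * (\<integral>\<^sup>+x. \<integral>\<^sup>+z. ennreal ((w (x + z) - w x)\<^sup>2) * indicator (ball 0 r) z \<partial>lborel \<partial>lborel)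
      + ennreal (2 * \<tau>\<^sup>2 / V) * ennreal M"
    using \<Omega> by (subst nn_integral_add) (simp_all add: nn_integral_cmult nn_integral_cmult_indicator)
  also have "(\<integral>\<^sup>+x. \<integral>\<^sup>+z. ennreal ((w (x + z) - w x)\<^sup>2) * indicator (ball 0 r) z \<partial>lborel \<partial>lborel)
      = (\<integral>\<^sup>+z. \<integral>\<^sup>+x. ennreal ((w (x + z) - w x)\<^sup>2) * indicator (ball 0 r) z \<partial>lborel \<partial>lborel)"
    by (rule lborel_pair.Fubini'[symmetric]) measurable
  also have "\<dots> = (\<integral>\<^sup>+z. (\<integral>\<^sup>+x. ennreal ((w (x + z) - w x)\<^sup>2) \<partial>lborel) * indicator (ball 0 r) z \<partial>lborel)"
    by (intro nn_integral_cong nn_integral_multc) measurable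
  also have "\<dots> \<le> (\<integral>\<^sup>+z. ennreal (4 * r\<^sup>2) * indicator (ball (0::'a) r) z \<partial>lborel)"
  proof (intro nn_integral_mono)
    fix z :: 'a
    have "(\<integral>\<^sup>+x. ennreal ((w (x + z) - w x)\<^sup>2) \<partial>lborel) \<le> ennreal (4 * r\<^sup>2)" if "z \<in> ball 0 r"
      using shift[of z] that power_mono[of "norm z" r 2] by (auto intro: order_trans ennreal_leI)
    then show "(\<integral>\<^sup>+x. ennreal ((w (x + z) - w x)\<^sup>2) \<partial>lborel) * indicator (ball 0 r) z \<le> ennreal (4 * r\<^sup>2) * indicator (ball 0 r) z"
      by (auto simp: indicator_def)
  qed
  also have "\<dots> = ennreal (4 * r\<^sup>2) * ennreal V"
    using vol(2)[OF r, of 0] by (simp add: nn_integral_cmult_indicator V_def)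
  finally have "ennreal V * (\<integral>\<^sup>+x. ennreal ((w x)\<^sup>2) \<partial>lborel) \<le> 2 * (ennreal (4 * r\<^sup>2) * ennreal V) + ennreal (2 * \<tau>\<^sup>2 / V) * ennreal M"
    by (simp add: add_right_mono mult_left_mono)
  also have "\<dots> = ennreal (8 * r\<^sup>2 * V + 2 * \<tau>\<^sup>2 / V * M)"
    using V \<Omega>(3) by (simp add: ennreal_plus flip: ennreal_mult ennreal_numeral)
  also have "8 * r\<^sup>2 * V + 2 * \<tau>\<^sup>2 / V * M = V * (8 * r\<^sup>2 + 2 * \<tau>\<^sup>2 * M / V\<^sup>2)"
    using V by (simp add: power2_eq_square field_simps)
  also have "ennreal \<dots> = ennreal V * ennreal (8 * r\<^sup>2 + 2 * \<tau>\<^sup>2 * M / V\<^sup>2)"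
    using V \<Omega>(3) by (intro ennreal_mult) auto
  finally show ?thesis
    using V by (simp add: ennreal_mult_le_mult_iff w_def V_def)
qed

text \<open>Rellich's theorem in the manner of Kolmogorov and Riesz: at a fixed scale
  \<open>r\<close> the averages are precompact in the uniform norm, and the error of averaging is
  uniformly small.\<close>

lemma L2_subsequence:
  fixes u :: "nat \<Rightarrow> 'a \<Rightarrow> real"
  assumes \<Omega>: "\<Omega> \<in> sets borel" "bounded \<Omega>" and u: "\<And>i. u i \<in> \<U>" and \<epsilon>: "\<epsilon> > 0"
  shows "\<exists>s :: nat \<Rightarrow> nat. strict_mono s \<and> (\<forall>i j. (\<integral>\<^sup>+x. ennreal ((u (s i) x - u (s j) x)\<^sup>2) \<partial>lborel) \<le> ennreal \<epsilon>)"
proof -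
  have "emeasure lborel \<Omega> < \<infinity>" by (rule emeasure_bounded_finite[OF \<Omega>(2)])
  then obtain M where M: "emeasure lborel \<Omega> = ennreal M" "M \<ge> 0"
    by (cases "emeasure lborel \<Omega>" rule: ennreal_cases) auto
  \<comment> \<open>The scale is fixed first, so that averaging costs
    \<open>8 * r^2 = \<epsilon> / 2\<close>.\<close>
  define r where "r = sqrt (\<epsilon> / 16)"
  have r: "r > 0" "8 * r\<^sup>2 = \<epsilon> / 2" using \<epsilon> by (auto simp: r_def)
  define V where "V = vol r"
  have V: "V > 0" unfolding V_def by (rule vol(1)[OF r(1)])
  \<comment> \<open>Uniform closeness of the averages that accounts for the other half of
    \<open>\<epsilon>\<close>; \<open>M + 1\<close> avoids division by zero for a null set.\<close>
  define \<tau> where "\<tau> = sqrt (\<epsilon> * V\<^sup>2 / (4 * (M + 1)))"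
  have \<tau>: "\<tau> > 0" using \<epsilon> V M(2) by (simp add: \<tau>_def)
  have \<tau>2: "2 * \<tau>\<^sup>2 * M / V\<^sup>2 \<le> \<epsilon> / 2"
  proof -
    have "\<tau>\<^sup>2 = \<epsilon> * V\<^sup>2 / (4 * (M + 1))" unfolding \<tau>_def using \<epsilon> M(2) by (intro real_sqrt_pow2) auto
    then have "2 * \<tau>\<^sup>2 * M / V\<^sup>2 = \<epsilon> / 2 * (M / (M + 1))" using V M(2) by (simp add: field_simps)
    also have "\<dots> \<le> \<epsilon> / 2 * 1" using \<epsilon> M(2) by (intro mult_left_mono) auto
    finally show ?thesis by simp
  qed
  have "\<exists>g (s :: nat \<Rightarrow> nat). strict_mono s \<and> (\<forall>e>0. \<exists>N. \<forall>n x. n \<ge> N \<and> x \<in> closure \<Omega> \<longrightarrow> norm (avg (u (s n)) r x - g x) < e)"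
  proof (rule Arzela_Ascoli[of "closure \<Omega>" "\<lambda>n. avg (u n) r" "sqrt V"])
    show "compact (closure \<Omega>)" using \<Omega>(2) by (simp add: compact_closure)
    show "norm (avg (u n) r x) \<le> sqrt V" for n x
      using avg_bound(2)[OF u r(1), of n x] real_le_rsqrt by (simp add: V_def abs_le_square_iff real_le_rsqrt)
    fix x :: 'a and e :: real assume e: "e > 0"
    have "norm (avg (u n) r x - avg (u n) r y) < e" if "norm (x - y) < e / sqrt V" for n y
    proof -
      have "\<bar>avg (u n) r x - avg (u n) r y\<bar> \<le> sqrt (V * (norm (x - y))\<^sup>2)"
        using avg_Lipschitz[OF u r(1), of n x y] by (intro real_le_rsqrt) (simp add: V_def)
      also have "\<dots> = sqrt V * norm (x - y)" by (simp add: real_sqrt_mult)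
      also have "\<dots> < e" using that V by (simp add: pos_less_divide_eq mult.commute)
      finally show ?thesis by simp
    qed
    then show "\<exists>d. 0 < d \<and> (\<forall>n y. y \<in> closure \<Omega> \<and> norm (x - y) < d \<longrightarrow> norm (avg (u n) r x - avg (u n) r y) < e)"
      using e V by (intro exI[of _ "e / sqrt V"]) auto
  next
    fix g and k :: "nat \<Rightarrow> nat" assume "strict_mono k"
      and *: "\<And>e. 0 < e \<Longrightarrow> \<exists>N. \<forall>n x. n \<ge> N \<and> x \<in> closure \<Omega> \<longrightarrow> norm (avg (u (k n)) r x - g x) < e"
    then show "\<exists>g (s :: nat \<Rightarrow> nat). strict_mono s \<and> (\<forall>e>0. \<exists>N. \<forall>n x. n \<ge> N \<and> x \<in> closure \<Omega> \<longrightarrow> norm (avg (u (s n)) r x - g x) < e)"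
      by (intro exI[of _ g] exI[of _ k] conjI allI impI *)
  qed
  then obtain g and s :: "nat \<Rightarrow> nat" where s: "strict_mono s" "\<And>e. 0 < e \<Longrightarrow> \<exists>N. \<forall>n x. n \<ge> N \<and> x \<in> closure \<Omega> \<longrightarrow> norm (avg (u (s n)) r x - g x) < e"
    by blast
  obtain N where N: "\<And>n x. n \<ge> N \<Longrightarrow> x \<in> closure \<Omega> \<Longrightarrow> norm (avg (u (s n)) r x - g x) < \<tau> / 2"
    using s(2)[of "\<tau> / 2"] \<tau> by auto
  define s' where "s' i = s (i + N)" for i
  have "(\<integral>\<^sup>+x. ennreal ((u (s' i) x - u (s' j) x)\<^sup>2) \<partial>lborel) \<le> ennreal \<epsilon>" for i j
  proof -
    have "(\<integral>\<^sup>+x. ennreal ((u (s' i) x - u (s' j) x)\<^sup>2) \<partial>lborel) \<le> ennreal (8 * r\<^sup>2 + 2 * \<tau>\<^sup>2 * M / (vol r)\<^sup>2)"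
    proof (rule L2_diff_le[OF u u r(1) \<Omega>(1) M])
      fix x assume "x \<in> \<Omega>"
      then have x: "x \<in> closure \<Omega>" using closure_subset by blast
      show "\<bar>avg (u (s' i)) r x - avg (u (s' j)) r x\<bar> \<le> \<tau>"
      proof -
        have "\<bar>avg (u (s (i + N))) r x - g x\<bar> < \<tau> / 2" "\<bar>avg (u (s (j + N))) r x - g x\<bar> < \<tau> / 2"
          using N[of "i + N" x] N[of "j + N" x] x by simp_all
        then show ?thesis unfolding s'_def by linarith
      qed
    qed
    also have "\<dots> \<le> ennreal \<epsilon>" using r(2) \<tau>2 by (intro ennreal_leI) (simp add: V_def)
    finally show ?thesis .
  qed
  moreover have "strict_mono s'" using s(1) by (auto simp: s'_def strict_mono_def)
  ultimately show ?thesis by (intro exI[of _ s']) simp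
qed

text \<open>\<open>L2_subsequence\<close> yields one tolerance at a time; a diagonal sequence over
  the tolerances \<open>1 / (m + 1)\<close> serves them all.\<close>

lemma L2_Cauchy_subsequence:
  fixes u :: "nat \<Rightarrow> 'a \<Rightarrow> real"
  assumes \<Omega>: "\<Omega> \<in> sets borel" "bounded \<Omega>" and u: "\<And>i. u i \<in> \<U>"
  shows "\<exists>s :: nat \<Rightarrow> nat. strict_mono s \<and> (\<forall>\<epsilon>>0. \<exists>N. \<forall>i\<ge>N. \<forall>j\<ge>N. (\<integral>\<^sup>+x. ennreal ((u (s i) x - u (s j) x)\<^sup>2) \<partial>lborel) \<le> ennreal \<epsilon>)"
proof -
  define P where "P m s \<longleftrightarrow> (\<exists>N. \<forall>i\<ge>N. \<forall>j\<ge>N. (\<integral>\<^sup>+x. ennreal ((u (s i) x - u (s j) x)\<^sup>2) \<partial>lborel) \<le> ennreal (inverse (real (Suc m))))"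
    for m and s :: "nat \<Rightarrow> nat"
  interpret subseqs P
  proof
    fix m and s :: "nat \<Rightarrow> nat" assume "strict_mono s"
    have "\<exists>r :: nat \<Rightarrow> nat. strict_mono r \<and> (\<forall>i j. (\<integral>\<^sup>+x. ennreal ((u (s (r i)) x - u (s (r j)) x)\<^sup>2) \<partial>lborel) \<le> ennreal (inverse (real (Suc m))))"
      by (rule L2_subsequence[OF \<Omega>, of "\<lambda>i. u (s i)"]) (auto intro: u)
    then show "\<exists>r'. strict_mono r' \<and> P m (s \<circ> r')" unfolding P_def by auto
  qed
  \<comment> \<open>The property passes to subsequences, and from index \<open>Suc m\<close> on the
    diagonal sequence is a subsequence of the one chosen for \<open>m\<close>.\<close>
  have "P m (diagseq \<circ> (+) (Suc m))" for m
  proof (rule diagseq_holds)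
    fix r s :: "nat \<Rightarrow> nat" and n assume r: "strict_mono r" and "P n s"
    then obtain N where N: "\<forall>i\<ge>N. \<forall>j\<ge>N. (\<integral>\<^sup>+x. ennreal ((u (s i) x - u (s j) x)\<^sup>2) \<partial>lborel) \<le> ennreal (inverse (real (Suc n)))"
      unfolding P_def by blast
    then show "P n (s \<circ> r)"
      unfolding P_def o_def
    proof (intro exI[of _ N] allI impI)
      fix i j assume "i \<ge> N" "j \<ge> N"
      then have "r i \<ge> N" "r j \<ge> N" using seq_suble[OF r, of i] seq_suble[OF r, of j] by auto
      then show "(\<integral>\<^sup>+x. ennreal ((u (s (r i)) x - u (s (r j)) x)\<^sup>2) \<partial>lborel) \<le> ennreal (inverse (real (Suc n)))"
        using N by simp
    qed
  qed
  then have *: "\<exists>N. \<forall>i\<ge>N. \<forall>j\<ge>N. (\<integral>\<^sup>+x. ennreal ((u (diagseq i) x - u (diagseq j) x)\<^sup>2) \<partial>lborel) \<le> ennreal (inverse (real (Suc m)))" for m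
  proof -
    obtain N where N: "\<And>i j. i \<ge> N \<Longrightarrow> j \<ge> N \<Longrightarrow> (\<integral>\<^sup>+x. ennreal ((u (diagseq (Suc m + i)) x - u (diagseq (Suc m + j)) x)\<^sup>2) \<partial>lborel) \<le> ennreal (inverse (real (Suc m)))"
      using \<open>P m (diagseq \<circ> (+) (Suc m))\<close> unfolding P_def o_def by blast
    show ?thesis
    proof (intro exI[of _ "Suc m + N"] allI impI)
      fix i j assume "Suc m + N \<le> i" "Suc m + N \<le> j"
      then have "Suc m + (i - Suc m) = i" "Suc m + (j - Suc m) = j" "i - Suc m \<ge> N" "j - Suc m \<ge> N" by auto
      then show "(\<integral>\<^sup>+x. ennreal ((u (diagseq i) x - u (diagseq j) x)\<^sup>2) \<partial>lborel) \<le> ennreal (inverse (real (Suc m)))"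
        using N[of "i - Suc m" "j - Suc m"] by (simp only:)
    qed
  qed
  have fin: "\<exists>N. \<forall>i\<ge>N. \<forall>j\<ge>N. (\<integral>\<^sup>+x. ennreal ((u (diagseq i) x - u (diagseq j) x)\<^sup>2) \<partial>lborel) \<le> ennreal \<epsilon>" if "\<epsilon> > 0" for \<epsilon>
  proof -
    obtain m where "inverse (real (Suc m)) < \<epsilon>" using reals_Archimedean[OF \<open>\<epsilon> > 0\<close>] by blast
    then have le: "ennreal (inverse (real (Suc m))) \<le> ennreal \<epsilon>" by (intro ennreal_leI) simp
    obtain N where "\<forall>i\<ge>N. \<forall>j\<ge>N. (\<integral>\<^sup>+x. ennreal ((u (diagseq i) x - u (diagseq j) x)\<^sup>2) \<partial>lborel) \<le> ennreal (inverse (real (Suc m)))"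
      using *[of m] by blast
    then show ?thesis using le by (intro exI[of _ N] allI impI) (rule order_trans[OF _ le], simp)
  qed
  show ?thesis by (intro exI[of _ diagseq] conjI subseq_diagseq allI impI) (rule fin)
qed

text \<open>An exponent \<open>p\<close> is inserted strictly between \<open>max q 2\<close> and the
  critical one. \<open>Lq_bound\<close> controls the \<open>p\<close>-th powers, and
  \<open>powr_interpolate\<close> passes from mean square to exponent \<open>q\<close>.\<close>

lemma Lq_Cauchy_subsequence:
  fixes u :: "nat \<Rightarrow> 'a \<Rightarrow> real"
  assumes \<Omega>: "\<Omega> \<in> sets borel" "bounded \<Omega>" and u: "\<And>i. u i \<in> \<U>" and q: "0 < q" "q < 2 * n / (n - 2)"
  shows "\<exists>s :: nat \<Rightarrow> nat. strict_mono s \<and> (\<forall>\<epsilon>>0. \<exists>N. \<forall>i\<ge>N. \<forall>j\<ge>N. (\<integral>\<^sup>+x. ennreal (\<bar>u (s i) x - u (s j) x\<bar> powr q) \<partial>lborel) \<le> ennreal \<epsilon>)"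
proof -
  have "emeasure lborel \<Omega> < \<infinity>" by (rule emeasure_bounded_finite[OF \<Omega>(2)])
  then obtain M where M: "emeasure lborel \<Omega> = ennreal M" "M \<ge> 0"
    by (cases "emeasure lborel \<Omega>" rule: ennreal_cases) auto
  have n2: "2 < 2 * n / (n - 2)" using n_gt by (simp add: field_simps)
  then obtain p where p: "max q 2 < p" "p < 2 * n / (n - 2)" using q(2) dense[of "max q 2"] by auto
  obtain K where K: "K > 0" "\<And>u. u \<in> \<U> \<Longrightarrow> (\<integral>\<^sup>+x. ennreal (\<bar>u x\<bar> powr p) \<partial>lborel) \<le> ennreal K"
    using Lq_bound[of p] p by auto
  obtain s :: "nat \<Rightarrow> nat" where s: "strict_mono s"
    "\<forall>\<epsilon>>0. \<exists>N. \<forall>i\<ge>N. \<forall>j\<ge>N. (\<integral>\<^sup>+x. ennreal ((u (s i) x - u (s j) x)\<^sup>2) \<partial>lborel) \<le> ennreal \<epsilon>"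
    using L2_Cauchy_subsequence[of u, OF \<Omega> u] by (elim exE conjE)
  have "\<exists>N. \<forall>i\<ge>N. \<forall>j\<ge>N. (\<integral>\<^sup>+x. ennreal (\<bar>u (s i) x - u (s j) x\<bar> powr q) \<partial>lborel) \<le> ennreal \<epsilon>" if \<epsilon>: "\<epsilon> > 0" for \<epsilon>
  proof -
    define K' where "K' = 2 powr p * (K + K)"
    have K': "K' > 0" using K(1) by (simp add: K'_def)
    \<comment> \<open>The constant and the \<open>p\<close>-th power together cost
      \<open>\<delta> * (M + K')\<close>, half of \<open>\<epsilon>\<close>; the mean square, made
      smaller than \<open>\<epsilon> / (2 * C)\<close>, costs the other half.\<close>
    define \<delta> where "\<delta> = \<epsilon> / (2 * (M + K'))"
    have MK: "M + K' > 0" using K' M(2) by simp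
    have \<delta>: "\<delta> > 0" using \<epsilon> MK by (simp add: \<delta>_def)
    obtain C where C: "C > 0" "\<And>t. \<bar>t\<bar> powr q \<le> \<delta> + \<delta> * \<bar>t\<bar> powr p + C * t\<^sup>2"
      using powr_interpolate[OF q(1), of p \<delta>] p(1) \<delta> by auto
    have "\<epsilon> / (2 * C) > 0" using \<epsilon> C(1) by simp
    with s(2) obtain N where N: "\<forall>i\<ge>N. \<forall>j\<ge>N. (\<integral>\<^sup>+x. ennreal ((u (s i) x - u (s j) x)\<^sup>2) \<partial>lborel) \<le> ennreal (\<epsilon> / (2 * C))"
      by (elim allE[of _ "\<epsilon> / (2 * C)"] impE exE)
    have "(\<integral>\<^sup>+x. ennreal (\<bar>u (s i) x - u (s j) x\<bar> powr q) \<partial>lborel) \<le> ennreal \<epsilon>" if ij: "i \<ge> N" "j \<ge> N" for i j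
    proof -
      note [measurable] = meas[OF u] \<Omega>(1)
      define a where "a = u (s i)"
      define b where "b = u (s j)"
      have ab: "a \<in> \<U>" "b \<in> \<U>" by (auto simp: a_def b_def u)
      note [measurable] = meas[OF ab(1)] meas[OF ab(2)]
      have pw: "(\<integral>\<^sup>+x. ennreal (\<bar>a x - b x\<bar> powr p) \<partial>lborel) \<le> ennreal K'"
      proof -
        have "(\<integral>\<^sup>+x. ennreal (\<bar>a x - b x\<bar> powr p) \<partial>lborel) \<le> (\<integral>\<^sup>+x. ennreal (2 powr p) * (ennreal (\<bar>a x\<bar> powr p) + ennreal (\<bar>b x\<bar> powr p)) \<partial>lborel)"
          using p(1) by (intro nn_integral_mono) (simp add: powr_diff_le ennreal_leI flip: ennreal_plus ennreal_mult)
        also have "\<dots> = ennreal (2 powr p) * ((\<integral>\<^sup>+x. ennreal (\<bar>a x\<bar> powr p) \<partial>lborel) + (\<integral>\<^sup>+x. ennreal (\<bar>b x\<bar> powr p) \<partial>lborel))"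
          by (subst nn_integral_cmult, measurable, subst nn_integral_add, measurable)
        also have "\<dots> \<le> ennreal (2 powr p) * (ennreal K + ennreal K)"
          by (intro mult_left_mono add_mono K(2) ab) auto
        also have "\<dots> = ennreal K'" using K(1) by (simp add: K'_def flip: ennreal_plus ennreal_mult)
        finally show ?thesis .
      qed
      have "(\<integral>\<^sup>+x. ennreal (\<bar>a x - b x\<bar> powr q) \<partial>lborel) \<le>
          (\<integral>\<^sup>+x. (ennreal \<delta> * indicator \<Omega> x + ennreal \<delta> * ennreal (\<bar>a x - b x\<bar> powr p)) + ennreal C * ennreal ((a x - b x)\<^sup>2) \<partial>lborel)"
      proof (rule nn_integral_mono)
        fix x
        show "ennreal (\<bar>a x - b x\<bar> powr q) \<le> (ennreal \<delta> * indicator \<Omega> x + ennreal \<delta> * ennreal (\<bar>a x - b x\<bar> powr p)) + ennreal C * ennreal ((a x - b x)\<^sup>2)"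
        proof (cases "x \<in> \<Omega>")
          case True
          have "ennreal (\<bar>a x - b x\<bar> powr q) \<le> ennreal (\<delta> + \<delta> * \<bar>a x - b x\<bar> powr p + C * (a x - b x)\<^sup>2)"
            by (intro ennreal_leI C(2))
          then show ?thesis using True \<delta> C(1) by (simp add: ennreal_plus ennreal_mult)
        next
          case False
          then show ?thesis using supp[OF ab(1) False] supp[OF ab(2) False] by simp
        qed
      qed
      also have "\<dots> = (ennreal \<delta> * ennreal M + ennreal \<delta> * (\<integral>\<^sup>+x. ennreal (\<bar>a x - b x\<bar> powr p) \<partial>lborel)) + ennreal C * (\<integral>\<^sup>+x. ennreal ((a x - b x)\<^sup>2) \<partial>lborel)"
        using M \<Omega>(1) by (simp add: nn_integral_add nn_integral_cmult nn_integral_cmult_indicator)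
      also have "\<dots> \<le> (ennreal \<delta> * ennreal M + ennreal \<delta> * ennreal K') + ennreal C * ennreal (\<epsilon> / (2 * C))"
        using N ij by (intro add_mono mult_left_mono pw order_refl) (auto simp: a_def b_def)
      also have "\<dots> = ennreal (\<delta> * (M + K') + C * (\<epsilon> / (2 * C)))"
      proof -
        have "ennreal C * ennreal (\<epsilon> / (2 * C)) = ennreal (C * (\<epsilon> / (2 * C)))"
          using C(1) \<epsilon> by (intro ennreal_mult[symmetric]) auto
        moreover have "ennreal \<delta> * ennreal M = ennreal (\<delta> * M)" "ennreal \<delta> * ennreal K' = ennreal (\<delta> * K')"
          using \<delta> M(2) K' by (intro ennreal_mult[symmetric]; simp)+
        moreover have "0 \<le> \<delta> * M" "0 \<le> \<delta> * K'" "0 \<le> C * (\<epsilon> / (2 * C))"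
          using \<delta> M(2) K' C(1) \<epsilon> by auto
        ultimately show ?thesis by (simp only: distrib_left ennreal_plus add_nonneg_nonneg)
      qed
      also have "\<delta> * (M + K') + C * (\<epsilon> / (2 * C)) = \<epsilon>"
      proof -
        have "\<epsilon> / (2 * c) * c = \<epsilon> / 2" if "c > 0" for c :: real using that by simp
        then have "\<delta> * (M + K') = \<epsilon> / 2" unfolding \<delta>_def using MK by blast
        moreover have "C * (\<epsilon> / (2 * C)) = \<epsilon> / 2" using C(1) by simp
        ultimately show ?thesis by linarith
      qed
      finally show ?thesis by (simp add: a_def b_def)
    qed
    then show ?thesis by (intro exI[of _ N]) simp
  qed
  then show ?thesis using s(1) by (intro exI[of _ s]) simp
qed

end

section \<open>Completeness\<close>

text \<open>Riesz-Fischer. Along a fast subsequence the weighted sum \<open>g\<close> of the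
  increments is integrable, hence finite almost everywhere, and its finiteness forces geometric
  decay of the increments at the point; Fatou's lemma then handles the whole sequence.\<close>

lemma Lq_complete:
  fixes u :: "nat \<Rightarrow> 'a::euclidean_space \<Rightarrow> real" and q :: real
  assumes q: "q > 0" and u[measurable]: "\<And>i. u i \<in> borel_measurable borel"
    and cauchy: "\<forall>\<epsilon>>0. \<exists>N. \<forall>i\<ge>N. \<forall>j\<ge>N. (\<integral>\<^sup>+x. ennreal (\<bar>u i x - u j x\<bar> powr q) \<partial>lborel) \<le> ennreal \<epsilon>"
  shows "\<exists>w\<in>borel_measurable borel. \<forall>\<epsilon>>0. \<exists>N. \<forall>i\<ge>N. (\<integral>\<^sup>+x. ennreal (\<bar>u i x - w x\<bar> powr q) \<partial>lborel) \<le> ennreal \<epsilon>"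
proof -
  \<comment> \<open>One factor \<open>2 powr (- j)\<close> is spent on summability of the integrals,
    the factor \<open>2 powr (- q * j)\<close> on the pointwise decay of the increments.\<close>
  define e where "e j = (1 / 2 :: real) ^ j / (2 powr q) ^ j" for j :: nat
  have e: "e j > 0" for j by (simp add: e_def)
  have "\<exists>N. \<forall>i\<ge>N. \<forall>j\<ge>N. (\<integral>\<^sup>+x. ennreal (\<bar>u i x - u j x\<bar> powr q) \<partial>lborel) \<le> ennreal (e k)" for k
    using cauchy e by blast
  then obtain N where N: "\<And>k. \<forall>i\<ge>N k. \<forall>j\<ge>N k. (\<integral>\<^sup>+x. ennreal (\<bar>u i x - u j x\<bar> powr q) \<partial>lborel) \<le> ennreal (e k)"
    by metis
  \<comment> \<open>Nondecreasing and at least \<open>N j\<close>, so consecutive indices both lie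
    in the range governed by \<open>N j\<close>; the summand \<open>j\<close> makes it
    unbounded.\<close>
  define \<kappa> where "\<kappa> j = j + (\<Sum>i\<le>j. N i)" for j
  have \<kappa>_ge: "N j \<le> \<kappa> j" "j \<le> \<kappa> j" for j
    using member_le_sum[of j "{..j}" N] by (auto simp: \<kappa>_def)
  have \<kappa>_Suc: "\<kappa> j \<le> \<kappa> (Suc j)" for j by (simp add: \<kappa>_def)
  define d where "d j x = u (\<kappa> (Suc j)) x - u (\<kappa> j) x" for j x
  have [measurable]: "d j \<in> borel_measurable borel" for j unfolding d_def by measurable
  have d_le: "(\<integral>\<^sup>+x. ennreal (\<bar>d j x\<bar> powr q) \<partial>lborel) \<le> ennreal (e j)" for j
    using N[of j] \<kappa>_ge(1)[of j] \<kappa>_Suc[of j] by (simp add: d_def)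
  define g where "g x = (\<Sum>j. ennreal ((2 powr q) ^ j) * ennreal (\<bar>d j x\<bar> powr q))" for x
  have [measurable]: "g \<in> borel_measurable borel" unfolding g_def by measurable
  have "(\<integral>\<^sup>+x. g x \<partial>lborel) = (\<Sum>j. \<integral>\<^sup>+x. ennreal ((2 powr q) ^ j) * ennreal (\<bar>d j x\<bar> powr q) \<partial>lborel)"
    unfolding g_def by (rule nn_integral_suminf) measurable
  also have "\<dots> \<le> (\<Sum>j. ennreal ((1 / 2) ^ j))"
  proof (intro suminf_le summableI)
    fix j
    have "(\<integral>\<^sup>+x. ennreal ((2 powr q) ^ j) * ennreal (\<bar>d j x\<bar> powr q) \<partial>lborel) = ennreal ((2 powr q) ^ j) * (\<integral>\<^sup>+x. ennreal (\<bar>d j x\<bar> powr q) \<partial>lborel)"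
      by (rule nn_integral_cmult) measurable
    also have "\<dots> \<le> ennreal ((2 powr q) ^ j) * ennreal (e j)" by (intro mult_left_mono d_le) simp
    also have "\<dots> = ennreal ((2 powr q) ^ j * e j)" using e[of j] by (intro ennreal_mult[symmetric]) auto
    also have "(2 powr q) ^ j * e j = (1 / 2) ^ j" by (simp add: e_def)
    finally show "(\<integral>\<^sup>+x. ennreal ((2 powr q) ^ j) * ennreal (\<bar>d j x\<bar> powr q) \<partial>lborel) \<le> ennreal ((1 / 2) ^ j)" .
  qed
  also have "\<dots> = ennreal (1 / (1 - 1 / 2))"
    by (intro suminf_ennreal_eq geometric_sums) auto
  finally have "(\<integral>\<^sup>+x. g x \<partial>lborel) \<noteq> \<infinity>" by (auto simp: top_unique)
  then have AE_fin: "AE x in lborel. g x \<noteq> \<infinity>" by (intro nn_integral_PInf_AE) auto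
  define w where "w x = lim (\<lambda>j. u (\<kappa> j) x)" for x
  have [measurable]: "w \<in> borel_measurable borel" unfolding w_def by measurable
  have conv: "(\<lambda>j. u (\<kappa> j) x) \<longlonglongrightarrow> w x" if fin: "g x \<noteq> \<infinity>" for x
  proof -
    obtain G where G: "g x = ennreal G" "G \<ge> 0" using fin by (cases "g x" rule: ennreal_cases) auto
    have bound: "\<bar>d j x\<bar> \<le> G powr (1 / q) * (1 / 2) ^ j" for j
    proof -
      have "ennreal ((2 powr q) ^ j) * ennreal (\<bar>d j x\<bar> powr q) \<le> g x"
        unfolding g_def using sum_le_suminf[of "\<lambda>j. ennreal ((2 powr q) ^ j) * ennreal (\<bar>d j x\<bar> powr q)" "{j}"]
        by (simp add: summableI)
      then have "(2 powr q) ^ j * \<bar>d j x\<bar> powr q \<le> G"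
        using G by (simp add: ennreal_le_iff flip: ennreal_mult)
      also have "(2 powr q) ^ j = (2 ^ j) powr q"
        by (simp add: powr_realpow[symmetric] powr_powr mult.commute)
      also have "(2 ^ j) powr q * \<bar>d j x\<bar> powr q = (2 ^ j * \<bar>d j x\<bar>) powr q" by (simp add: powr_mult)
      finally have "((2 ^ j * \<bar>d j x\<bar>) powr q) powr (1 / q) \<le> G powr (1 / q)"
        using q by (intro powr_mono2) auto
      then have "2 ^ j * \<bar>d j x\<bar> \<le> G powr (1 / q)" using q by (simp add: powr_powr)
      then show ?thesis by (simp add: field_simps)
    qed
    have "summable (\<lambda>j. G powr (1 / q) * (1 / 2 :: real) ^ j)"
      by (intro summable_mult summable_geometric) simp
    then have "summable (\<lambda>j. d j x)"
      by (rule summable_comparison_test') (use bound in simp)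
    then have "convergent (\<lambda>n. \<Sum>j<n. d j x)" by (simp add: summable_iff_convergent)
    moreover have "(\<Sum>j<n. d j x) = u (\<kappa> n) x - u (\<kappa> 0) x" for n
      unfolding d_def by (rule sum_lessThan_telescope)
    ultimately have "convergent (\<lambda>n. u (\<kappa> n) x - u (\<kappa> 0) x)" by simp
    then have "convergent (\<lambda>n. u (\<kappa> n) x - u (\<kappa> 0) x + u (\<kappa> 0) x)" by (intro convergent_add convergent_const)
    then show ?thesis by (simp add: w_def convergent_LIMSEQ_iff)
  qed
  have "\<exists>N. \<forall>i\<ge>N. (\<integral>\<^sup>+x. ennreal (\<bar>u i x - w x\<bar> powr q) \<partial>lborel) \<le> ennreal \<epsilon>" if "\<epsilon> > 0" for \<epsilon>
  proof -
    obtain M where M: "\<forall>i\<ge>M. \<forall>j\<ge>M. (\<integral>\<^sup>+x. ennreal (\<bar>u i x - u j x\<bar> powr q) \<partial>lborel) \<le> ennreal \<epsilon>"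
      using cauchy \<open>\<epsilon> > 0\<close> by blast
    have "(\<integral>\<^sup>+x. ennreal (\<bar>u i x - w x\<bar> powr q) \<partial>lborel) \<le> ennreal \<epsilon>" if "i \<ge> M" for i
    proof -
      \<comment> \<open>Almost everywhere the integrand is the limit along \<open>\<kappa>\<close>,
        which puts it into the form required by Fatou's lemma.\<close>
      have "(\<integral>\<^sup>+x. ennreal (\<bar>u i x - w x\<bar> powr q) \<partial>lborel) = (\<integral>\<^sup>+x. liminf (\<lambda>j. ennreal (\<bar>u i x - u (\<kappa> j) x\<bar> powr q)) \<partial>lborel)"
      proof (rule nn_integral_cong_AE, use AE_fin in eventually_elim)
        fix x assume "g x \<noteq> \<infinity>"
        then have "(\<lambda>j. \<bar>u i x - u (\<kappa> j) x\<bar> powr q) \<longlonglongrightarrow> \<bar>u i x - w x\<bar> powr q"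
          using q by (intro tendsto_powr' tendsto_intros conv) auto
        then have "(\<lambda>j. ennreal (\<bar>u i x - u (\<kappa> j) x\<bar> powr q)) \<longlonglongrightarrow> ennreal (\<bar>u i x - w x\<bar> powr q)"
          by (rule tendsto_ennrealI)
        then show "ennreal (\<bar>u i x - w x\<bar> powr q) = liminf (\<lambda>j. ennreal (\<bar>u i x - u (\<kappa> j) x\<bar> powr q))"
          by (rule lim_imp_Liminf[OF sequentially_bot, symmetric])
      qed
      also have "\<dots> \<le> liminf (\<lambda>j. \<integral>\<^sup>+x. ennreal (\<bar>u i x - u (\<kappa> j) x\<bar> powr q) \<partial>lborel)"
        by (rule nn_integral_liminf) measurable
      also have "\<dots> \<le> ennreal \<epsilon>"
      proof (rule Liminf_le[OF sequentially_bot])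
        show "\<forall>\<^sub>F j in sequentially. (\<integral>\<^sup>+x. ennreal (\<bar>u i x - u (\<kappa> j) x\<bar> powr q) \<partial>lborel) \<le> ennreal \<epsilon>"
          using eventually_ge_at_top[of M]
          by eventually_elim (use M that \<kappa>_ge(2) order_trans in blast)
      qed
      finally show ?thesis .
    qed
    then show ?thesis by (intro exI[of _ M]) simp
  qed
  then show ?thesis by (intro bexI[of _ w]) auto
qed

section \<open>Sobolev functions\<close>

lemma test_function_Ck: "\<phi> \<in> test_functions \<Omega> \<Longrightarrow> Ck_on n UNIV \<phi>"
  by (simp add: test_functions_def smooth_on_def)

lemma test_function_has_derivative:
  "\<phi> \<in> test_functions \<Omega> \<Longrightarrow> (\<phi> has_derivative frechet_derivative \<phi> (at x)) (at x)"
  by (rule Ck_on_Suc_has_derivative[OF test_function_Ck UNIV_I])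

lemma test_function_continuous: "\<phi> \<in> test_functions \<Omega> \<Longrightarrow> continuous_on S \<phi>"
  using Ck_on_imp_continuous_on[OF test_function_Ck] continuous_on_subset by blast

lemma test_function_borel [measurable_dest]: "\<phi> \<in> test_functions \<Omega> \<Longrightarrow> \<phi> \<in> borel_measurable borel"
  by (intro borel_measurable_continuous_onI test_function_continuous)

lemma test_function_compact_support:
  assumes "\<phi> \<in> test_functions \<Omega>"
  obtains K where "compact K" "K \<subseteq> \<Omega>" "\<And>x. x \<notin> K \<Longrightarrow> \<phi> x = 0"
  using assms closure_subset[of "{x. \<phi> x \<noteq> 0}"] unfolding test_functions_def by (intro that[of "closure {x. \<phi> x \<noteq> 0}"]) auto

lemma test_function_outside: "\<phi> \<in> test_functions \<Omega> \<Longrightarrow> x \<notin> \<Omega> \<Longrightarrow> \<phi> x = 0"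
  by (metis subsetD test_function_compact_support)

lemma test_functionI:
  assumes "smooth_on UNIV \<phi>" "compact K" "K \<subseteq> \<Omega>" "\<And>x. x \<notin> K \<Longrightarrow> \<phi> x = 0"
  shows "\<phi> \<in> test_functions \<Omega>"
proof -
  have sub: "{x. \<phi> x \<noteq> 0} \<subseteq> K" using assms(4) by blast
  then have "closure {x. \<phi> x \<noteq> 0} \<subseteq> K" by (rule closure_minimal) (rule compact_imp_closed[OF assms(2)])
  moreover have "bounded {x. \<phi> x \<noteq> 0}" using compact_imp_bounded[OF assms(2)] bounded_subset sub by blast
  ultimately show ?thesis using assms by (auto simp: test_functions_def compact_closure)
qed

lemma test_function_deriv:
  assumes "\<phi> \<in> test_functions \<Omega>"
  shows "(\<lambda>x. frechet_derivative \<phi> (at x) v) \<in> test_functions \<Omega>"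
proof -
  obtain K where K: "compact K" "K \<subseteq> \<Omega>" "\<And>x. x \<notin> K \<Longrightarrow> \<phi> x = 0"
    using test_function_compact_support[OF assms] by blast
  show ?thesis
  proof (rule test_functionI[OF _ K(1,2)])
    show "smooth_on UNIV (\<lambda>x. frechet_derivative \<phi> (at x) v)"
      using assms by (intro smooth_on_frechet) (simp add: test_functions_def)
    fix x assume x: "x \<notin> K"
    have "((\<lambda>x. 0) has_derivative (\<lambda>_. 0)) (at x)" by (rule has_derivative_const)
    then have "(\<phi> has_derivative (\<lambda>_. 0)) (at x)"
      by (rule has_derivative_transform_within_open[where s = "- K"])
        (use x K compact_imp_closed in \<open>auto simp: open_Compl\<close>)
    then show "frechet_derivative \<phi> (at x) v = 0" using frechet_derivative_at by metis
  qed
qed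

lemma test_function_mult:
  assumes "\<phi> \<in> test_functions \<Omega>" "\<psi> \<in> test_functions \<Omega>"
  shows "(\<lambda>x. \<phi> x * \<psi> x) \<in> test_functions \<Omega>"
proof -
  obtain K where K: "compact K" "K \<subseteq> \<Omega>" "\<And>x. x \<notin> K \<Longrightarrow> \<phi> x = 0"
    using test_function_compact_support[OF assms(1)] by blast
  have "smooth_on UNIV (\<lambda>x. \<phi> x * \<psi> x)"
    unfolding smooth_on_def
    by (intro allI Ck_on_mult open_UNIV test_function_Ck[OF assms(1)] test_function_Ck[OF assms(2)])
  then show ?thesis by (rule test_functionI[OF _ K(1,2)]) (simp add: K(3))
qed

lemma test_function_integrable: "\<phi> \<in> test_functions \<Omega> \<Longrightarrow> integrable lborel \<phi>"
proof -
  assume \<phi>: "\<phi> \<in> test_functions \<Omega>"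
  obtain K where K: "compact K" "K \<subseteq> \<Omega>" "\<And>x. x \<notin> K \<Longrightarrow> \<phi> x = 0"
    using test_function_compact_support[OF \<phi>] by blast
  have "integrable lborel (\<lambda>x. indicator K x *\<^sub>R \<phi> x)"
    by (rule borel_integrable_compact[OF K(1) test_function_continuous[OF \<phi>]])
  also have "(\<lambda>x. indicator K x *\<^sub>R \<phi> x) = \<phi>"
  proof (rule ext)
    show "indicator K x *\<^sub>R \<phi> x = \<phi> x" for x using K(3)[of x] by (cases "x \<in> K") auto
  qed
  finally show ?thesis .
qed

lemma test_function_bounded:
  assumes \<phi>: "\<phi> \<in> test_functions \<Omega>"
  obtains B where "B > 0" "\<And>x. \<bar>\<phi> x\<bar> \<le> B"
proof -
  obtain K where K: "compact K" "K \<subseteq> \<Omega>" "\<And>x. x \<notin> K \<Longrightarrow> \<phi> x = 0"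
    using test_function_compact_support[OF \<phi>] by blast
  have "bounded (\<phi> ` K)"
    by (intro compact_imp_bounded compact_continuous_image test_function_continuous[OF \<phi>] K(1))
  then obtain B where "B > 0" "\<And>x. x \<in> K \<Longrightarrow> \<bar>\<phi> x\<bar> \<le> B" by (auto simp: bounded_pos)
  then show thesis using K(3) by (intro that[of B]) (metis abs_zero less_imp_le)+
qed

lemma line_has_derivative:
  fixes \<phi> :: "'a::euclidean_space \<Rightarrow> real"
  assumes "\<phi> \<in> test_functions \<Omega>"
  shows "((\<lambda>t. \<phi> (x + t *\<^sub>R z)) has_real_derivative frechet_derivative \<phi> (at (x + t *\<^sub>R z)) z) (at t)"
proof -
  let ?D = "frechet_derivative \<phi> (at (x + t *\<^sub>R z))"
  have "((\<lambda>t. x + t *\<^sub>R z) has_derivative (\<lambda>s. s *\<^sub>R z)) (at t)"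
    by (auto intro!: derivative_eq_intros)
  from has_derivative_compose[OF this test_function_has_derivative[OF assms]]
  have "((\<lambda>t. \<phi> (x + t *\<^sub>R z)) has_derivative (\<lambda>s. ?D (s *\<^sub>R z))) (at t)" .
  moreover have "linear ?D" using test_function_has_derivative[OF assms] has_derivative_linear by blast
  then have "(\<lambda>s. ?D (s *\<^sub>R z)) = (*) (?D z)" by (auto simp: linear_cmul)
  ultimately show ?thesis unfolding has_field_derivative_def by simp
qed

lemma lborel_integral_translate:
  fixes f :: "'a::euclidean_space \<Rightarrow> real"
  assumes [measurable]: "f \<in> borel_measurable borel"
  shows "(\<integral>x. f (c + x) \<partial>lborel) = (\<integral>x. f x \<partial>lborel)"
proof -
  have "(\<integral>x. f x \<partial>lborel) = (\<integral>x. f x \<partial>(distr lborel borel ((+) c)))" by (simp add: lborel_distr_plus)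
  also have "\<dots> = (\<integral>x. f (c + x) \<partial>lborel)" by (rule integral_distr) auto
  finally show ?thesis by simp
qed

text \<open>Difference quotients of a test function have integral zero by translation invariance.\<close>

lemma integral_test_function_deriv:
  fixes \<phi> :: "'a::euclidean_space \<Rightarrow> real"
  assumes \<phi>: "\<phi> \<in> test_functions \<Omega>"
  shows "(\<integral>x. frechet_derivative \<phi> (at x) v \<partial>lborel) = 0"
proof -
  note [measurable] = test_function_borel[OF \<phi>]
  define D where "D x = frechet_derivative \<phi> (at x) v" for x
  have D: "D \<in> test_functions \<Omega>" unfolding D_def by (rule test_function_deriv[OF \<phi>])
  note [measurable] = test_function_borel[OF D]
  obtain L where L: "L > 0" "\<And>x. \<bar>D x\<bar> \<le> L" using test_function_bounded[OF D] by blast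
  obtain K where K: "compact K" "K \<subseteq> \<Omega>" "\<And>x. x \<notin> K \<Longrightarrow> \<phi> x = 0"
    using test_function_compact_support[OF \<phi>] by blast
  obtain b where b: "\<And>x. x \<in> K \<Longrightarrow> norm x \<le> b" using compact_imp_bounded[OF K(1)] by (auto simp: bounded_iff)
  \<comment> \<open>All translates involved are by at most \<open>norm v\<close> because
    \<open>s n \<le> 1\<close>, so one ball carries every difference quotient.\<close>
  define S where "S = cball (0::'a) (b + norm v)"
  define s where "s n = inverse (real (Suc n))" for n
  have s: "0 < s n" "s n \<le> 1" for n by (auto simp: s_def field_simps)
  have s_lim: "s \<longlonglongrightarrow> 0" unfolding s_def by (rule LIMSEQ_inverse_real_of_nat)
  define Q where "Q n x = (\<phi> (x + s n *\<^sub>R v) - \<phi> x) / s n" for n x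
  have [measurable]: "Q n \<in> borel_measurable borel" for n unfolding Q_def by measurable
  have Q0: "(\<integral>x. Q n x \<partial>lborel) = 0" for n
  proof -
    have "integrable lborel (\<lambda>x. \<phi> (s n *\<^sub>R v + x))"
    proof -
      have "integrable (distr lborel borel ((+) (s n *\<^sub>R v))) \<phi>"
        using test_function_integrable[OF \<phi>] by (simp add: lborel_distr_plus)
      then show ?thesis by (subst (asm) integrable_distr_eq) auto
    qed
    then have "(\<integral>x. \<phi> (s n *\<^sub>R v + x) - \<phi> x \<partial>lborel) = 0"
      using test_function_integrable[OF \<phi>] lborel_integral_translate[of \<phi> "s n *\<^sub>R v"] by simp
    then show ?thesis by (simp add: Q_def add.commute)
  qed
  \<comment> \<open>The mean value theorem along the segment bounds the quotient by the derivative;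
    this gives the integrable majorant.\<close>
  have Q_bound: "norm (Q n x) \<le> L * indicator S x" for n x
  proof (cases "x \<in> S")
    case True
    have "\<exists>t. 0 < t \<and> t < s n \<and> \<phi> (x + s n *\<^sub>R v) - \<phi> (x + 0 *\<^sub>R v) = (s n - 0) * D (x + t *\<^sub>R v)"
      by (rule MVT2[OF s(1)[of n]]) (unfold D_def, rule line_has_derivative[OF \<phi>])
    then obtain t where "\<phi> (x + s n *\<^sub>R v) - \<phi> x = s n * D (x + t *\<^sub>R v)" by auto
    then have "Q n x = D (x + t *\<^sub>R v)" using s(1)[of n] by (simp add: Q_def)
    then show ?thesis using L(2) True by simp
  next
    case False
    then have nx: "norm x > b + norm v" by (simp add: S_def)
    have "x \<notin> K" using nx b[of x] norm_ge_zero[of v] by linarith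
    moreover have "x + s n *\<^sub>R v \<notin> K"
    proof
      assume "x + s n *\<^sub>R v \<in> K"
      then have "norm (x + s n *\<^sub>R v) \<le> b" by (rule b)
      moreover have "norm (s n *\<^sub>R v) \<le> norm v" using s[of n] by (simp add: mult_left_le_one_le)
      ultimately show False using nx norm_triangle_ineq4[of "x + s n *\<^sub>R v" "s n *\<^sub>R v"] by simp
    qed
    ultimately show ?thesis using K(3) False by (simp add: Q_def)
  qed
  have Q_lim: "(\<lambda>n. Q n x) \<longlonglongrightarrow> D x" for x
  proof -
    have "((\<lambda>t. \<phi> (x + t *\<^sub>R v)) has_real_derivative D x) (at 0)"
      using line_has_derivative[OF \<phi>, of x v 0] by (simp add: D_def)
    then have "((\<lambda>h. (\<phi> (x + h *\<^sub>R v) - \<phi> x) / h) \<longlongrightarrow> D x) (at 0)"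
      by (simp add: has_field_derivative_iff)
    moreover have "filterlim s (at 0) sequentially"
      unfolding filterlim_at using s_lim s(1) by (auto simp: less_imp_neq[symmetric])
    ultimately show ?thesis unfolding Q_def by (rule filterlim_compose)
  qed
  have "(\<lambda>n. \<integral>x. Q n x \<partial>lborel) \<longlonglongrightarrow> (\<integral>x. D x \<partial>lborel)"
  proof (rule integral_dominated_convergence[where w = "\<lambda>x. L * indicator S x"])
    have "integrable lborel (indicator S :: 'a \<Rightarrow> real)"
      unfolding S_def by (intro integrable_real_indicator emeasure_bounded_finite) auto
    then show "integrable lborel (\<lambda>x. L * indicator S x)" by simp
  qed (use Q_lim Q_bound in auto)
  then have "(\<lambda>n. 0) \<longlonglongrightarrow> (\<integral>x. D x \<partial>lborel)" unfolding Q0 .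
  then show ?thesis by (simp add: LIMSEQ_const_iff D_def)
qed

text \<open>The product of the two test functions is again one, so its derivative integrates to
  zero.\<close>

lemma integral_by_parts:
  fixes \<phi> \<psi> :: "'a::euclidean_space \<Rightarrow> real"
  assumes \<phi>: "\<phi> \<in> test_functions \<Omega>" and \<psi>: "\<psi> \<in> test_functions \<Omega>"
  shows "(\<integral>x. \<phi> x * frechet_derivative \<psi> (at x) v \<partial>lborel) = - (\<integral>x. frechet_derivative \<phi> (at x) v * \<psi> x \<partial>lborel)"
proof -
  have "frechet_derivative (\<lambda>x. \<phi> x * \<psi> x) (at x) v = \<phi> x * frechet_derivative \<psi> (at x) v + frechet_derivative \<phi> (at x) v * \<psi> x" for x
  proof -
    have "((\<lambda>x. \<phi> x * \<psi> x) has_derivative (\<lambda>v. \<phi> x * frechet_derivative \<psi> (at x) v + frechet_derivative \<phi> (at x) v * \<psi> x)) (at x)"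
      by (intro has_derivative_mult test_function_has_derivative[OF \<phi>] test_function_has_derivative[OF \<psi>])
    from fun_cong[OF frechet_derivative_at[OF this], of v] show ?thesis by simp
  qed
  then have "(\<integral>x. \<phi> x * frechet_derivative \<psi> (at x) v + frechet_derivative \<phi> (at x) v * \<psi> x \<partial>lborel) = 0"
    using integral_test_function_deriv[OF test_function_mult[OF \<phi> \<psi>], of v] by simp
  moreover have "integrable lborel (\<lambda>x. \<phi> x * frechet_derivative \<psi> (at x) v)" "integrable lborel (\<lambda>x. frechet_derivative \<phi> (at x) v * \<psi> x)"
    by (intro test_function_integrable[of _ \<Omega>] test_function_mult test_function_deriv \<phi> \<psi>)+
  ultimately show ?thesis by simp
qed

definition grad :: "('a::euclidean_space \<Rightarrow> real) \<Rightarrow> 'a \<Rightarrow> 'a" where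
  "grad \<phi> x = (\<Sum>b\<in>Basis. frechet_derivative \<phi> (at x) b *\<^sub>R b)"

lemma grad_inner_Basis: "b \<in> Basis \<Longrightarrow> grad \<phi> x \<bullet> b = frechet_derivative \<phi> (at x) b"
  by (simp add: grad_def inner_sum_left inner_Basis if_distrib sum.delta cong: if_cong)

lemma norm_grad_square: "(norm (grad \<phi> x))\<^sup>2 = (\<Sum>b\<in>Basis. (frechet_derivative \<phi> (at x) b)\<^sup>2)"
proof -
  have "(norm (grad \<phi> x))\<^sup>2 = (\<Sum>b\<in>Basis. (grad \<phi> x \<bullet> b) * (grad \<phi> x \<bullet> b))"
    unfolding power2_norm_eq_inner by (rule euclidean_inner)
  then show ?thesis by (simp add: grad_inner_Basis power2_eq_square)
qed

lemma frechet_eq_grad: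
  assumes "\<phi> \<in> test_functions \<Omega>"
  shows "frechet_derivative \<phi> (at x) v = grad \<phi> x \<bullet> v"
proof -
  let ?D = "frechet_derivative \<phi> (at x)"
  have lin: "linear ?D" using test_function_has_derivative[OF assms] has_derivative_linear by blast
  have "?D (\<Sum>b\<in>Basis. (v \<bullet> b) *\<^sub>R b) = (\<Sum>b\<in>Basis. (v \<bullet> b) * ?D b)"
    by (simp add: linear_sum[OF lin] linear_cmul[OF lin])
  also have "\<dots> = grad \<phi> x \<bullet> v"
    by (simp add: grad_def inner_sum_left inner_sum_right mult.commute inner_commute)
  finally show ?thesis by (simp add: euclidean_representation)
qed

lemma grad_norm_test:
  assumes "\<phi> \<in> test_functions \<Omega>"
  shows "(\<lambda>x. (norm (grad \<phi> x))\<^sup>2) \<in> borel_measurable borel" "integrable lborel (\<lambda>x. (norm (grad \<phi> x))\<^sup>2)"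
proof -
  have "integrable lborel (\<lambda>x. \<Sum>b\<in>Basis. (frechet_derivative \<phi> (at x) b)\<^sup>2)"
    unfolding power2_eq_square
    by (intro Bochner_Integration.integrable_sum test_function_integrable[of _ \<Omega>] test_function_mult test_function_deriv assms)
  then show "integrable lborel (\<lambda>x. (norm (grad \<phi> x))\<^sup>2)" by (simp add: norm_grad_square)
  then show "(\<lambda>x. (norm (grad \<phi> x))\<^sup>2) \<in> borel_measurable borel" using borel_measurable_integrable by fastforce
qed

lemma borel_lebesgue_on: "f \<in> borel_measurable borel \<Longrightarrow> f \<in> borel_measurable (lebesgue_on \<Omega>)"
  by (intro measurable_restrict_space1 measurable_completion) simp

text \<open>The function spaces integrate over \<open>lebesgue_on\<close>; Borel functions vanishing
  off the domain are moved to \<open>lborel\<close>, where the arguments by Fubini and translation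
  take place.\<close>

lemma lebesgue_on_borel:
  fixes f :: "'a::euclidean_space \<Rightarrow> real"
  assumes \<Omega>: "open \<Omega>" and f[measurable]: "f \<in> borel_measurable borel" and out: "\<And>x. x \<notin> \<Omega> \<Longrightarrow> f x = 0"
  shows "(\<integral>x. f x \<partial>lebesgue_on \<Omega>) = (\<integral>x. f x \<partial>lborel)"
    and "integrable (lebesgue_on \<Omega>) f \<longleftrightarrow> integrable lborel f"
proof -
  have S: "\<Omega> \<inter> space lebesgue \<in> sets lebesgue" using \<Omega> by auto
  have eq: "(\<lambda>x. indicator \<Omega> x *\<^sub>R f x) = f"
  proof (rule ext)
    show "indicator \<Omega> x *\<^sub>R f x = f x" for x using out[of x] by (cases "x \<in> \<Omega>") auto
  qed
  have meas: "f \<in> lborel \<rightarrow>\<^sub>M borel" by simp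
  show "(\<integral>x. f x \<partial>lebesgue_on \<Omega>) = (\<integral>x. f x \<partial>lborel)"
    using integral_restrict_space[OF S, of f] integral_completion[OF meas] unfolding eq by simp
  show "integrable (lebesgue_on \<Omega>) f \<longleftrightarrow> integrable lborel f"
    using integrable_restrict_space[OF S, of f] integrable_completion[OF meas] unfolding eq by simp
qed

lemma test_function_lebesgue_on:
  assumes "open \<Omega>" "\<phi> \<in> test_functions \<Omega>"
  shows "\<phi> \<in> borel_measurable (lebesgue_on \<Omega>)" "integrable (lebesgue_on \<Omega>) \<phi>"
    "(\<integral>x. \<phi> x \<partial>lebesgue_on \<Omega>) = (\<integral>x. \<phi> x \<partial>lborel)"
  using borel_lebesgue_on[OF test_function_borel[OF assms(2)]] test_function_integrable[OF assms(2)]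
    lebesgue_on_borel[OF assms(1) test_function_borel[OF assms(2)] test_function_outside[OF assms(2)]]
  by auto

lemma integrable_mult_L2:
  fixes f g :: "'a \<Rightarrow> real"
  assumes [measurable]: "f \<in> borel_measurable M" "g \<in> borel_measurable M"
    and "integrable M (\<lambda>x. (f x)\<^sup>2)" "integrable M (\<lambda>x. (g x)\<^sup>2)"
  shows "integrable M (\<lambda>x. f x * g x)"
proof (rule Bochner_Integration.integrable_bound[OF Bochner_Integration.integrable_add[OF assms(3,4)]])
  have "\<bar>a * b\<bar> \<le> a\<^sup>2 + b\<^sup>2" for a b :: real
  proof -
    have "2 * (\<bar>a\<bar> * \<bar>b\<bar>) \<le> a\<^sup>2 + b\<^sup>2" using sum_squares_bound[of "\<bar>a\<bar>" "\<bar>b\<bar>"] by (simp add: mult.assoc)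
    moreover have "0 \<le> \<bar>a\<bar> * \<bar>b\<bar>" by simp
    ultimately show ?thesis unfolding abs_mult by linarith
  qed
  then show "AE x in M. norm (f x * g x) \<le> norm ((f x)\<^sup>2 + (g x)\<^sup>2)" by simp
qed measurable

lemma norm_diff_square_le: "(norm (a - b))\<^sup>2 \<le> 2 * (norm a)\<^sup>2 + 2 * (norm (b::'a::real_normed_vector))\<^sup>2"
proof -
  have "(norm (a - b))\<^sup>2 \<le> (norm a + norm b)\<^sup>2" by (intro power_mono norm_triangle_ineq4) simp
  also have "\<dots> \<le> 2 * (norm a)\<^sup>2 + 2 * (norm b)\<^sup>2"
    using square_diff_le[of "norm a" "- norm b"] by simp
  finally show ?thesis .
qed

lemma L2_on_diff:
  assumes "f \<in> L2_on \<Omega>" "g \<in> L2_on \<Omega>"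
  shows "(\<lambda>x. f x - g x) \<in> L2_on \<Omega>"
    and "(\<integral>x. (norm (f x - g x))\<^sup>2 \<partial>lebesgue_on \<Omega>) \<le>
      2 * (\<integral>x. (norm (f x))\<^sup>2 \<partial>lebesgue_on \<Omega>) + 2 * (\<integral>x. (norm (g x))\<^sup>2 \<partial>lebesgue_on \<Omega>)"
proof -
  have [measurable]: "f \<in> borel_measurable (lebesgue_on \<Omega>)" "g \<in> borel_measurable (lebesgue_on \<Omega>)"
    and int: "integrable (lebesgue_on \<Omega>) (\<lambda>x. (norm (f x))\<^sup>2)" "integrable (lebesgue_on \<Omega>) (\<lambda>x. (norm (g x))\<^sup>2)"
    using assms by (auto simp: L2_on_def)
  have sum_int: "integrable (lebesgue_on \<Omega>) (\<lambda>x. 2 * (norm (f x))\<^sup>2 + 2 * (norm (g x))\<^sup>2)"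
    using int by simp
  have diff_int: "integrable (lebesgue_on \<Omega>) (\<lambda>x. (norm (f x - g x))\<^sup>2)"
    by (rule Bochner_Integration.integrable_bound[OF sum_int]) (auto simp: norm_diff_square_le)
  then show "(\<lambda>x. f x - g x) \<in> L2_on \<Omega>" by (simp add: L2_on_def)
  have "(\<integral>x. (norm (f x - g x))\<^sup>2 \<partial>lebesgue_on \<Omega>) \<le> (\<integral>x. 2 * (norm (f x))\<^sup>2 + 2 * (norm (g x))\<^sup>2 \<partial>lebesgue_on \<Omega>)"
    by (intro integral_mono diff_int sum_int norm_diff_square_le)
  then show "(\<integral>x. (norm (f x - g x))\<^sup>2 \<partial>lebesgue_on \<Omega>) \<le>
      2 * (\<integral>x. (norm (f x))\<^sup>2 \<partial>lebesgue_on \<Omega>) + 2 * (\<integral>x. (norm (g x))\<^sup>2 \<partial>lebesgue_on \<Omega>)"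
    using int by simp
qed

lemma L2_on_inner:
  fixes v :: "'a::euclidean_space \<Rightarrow> 'b::euclidean_space"
  assumes "v \<in> L2_on \<Omega>" "norm b = 1"
  shows "(\<lambda>x. v x \<bullet> b) \<in> L2_on \<Omega>"
proof -
  have [measurable]: "v \<in> borel_measurable (lebesgue_on \<Omega>)" and int: "integrable (lebesgue_on \<Omega>) (\<lambda>x. (norm (v x))\<^sup>2)"
    using assms by (auto simp: L2_on_def)
  have "integrable (lebesgue_on \<Omega>) (\<lambda>x. (norm (v x \<bullet> b))\<^sup>2)"
  proof (rule Bochner_Integration.integrable_bound[OF int])
    have "(norm (v x \<bullet> b))\<^sup>2 \<le> (norm (v x))\<^sup>2" for x
      using Cauchy_Schwarz_ineq2[of "v x" b] assms(2) by (intro power_mono) auto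
    then show "AE x in lebesgue_on \<Omega>. norm ((norm (v x \<bullet> b))\<^sup>2) \<le> norm ((norm (v x))\<^sup>2)" by simp
  qed measurable
  then show ?thesis by (simp add: L2_on_def)
qed

lemma L2_on_mult_integrable:
  fixes f g :: "'a::euclidean_space \<Rightarrow> real"
  assumes "f \<in> L2_on \<Omega>" "g \<in> L2_on \<Omega>"
  shows "integrable (lebesgue_on \<Omega>) (\<lambda>x. f x * g x)"
  using assms by (intro integrable_mult_L2) (auto simp: L2_on_def)

lemma test_function_L2_on:
  assumes "open \<Omega>" "\<phi> \<in> test_functions \<Omega>"
  shows "\<phi> \<in> L2_on \<Omega>"
  using test_function_lebesgue_on(1)[OF assms] test_function_lebesgue_on(2)[OF assms(1) test_function_mult[OF assms(2,2)]]
  by (simp add: L2_on_def power2_eq_square)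

lemma grad_borel:
  assumes "\<phi> \<in> test_functions \<Omega>"
  shows "grad \<phi> \<in> borel_measurable borel"
  unfolding grad_def
  by (intro borel_measurable_sum borel_measurable_scaleR test_function_borel[of _ \<Omega>] test_function_deriv assms) simp

lemma grad_L2_on:
  assumes "open \<Omega>" "\<phi> \<in> test_functions \<Omega>"
  shows "grad \<phi> \<in> L2_on \<Omega>"
proof -
  have out: "(norm (grad \<phi> x))\<^sup>2 = 0" if "x \<notin> \<Omega>" for x
    using test_function_outside[OF test_function_deriv[OF assms(2)] that] by (simp add: norm_grad_square)
  have "integrable (lebesgue_on \<Omega>) (\<lambda>x. (norm (grad \<phi> x))\<^sup>2)"
    using lebesgue_on_borel(2)[OF assms(1) grad_norm_test(1)[OF assms(2)] out] grad_norm_test(2)[OF assms(2)] by simp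
  then show ?thesis using borel_lebesgue_on[OF grad_borel[OF assms(2)]] by (simp add: L2_on_def)
qed

lemma has_weak_gradient_test:
  assumes "open \<Omega>" "\<phi> \<in> test_functions \<Omega>"
  shows "has_weak_gradient \<Omega> \<phi> (grad \<phi>)"
  unfolding has_weak_gradient_def
proof (intro ballI)
  fix \<psi> and b :: 'a assume \<psi>: "\<psi> \<in> test_functions \<Omega>" and b: "b \<in> Basis"
  have "(\<integral>x. \<phi> x * frechet_derivative \<psi> (at x) b \<partial>lebesgue_on \<Omega>) = (\<integral>x. \<phi> x * frechet_derivative \<psi> (at x) b \<partial>lborel)"
    by (intro test_function_lebesgue_on(3) assms test_function_mult test_function_deriv \<psi>)
  also have "\<dots> = - (\<integral>x. frechet_derivative \<phi> (at x) b * \<psi> x \<partial>lborel)"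
    by (rule integral_by_parts[OF assms(2) \<psi>])
  also have "(\<integral>x. frechet_derivative \<phi> (at x) b * \<psi> x \<partial>lborel) = (\<integral>x. frechet_derivative \<phi> (at x) b * \<psi> x \<partial>lebesgue_on \<Omega>)"
    by (intro test_function_lebesgue_on(3)[symmetric] assms test_function_mult test_function_deriv \<psi>)
  finally show "(\<integral>x. \<phi> x * frechet_derivative \<psi> (at x) b \<partial>lebesgue_on \<Omega>) = - (\<integral>x. (grad \<phi> x \<bullet> b) * \<psi> x \<partial>lebesgue_on \<Omega>)"
    by (simp add: grad_inner_Basis[OF b])
qed

lemma has_weak_gradient_diff:
  assumes \<Omega>: "open \<Omega>" and u: "u \<in> L2_on \<Omega>" "u' \<in> L2_on \<Omega>" and v: "v \<in> L2_on \<Omega>" "v' \<in> L2_on \<Omega>"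
    and "has_weak_gradient \<Omega> u v" "has_weak_gradient \<Omega> u' v'"
  shows "has_weak_gradient \<Omega> (\<lambda>x. u x - u' x) (\<lambda>x. v x - v' x)"
  unfolding has_weak_gradient_def
proof (intro ballI)
  fix \<psi> and b :: 'a assume \<psi>: "\<psi> \<in> test_functions \<Omega>" and b: "b \<in> Basis"
  let ?D = "\<lambda>x. frechet_derivative \<psi> (at x) b"
  have D: "?D \<in> L2_on \<Omega>" by (intro test_function_L2_on test_function_deriv \<Omega> \<psi>)
  have p: "\<psi> \<in> L2_on \<Omega>" by (intro test_function_L2_on \<Omega> \<psi>)
  have 1: "integrable (lebesgue_on \<Omega>) (\<lambda>x. u x * ?D x)" "integrable (lebesgue_on \<Omega>) (\<lambda>x. u' x * ?D x)"
    by (intro L2_on_mult_integrable u D)+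
  have 2: "integrable (lebesgue_on \<Omega>) (\<lambda>x. (v x \<bullet> b) * \<psi> x)" "integrable (lebesgue_on \<Omega>) (\<lambda>x. (v' x \<bullet> b) * \<psi> x)"
    using b by (auto intro!: L2_on_mult_integrable L2_on_inner v p)
  have 3: "(\<integral>x. u x * ?D x \<partial>lebesgue_on \<Omega>) = - (\<integral>x. (v x \<bullet> b) * \<psi> x \<partial>lebesgue_on \<Omega>)"
    "(\<integral>x. u' x * ?D x \<partial>lebesgue_on \<Omega>) = - (\<integral>x. (v' x \<bullet> b) * \<psi> x \<partial>lebesgue_on \<Omega>)"
    using assms(6,7) \<psi> b by (auto simp: has_weak_gradient_def)
  show "(\<integral>x. (u x - u' x) * ?D x \<partial>lebesgue_on \<Omega>) = - (\<integral>x. ((v x - v' x) \<bullet> b) * \<psi> x \<partial>lebesgue_on \<Omega>)"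
    using 1 2 3 by (simp add: left_diff_distrib inner_diff_left)
qed

text \<open>Testing the weak gradient \<open>d\<close> of \<open>\<phi>\<close> against the derivatives of \<open>\<phi>\<close> itself.\<close>

lemma grad_le_weak_gradient:
  assumes \<Omega>: "open \<Omega>" and \<phi>: "\<phi> \<in> test_functions \<Omega>" and d: "d \<in> L2_on \<Omega>" "has_weak_gradient \<Omega> \<phi> d"
  shows "(\<integral>x. (norm (grad \<phi> x))\<^sup>2 \<partial>lborel) \<le> (\<integral>x. (norm (d x))\<^sup>2 \<partial>lebesgue_on \<Omega>)"
proof -
  let ?M = "lebesgue_on \<Omega>"
  let ?D = "\<lambda>b x. frechet_derivative \<phi> (at x) b"
  have g: "grad \<phi> \<in> L2_on \<Omega>" by (rule grad_L2_on[OF \<Omega> \<phi>])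
  have DT: "?D b \<in> test_functions \<Omega>" for b by (rule test_function_deriv[OF \<phi>])
  have D: "?D b \<in> L2_on \<Omega>" for b by (rule test_function_L2_on[OF \<Omega> DT])
  have eq: "(\<integral>x. (d x \<bullet> b) * ?D b x \<partial>?M) = (\<integral>x. (?D b x)\<^sup>2 \<partial>?M)" if b: "b \<in> Basis" for b
  proof -
    have "- (\<integral>x. (d x \<bullet> b) * ?D b x \<partial>?M) = (\<integral>x. \<phi> x * frechet_derivative (?D b) (at x) b \<partial>?M)"
      using d(2) DT b by (simp add: has_weak_gradient_def)
    also have "\<dots> = - (\<integral>x. (grad \<phi> x \<bullet> b) * ?D b x \<partial>?M)"
      using has_weak_gradient_test[OF \<Omega> \<phi>] DT b by (simp add: has_weak_gradient_def)
    finally show ?thesis by (simp add: grad_inner_Basis[OF b] power2_eq_square)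
  qed
  have int1: "integrable ?M (\<lambda>x. (d x \<bullet> b) * ?D b x)" if "b \<in> Basis" for b
    using that by (intro L2_on_mult_integrable L2_on_inner d D) auto
  have int2: "integrable ?M (\<lambda>x. (?D b x)\<^sup>2)" for b
    using D by (simp add: L2_on_def)
  have int_d: "integrable ?M (\<lambda>x. (norm (d x))\<^sup>2)" using d(1) by (simp add: L2_on_def)
  have int_g: "integrable ?M (\<lambda>x. (norm (grad \<phi> x))\<^sup>2)" using g by (simp add: L2_on_def)
  have dg: "d x \<bullet> grad \<phi> x = (\<Sum>b\<in>Basis. (d x \<bullet> b) * ?D b x)" for x
    using euclidean_inner[of "d x" "grad \<phi> x"] by (simp add: grad_inner_Basis)
  have "(\<integral>x. (norm (grad \<phi> x))\<^sup>2 \<partial>?M) = (\<Sum>b\<in>Basis. \<integral>x. (?D b x)\<^sup>2 \<partial>?M)"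
    unfolding norm_grad_square by (rule Bochner_Integration.integral_sum) (rule int2)
  also have "\<dots> = (\<Sum>b\<in>Basis. \<integral>x. (d x \<bullet> b) * ?D b x \<partial>?M)" by (intro sum.cong refl eq[symmetric])
  also have "\<dots> = (\<integral>x. d x \<bullet> grad \<phi> x \<partial>?M)"
    unfolding dg by (rule Bochner_Integration.integral_sum[symmetric]) (rule int1)
  \<comment> \<open>The gradient term on the right carries the factor one half and is absorbed into
    the left-hand side.\<close>
  also have "\<dots> \<le> (\<integral>x. ((norm (d x))\<^sup>2 + (norm (grad \<phi> x))\<^sup>2) / 2 \<partial>?M)"
  proof (rule integral_mono)
    show "integrable ?M (\<lambda>x. d x \<bullet> grad \<phi> x)"
      unfolding dg by (intro Bochner_Integration.integrable_sum int1)
    show "integrable ?M (\<lambda>x. ((norm (d x))\<^sup>2 + (norm (grad \<phi> x))\<^sup>2) / 2)" using int_d int_g by simp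
    fix x
    have "d x \<bullet> grad \<phi> x \<le> norm (d x) * norm (grad \<phi> x)" by (rule norm_cauchy_schwarz)
    also have "\<dots> \<le> ((norm (d x))\<^sup>2 + (norm (grad \<phi> x))\<^sup>2) / 2"
      using sum_squares_bound[of "norm (d x)" "norm (grad \<phi> x)"] by simp
    finally show "d x \<bullet> grad \<phi> x \<le> ((norm (d x))\<^sup>2 + (norm (grad \<phi> x))\<^sup>2) / 2" .
  qed
  also have "\<dots> = ((\<integral>x. (norm (d x))\<^sup>2 \<partial>?M) + (\<integral>x. (norm (grad \<phi> x))\<^sup>2 \<partial>?M)) / 2"
    using int_d int_g by simp
  finally have "(\<integral>x. (norm (grad \<phi> x))\<^sup>2 \<partial>?M) \<le> (\<integral>x. (norm (d x))\<^sup>2 \<partial>?M)" by simp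
  moreover have "(\<integral>x. (norm (grad \<phi> x))\<^sup>2 \<partial>?M) = (\<integral>x. (norm (grad \<phi> x))\<^sup>2 \<partial>lborel)"
  proof (rule lebesgue_on_borel(1)[OF \<Omega> grad_norm_test(1)[OF \<phi>]])
    show "(norm (grad \<phi> x))\<^sup>2 = 0" if "x \<notin> \<Omega>" for x
      using test_function_outside[OF DT that] by (simp add: norm_grad_square)
  qed
  ultimately show ?thesis by simp
qed

text \<open>The increment is the integral of the directional derivative over the unit interval.
  Cauchy-Schwarz there, Fubini, and translation invariance for each \<open>t\<close> reduce
  everything to one integral of the gradient.\<close>

lemma test_function_shift:
  fixes \<phi> :: "'a::euclidean_space \<Rightarrow> real"
  assumes \<phi>: "\<phi> \<in> test_functions \<Omega>"
  shows "(\<integral>\<^sup>+x. ennreal ((\<phi> (x + z) - \<phi> x)\<^sup>2) \<partial>lborel) \<le> ennreal ((norm z)\<^sup>2 * (\<integral>x. (norm (grad \<phi> x))\<^sup>2 \<partial>lborel))"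
proof -
  note [measurable] = test_function_borel[OF \<phi>]
  define D where "D x = frechet_derivative \<phi> (at x) z" for x
  have D: "D \<in> test_functions \<Omega>" unfolding D_def by (rule test_function_deriv[OF \<phi>])
  note [measurable] = test_function_borel[OF D]
  have pw: "ennreal ((\<phi> (x + z) - \<phi> x)\<^sup>2) \<le> (\<integral>\<^sup>+t. ennreal ((D (x + t *\<^sub>R z))\<^sup>2) * indicator {0..1::real} t \<partial>lborel)" (is "_ \<le> ?T") for x
  proof (cases ?T rule: ennreal_cases)
    case (real b)
    have cont: "isCont (\<lambda>t. D (x + t *\<^sub>R z)) t" for t
    proof -
      have "continuous_on UNIV (\<lambda>t. D (x + t *\<^sub>R z))"
        by (rule continuous_on_compose2[OF test_function_continuous[OF D, of UNIV]]) (auto intro!: continuous_intros)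
      then show ?thesis by (simp add: continuous_on_eq_continuous_at)
    qed
    have "(\<integral>t. D (x + t *\<^sub>R z) * indicator {0..1} t \<partial>lborel) = \<phi> (x + 1 *\<^sub>R z) - \<phi> (x + 0 *\<^sub>R z)"
      by (rule integral_FTC_Icc_real[where F = "\<lambda>t. \<phi> (x + t *\<^sub>R z)"])
        (use cont line_has_derivative[OF \<phi>] in \<open>auto simp: D_def\<close>)
    then have eq: "(\<integral>t. indicator {0..1} t * D (x + t *\<^sub>R z) \<partial>lborel) = \<phi> (x + z) - \<phi> x"
      by (simp add: mult.commute)
    have "(\<integral>t. indicator {0..1} t * D (x + t *\<^sub>R z) \<partial>lborel)\<^sup>2 \<le> 1 * b"
      by (rule integral_square_le(2)) (use real in auto)
    then show ?thesis unfolding eq real(2) by (intro ennreal_leI) simp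
  qed simp
  have D_le: "(D y)\<^sup>2 \<le> (norm z)\<^sup>2 * (norm (grad \<phi> y))\<^sup>2" for y
  proof -
    have "\<bar>D y\<bar> \<le> norm (grad \<phi> y) * norm z"
      unfolding D_def frechet_eq_grad[OF \<phi>] by (rule Cauchy_Schwarz_ineq2)
    then have "\<bar>D y\<bar>\<^sup>2 \<le> (norm (grad \<phi> y) * norm z)\<^sup>2" by (intro power_mono) auto
    then show ?thesis by (simp add: power_mult_distrib mult.commute)
  qed
  have int_g: "integrable lborel (\<lambda>x. (norm z)\<^sup>2 * (norm (grad \<phi> x))\<^sup>2)" using grad_norm_test(2)[OF \<phi>] by simp
  have D_int: "(\<integral>\<^sup>+y. ennreal ((D y)\<^sup>2) \<partial>lborel) \<le> ennreal ((norm z)\<^sup>2 * (\<integral>x. (norm (grad \<phi> x))\<^sup>2 \<partial>lborel))"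
  proof -
    have "(\<integral>\<^sup>+y. ennreal ((D y)\<^sup>2) \<partial>lborel) \<le> (\<integral>\<^sup>+y. ennreal ((norm z)\<^sup>2 * (norm (grad \<phi> y))\<^sup>2) \<partial>lborel)"
      by (intro nn_integral_mono ennreal_leI D_le)
    also have "\<dots> = ennreal (\<integral>x. (norm z)\<^sup>2 * (norm (grad \<phi> x))\<^sup>2 \<partial>lborel)"
      by (rule nn_integral_eq_integral[OF int_g]) simp
    finally show ?thesis by simp
  qed
  have "(\<integral>\<^sup>+x. ennreal ((\<phi> (x + z) - \<phi> x)\<^sup>2) \<partial>lborel) \<le> (\<integral>\<^sup>+x. \<integral>\<^sup>+t. ennreal ((D (x + t *\<^sub>R z))\<^sup>2) * indicator {0..1::real} t \<partial>lborel \<partial>lborel)"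
    by (intro nn_integral_mono pw)
  also have "\<dots> = (\<integral>\<^sup>+t. \<integral>\<^sup>+x. ennreal ((D (x + t *\<^sub>R z))\<^sup>2) * indicator {0..1::real} t \<partial>lborel \<partial>lborel)"
    by (rule lborel_pair.Fubini'[symmetric]) measurable
  also have "\<dots> = (\<integral>\<^sup>+t. (\<integral>\<^sup>+y. ennreal ((D y)\<^sup>2) \<partial>lborel) * indicator {0..1::real} t \<partial>lborel)"
  proof (intro nn_integral_cong)
    fix t :: real
    have "(\<integral>\<^sup>+x. ennreal ((D (x + t *\<^sub>R z))\<^sup>2) * indicator {0..1::real} t \<partial>lborel) = (\<integral>\<^sup>+x. ennreal ((D (x + t *\<^sub>R z))\<^sup>2) \<partial>lborel) * indicator {0..1::real} t"
      by (rule nn_integral_multc) measurable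
    also have "(\<integral>\<^sup>+x. ennreal ((D (x + t *\<^sub>R z))\<^sup>2) \<partial>lborel) = (\<integral>\<^sup>+x. ennreal ((D (t *\<^sub>R z + x))\<^sup>2) \<partial>lborel)"
      by (simp add: add.commute)
    also have "\<dots> = (\<integral>\<^sup>+y. ennreal ((D y)\<^sup>2) \<partial>lborel)" by (rule nn_integral_translate) measurable
    finally show "(\<integral>\<^sup>+x. ennreal ((D (x + t *\<^sub>R z))\<^sup>2) * indicator {0..1::real} t \<partial>lborel) = (\<integral>\<^sup>+y. ennreal ((D y)\<^sup>2) \<partial>lborel) * indicator {0..1::real} t" .
  qed
  also have "\<dots> = (\<integral>\<^sup>+y. ennreal ((D y)\<^sup>2) \<partial>lborel)"
    by (simp add: nn_integral_cmult_indicator)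
  finally show ?thesis using D_int by (rule order_trans)
qed

section \<open>Translation estimate and uniqueness of weak gradients\<close>

lemma H1_weak_gradient:
  assumes "u \<in> H1 \<Omega>"
  shows "weak_gradient \<Omega> u \<in> L2_on \<Omega>" "has_weak_gradient \<Omega> u (weak_gradient \<Omega> u)"
proof -
  have "\<exists>v. v \<in> L2_on \<Omega> \<and> has_weak_gradient \<Omega> u v" using assms by (auto simp: H1_def)
  from someI_ex[OF this] show "weak_gradient \<Omega> u \<in> L2_on \<Omega>" "has_weak_gradient \<Omega> u (weak_gradient \<Omega> u)"
    unfolding weak_gradient_def by auto
qed

lemma H1_norm_nonneg: "0 \<le> H1_norm \<Omega> u"
  by (simp add: H1_norm_def integral_nonneg_AE)

lemma H1_norm_ge:
  shows "(\<integral>x. (u x)\<^sup>2 \<partial>lebesgue_on \<Omega>) \<le> (H1_norm \<Omega> u)\<^sup>2"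
    and "(\<integral>x. (norm (weak_gradient \<Omega> u x))\<^sup>2 \<partial>lebesgue_on \<Omega>) \<le> (H1_norm \<Omega> u)\<^sup>2"
proof -
  have "0 \<le> (\<integral>x. (u x)\<^sup>2 \<partial>lebesgue_on \<Omega>)" "0 \<le> (\<integral>x. (norm (weak_gradient \<Omega> u x))\<^sup>2 \<partial>lebesgue_on \<Omega>)"
    by (auto intro: integral_nonneg_AE)
  then show "(\<integral>x. (u x)\<^sup>2 \<partial>lebesgue_on \<Omega>) \<le> (H1_norm \<Omega> u)\<^sup>2"
    "(\<integral>x. (norm (weak_gradient \<Omega> u x))\<^sup>2 \<partial>lebesgue_on \<Omega>) \<le> (H1_norm \<Omega> u)\<^sup>2"
    unfolding H1_norm_def by auto
qed

lemma H1_L2_on: "u \<in> H1 \<Omega> \<Longrightarrow> u \<in> L2_on \<Omega>"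
  by (simp add: H1_def)

lemma H1_diff_test:
  assumes "open \<Omega>" "u \<in> H1 \<Omega>" "\<phi> \<in> test_functions \<Omega>"
  shows "(\<lambda>x. u x - \<phi> x) \<in> H1 \<Omega>"
proof -
  note p = test_function_L2_on[OF assms(1,3)] grad_L2_on[OF assms(1,3)] has_weak_gradient_test[OF assms(1,3)]
  note u = H1_L2_on[OF assms(2)] H1_weak_gradient[OF assms(2)]
  have "(\<lambda>x. u x - \<phi> x) \<in> L2_on \<Omega>" by (rule L2_on_diff(1)[OF u(1) p(1)])
  moreover have "(\<lambda>x. weak_gradient \<Omega> u x - grad \<phi> x) \<in> L2_on \<Omega>" by (rule L2_on_diff(1)[OF u(2) p(2)])
  moreover have "has_weak_gradient \<Omega> (\<lambda>x. u x - \<phi> x) (\<lambda>x. weak_gradient \<Omega> u x - grad \<phi> x)"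
    by (rule has_weak_gradient_diff[OF assms(1) u(1) p(1) u(2) p(2) u(3) p(3)])
  ultimately show ?thesis unfolding H1_def by blast
qed

text \<open>Translations leave the domain, hence the extension by zero; Borel measurability gives
  the joint measurability in point and displacement that Fubini needs.\<close>

lemma ex_borel_representative:
  fixes g :: "'a::euclidean_space \<Rightarrow> real"
  assumes "open \<Omega>" "g \<in> borel_measurable (lebesgue_on \<Omega>)"
  shows "\<exists>f\<in>borel_measurable borel. (\<forall>x. x \<notin> \<Omega> \<longrightarrow> f x = 0) \<and> (AE x in lborel. f x = indicator \<Omega> x * g x)"
proof -
  have "\<Omega> \<inter> space lebesgue \<in> sets lebesgue" using assms(1) by auto
  from borel_measurable_restrict_space_iff[OF this, of g]
  have "(\<lambda>x. indicator \<Omega> x *\<^sub>R g x) \<in> borel_measurable lebesgue" using assms(2) by simp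
  from completion_ex_borel_measurable_real[OF this] obtain g' where
    g': "g' \<in> borel_measurable lborel" "AE x in lborel. indicator \<Omega> x *\<^sub>R g x = g' x" by blast
  have [measurable]: "g' \<in> borel_measurable borel" "\<Omega> \<in> sets borel" using g'(1) assms(1) by auto
  show ?thesis
  proof (intro bexI[of _ "\<lambda>x. indicator \<Omega> x * g' x"] conjI)
    show "AE x in lborel. indicator \<Omega> x * g' x = indicator \<Omega> x * g x"
      using g'(2) by eventually_elim (auto simp: indicator_def split: if_splits)
  qed auto
qed

lemma nn_integral_borel_representative:
  fixes g :: "'a::euclidean_space \<Rightarrow> real"
  assumes "open \<Omega>" "AE x in lborel. f x = indicator \<Omega> x * g x" "H 0 = 0"
  shows "(\<integral>\<^sup>+x. ennreal (H (f x)) \<partial>lborel) = (\<integral>\<^sup>+x. ennreal (H (g x)) \<partial>lebesgue_on \<Omega>)"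
proof -
  have S: "\<Omega> \<inter> space lebesgue \<in> sets lebesgue" using assms(1) by auto
  have "(\<integral>\<^sup>+x. ennreal (H (g x)) \<partial>lebesgue_on \<Omega>) = (\<integral>\<^sup>+x. ennreal (H (g x)) * indicator \<Omega> x \<partial>lborel)"
    by (simp add: nn_integral_restrict_space[OF S] nn_integral_completion)
  also have "\<dots> = (\<integral>\<^sup>+x. ennreal (H (f x)) \<partial>lborel)"
    by (rule nn_integral_cong_AE, use assms(2) in eventually_elim) (use assms(3) in \<open>auto simp: indicator_def\<close>)
  finally show ?thesis by simp
qed

lemma L2_borel_representative:
  fixes g :: "'a::euclidean_space \<Rightarrow> real"
  assumes "open \<Omega>" "g \<in> L2_on \<Omega>" "AE x in lborel. f x = indicator \<Omega> x * g x"
  shows "(\<integral>\<^sup>+x. ennreal ((f x)\<^sup>2) \<partial>lborel) = ennreal (\<integral>x. (g x)\<^sup>2 \<partial>lebesgue_on \<Omega>)"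
proof -
  have "integrable (lebesgue_on \<Omega>) (\<lambda>x. (g x)\<^sup>2)" using assms(2) by (simp add: L2_on_def)
  then have "(\<integral>\<^sup>+x. ennreal ((g x)\<^sup>2) \<partial>lebesgue_on \<Omega>) = ennreal (\<integral>x. (g x)\<^sup>2 \<partial>lebesgue_on \<Omega>)"
    by (rule nn_integral_eq_integral) simp
  then show ?thesis using nn_integral_borel_representative[OF assms(1,3), of "\<lambda>t. t\<^sup>2"] by simp
qed

text \<open>The estimate for test functions passes to the limit, the error terms being translates of
  \<open>u - \<phi> n\<close>. The constant \<open>4\<close> comes from splitting squares of sums
  twice.\<close>

lemma H10_shift:
  fixes u :: "'a::euclidean_space \<Rightarrow> real"
  assumes \<Omega>: "open \<Omega>" and u: "u \<in> H10 \<Omega>" and f[measurable]: "f \<in> borel_measurable borel"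
    and f_eq: "AE x in lborel. f x = indicator \<Omega> x * u x"
  shows "(\<integral>\<^sup>+x. ennreal ((f (x + z) - f x)\<^sup>2) \<partial>lborel) \<le> ennreal (4 * (norm z)\<^sup>2 * (H1_norm \<Omega> u)\<^sup>2)"
proof -
  have uH: "u \<in> H1 \<Omega>" using u by (simp add: H10_def)
  obtain \<phi> where \<phi>: "\<And>n::nat. \<phi> n \<in> test_functions \<Omega>" "(\<lambda>n. H1_norm \<Omega> (\<lambda>x. u x - \<phi> n x)) \<longlonglongrightarrow> 0"
    using u by (auto simp: H10_def)
  define h where "h n = H1_norm \<Omega> (\<lambda>x. u x - \<phi> n x)" for n
  define S where "S = H1_norm \<Omega> u"
  define a where "a n = 2 * ((norm z)\<^sup>2 * (2 * S\<^sup>2 + 2 * (h n)\<^sup>2)) + 4 * (h n)\<^sup>2 + 4 * (h n)\<^sup>2" for n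
  have le: "(\<integral>\<^sup>+x. ennreal ((f (x + z) - f x)\<^sup>2) \<partial>lborel) \<le> ennreal (a n)" for n
  proof -
    note [measurable] = test_function_borel[OF \<phi>(1)[of n]]
    have d: "(\<lambda>x. u x - \<phi> n x) \<in> H1 \<Omega>" by (rule H1_diff_test[OF \<Omega> uH \<phi>(1)])
    \<comment> \<open>\<open>weak_gradient\<close> is a choice and not known to be additive. But the
      difference of the chosen gradients of \<open>u\<close> and \<open>u - \<phi> n\<close> is a
      weak gradient of \<open>\<phi> n\<close>, and \<open>grad_le_weak_gradient\<close> compares it
      with the classical one.\<close>
    have G: "(\<integral>x. (norm (grad (\<phi> n) x))\<^sup>2 \<partial>lborel) \<le> 2 * S\<^sup>2 + 2 * (h n)\<^sup>2"
    proof -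
      let ?v = "weak_gradient \<Omega> u" and ?w = "weak_gradient \<Omega> (\<lambda>x. u x - \<phi> n x)"
      note v = H1_weak_gradient[OF uH] and w = H1_weak_gradient[OF d]
      have "has_weak_gradient \<Omega> (\<lambda>x. u x - (u x - \<phi> n x)) (\<lambda>x. ?v x - ?w x)"
        by (rule has_weak_gradient_diff[OF \<Omega> H1_L2_on[OF uH] H1_L2_on[OF d] v(1) w(1) v(2) w(2)])
      then have "has_weak_gradient \<Omega> (\<phi> n) (\<lambda>x. ?v x - ?w x)" by simp
      then have "(\<integral>x. (norm (grad (\<phi> n) x))\<^sup>2 \<partial>lborel) \<le> (\<integral>x. (norm (?v x - ?w x))\<^sup>2 \<partial>lebesgue_on \<Omega>)"
        by (intro grad_le_weak_gradient \<Omega> \<phi>(1) L2_on_diff(1) v(1) w(1))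
      also have "\<dots> \<le> 2 * (\<integral>x. (norm (?v x))\<^sup>2 \<partial>lebesgue_on \<Omega>) + 2 * (\<integral>x. (norm (?w x))\<^sup>2 \<partial>lebesgue_on \<Omega>)"
        by (rule L2_on_diff(2)[OF v(1) w(1)])
      also have "\<dots> \<le> 2 * S\<^sup>2 + 2 * (h n)\<^sup>2"
        unfolding S_def h_def by (intro add_mono mult_left_mono H1_norm_ge(2)) auto
      finally show ?thesis .
    qed
    define r where "r x = f x - \<phi> n x" for x
    have [measurable]: "r \<in> borel_measurable borel" unfolding r_def by measurable
    have r: "(\<integral>\<^sup>+x. ennreal ((r x)\<^sup>2) \<partial>lborel) \<le> ennreal ((h n)\<^sup>2)"
    proof -
      have "AE x in lborel. r x = indicator \<Omega> x * (u x - \<phi> n x)"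
        using f_eq by eventually_elim (auto simp: r_def indicator_def test_function_outside[OF \<phi>(1)])
      from L2_borel_representative[OF \<Omega> H1_L2_on[OF d] this]
      show ?thesis unfolding h_def using H1_norm_ge(1)[where u = "\<lambda>x. u x - \<phi> n x"] by (simp add: ennreal_leI)
    qed
    have r': "(\<integral>\<^sup>+x. ennreal ((r (x + z))\<^sup>2) \<partial>lborel) \<le> ennreal ((h n)\<^sup>2)"
    proof -
      have "(\<integral>\<^sup>+x. ennreal ((r (z + x))\<^sup>2) \<partial>lborel) = (\<integral>\<^sup>+x. ennreal ((r x)\<^sup>2) \<partial>lborel)"
        by (rule nn_integral_translate) measurable
      then show ?thesis using r by (simp add: add.commute)
    qed
    have p: "(\<integral>\<^sup>+x. ennreal ((\<phi> n (x + z) - \<phi> n x)\<^sup>2) \<partial>lborel) \<le> ennreal ((norm z)\<^sup>2 * (2 * S\<^sup>2 + 2 * (h n)\<^sup>2))"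
      by (rule order_trans[OF test_function_shift[OF \<phi>(1)]]) (intro ennreal_leI mult_left_mono G, simp)
    have "(\<integral>\<^sup>+x. ennreal ((f (x + z) - f x)\<^sup>2) \<partial>lborel) \<le>
       (\<integral>\<^sup>+x. (ennreal 2 * ennreal ((\<phi> n (x + z) - \<phi> n x)\<^sup>2) + ennreal 4 * ennreal ((r (x + z))\<^sup>2)) + ennreal 4 * ennreal ((r x)\<^sup>2) \<partial>lborel)"
    proof (rule nn_integral_mono)
      fix x
      have 1: "(f (x + z) - f x)\<^sup>2 \<le> 2 * (\<phi> n (x + z) - \<phi> n x)\<^sup>2 + 2 * (r x - r (x + z))\<^sup>2"
        using square_diff_le[of "\<phi> n (x + z) - \<phi> n x" "r x - r (x + z)"] by (simp add: r_def algebra_simps)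
      have 2: "(r x - r (x + z))\<^sup>2 \<le> 2 * (r x)\<^sup>2 + 2 * (r (x + z))\<^sup>2" by (rule square_diff_le)
      have "(f (x + z) - f x)\<^sup>2 \<le> (2 * (\<phi> n (x + z) - \<phi> n x)\<^sup>2 + 4 * (r (x + z))\<^sup>2) + 4 * (r x)\<^sup>2"
        using 1 2 by linarith
      then have "ennreal ((f (x + z) - f x)\<^sup>2) \<le> ennreal ((2 * (\<phi> n (x + z) - \<phi> n x)\<^sup>2 + 4 * (r (x + z))\<^sup>2) + 4 * (r x)\<^sup>2)"
        by (rule ennreal_leI)
      then show "ennreal ((f (x + z) - f x)\<^sup>2) \<le> (ennreal 2 * ennreal ((\<phi> n (x + z) - \<phi> n x)\<^sup>2) + ennreal 4 * ennreal ((r (x + z))\<^sup>2)) + ennreal 4 * ennreal ((r x)\<^sup>2)"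
        by (subst (asm) ennreal_plus, simp, simp, subst (asm) ennreal_plus, simp, simp) (simp only: ennreal_mult[OF _ zero_le_power2] zero_le_numeral)
    qed
    also have "\<dots> = (ennreal 2 * (\<integral>\<^sup>+x. ennreal ((\<phi> n (x + z) - \<phi> n x)\<^sup>2) \<partial>lborel) + ennreal 4 * (\<integral>\<^sup>+x. ennreal ((r (x + z))\<^sup>2) \<partial>lborel))
        + ennreal 4 * (\<integral>\<^sup>+x. ennreal ((r x)\<^sup>2) \<partial>lborel)"
      by (simp add: nn_integral_add nn_integral_cmult del: ennreal_numeral)
    also have "\<dots> \<le> (ennreal 2 * ennreal ((norm z)\<^sup>2 * (2 * S\<^sup>2 + 2 * (h n)\<^sup>2)) + ennreal 4 * ennreal ((h n)\<^sup>2)) + ennreal 4 * ennreal ((h n)\<^sup>2)"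
      by (intro add_mono mult_left_mono p r r') auto
    also have "\<dots> = (ennreal (2 * ((norm z)\<^sup>2 * (2 * S\<^sup>2 + 2 * (h n)\<^sup>2))) + ennreal (4 * (h n)\<^sup>2)) + ennreal (4 * (h n)\<^sup>2)"
      by (subst (1 2 3) ennreal_mult[symmetric]) auto
    also have "\<dots> = ennreal (a n)"
    proof -
      have "0 \<le> 2 * ((norm z)\<^sup>2 * (2 * S\<^sup>2 + 2 * (h n)\<^sup>2))" "0 \<le> 4 * (h n)\<^sup>2" by auto
      then show ?thesis by (simp only: a_def ennreal_plus add_nonneg_nonneg)
    qed
    finally show ?thesis .
  qed
  have "h \<longlonglongrightarrow> 0" using \<phi>(2) by (simp add: h_def[abs_def])
  then have "a \<longlonglongrightarrow> 2 * ((norm z)\<^sup>2 * (2 * S\<^sup>2 + 2 * 0\<^sup>2)) + 4 * 0\<^sup>2 + 4 * 0\<^sup>2"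
    unfolding a_def by (intro tendsto_intros)
  then have "a \<longlonglongrightarrow> 4 * (norm z)\<^sup>2 * S\<^sup>2" by (simp add: mult.assoc)
  then have lim: "(\<lambda>n. ennreal (a n)) \<longlonglongrightarrow> ennreal (4 * (norm z)\<^sup>2 * S\<^sup>2)" by (rule tendsto_ennrealI)
  have "\<forall>\<^sub>F n in sequentially. (\<integral>\<^sup>+x. ennreal ((f (x + z) - f x)\<^sup>2) \<partial>lborel) \<le> ennreal (a n)"
    by (intro always_eventually allI le)
  then show ?thesis unfolding S_def[symmetric]
    by (rule tendsto_lowerbound[OF lim _ sequentially_bot])
qed

lemma one_L2_on:
  assumes "open \<Omega>" "bounded (\<Omega> :: 'a::euclidean_space set)"
  shows "(\<lambda>_. 1 :: real) \<in> L2_on \<Omega>"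
proof -
  have "integrable lborel (indicator \<Omega> :: 'a \<Rightarrow> real)"
    using emeasure_bounded_finite[OF assms(2)] assms(1) by (intro integrable_real_indicator) auto
  then have "integrable (lebesgue_on \<Omega>) (indicator \<Omega> :: 'a \<Rightarrow> real)"
    using lebesgue_on_borel(2)[OF assms(1), of "indicator \<Omega>"] assms(1) by auto
  then have "integrable (lebesgue_on \<Omega>) (\<lambda>_. 1 :: real)"
    by (subst (asm) Bochner_Integration.integrable_cong[OF refl, of _ _ "\<lambda>_. 1"]) auto
  then show ?thesis by (simp add: L2_on_def)
qed

text \<open>Bump functions show that \<open>f\<close> has integral zero over every closed box in the
  domain; Lebesgue's differentiation theorem along shrinking cubes recovers \<open>f\<close> almost
  everywhere.\<close>

lemma fundamental_lemma:
  fixes f :: "'a::euclidean_space \<Rightarrow> real"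
  assumes \<Omega>: "open \<Omega>" "bounded \<Omega>" and f: "f \<in> L2_on \<Omega>"
    and zero: "\<And>\<psi>. \<psi> \<in> test_functions \<Omega> \<Longrightarrow> (\<integral>x. f x * \<psi> x \<partial>lebesgue_on \<Omega>) = 0"
  shows "AE x in lebesgue_on \<Omega>. f x = 0"
proof -
  have S: "\<Omega> \<inter> space lebesgue \<in> sets lebesgue" using \<Omega> by auto
  define g where "g x = indicator \<Omega> x * f x" for x
  have "integrable (lebesgue_on \<Omega>) f"
    using L2_on_mult_integrable[OF f one_L2_on[OF \<Omega>]] by simp
  then have g_int: "integrable lebesgue g"
    using integrable_restrict_space[OF S, of f] by (simp add: g_def[abs_def])
  have g_set: "set_integrable lebesgue T g" if "T \<in> sets lebesgue" for T
    unfolding set_integrable_def by (rule integrable_mult_indicator[OF that g_int])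
  have box0: "integral (cbox a c) g = 0" if sub: "cbox a c \<subseteq> \<Omega>" for a c
  proof -
    have "(\<lambda>n. \<integral>x. box_bump n a c x * g x \<partial>lebesgue) \<longlonglongrightarrow> (\<integral>x. indicator (box a c) x * g x \<partial>lebesgue)"
    proof (rule integral_dominated_convergence[where w = "\<lambda>x. \<bar>g x\<bar>"])
      show "(\<lambda>x. indicator (box a c) x * g x) \<in> borel_measurable lebesgue"
        using borel_measurable_integrable[OF g_int] by (intro borel_measurable_times borel_measurable_indicator) auto
      show "(\<lambda>x. box_bump n a c x * g x) \<in> borel_measurable lebesgue" for n
      proof (intro borel_measurable_times borel_measurable_integrable[OF g_int])
        have "box_bump n a c \<in> borel_measurable borel"
          by (rule test_function_borel[OF box_bump_test_function[OF sub]])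
        then show "box_bump n a c \<in> borel_measurable lebesgue" by (intro measurable_completion) simp
      qed
      show "integrable lebesgue (\<lambda>x. \<bar>g x\<bar>)" using g_int by simp
      show "AE x in lebesgue. (\<lambda>n. box_bump n a c x * g x) \<longlonglongrightarrow> indicator (box a c) x * g x"
        by (intro AE_I2 tendsto_mult box_bump_tendsto tendsto_const)
      show "AE x in lebesgue. norm (box_bump n a c x * g x) \<le> \<bar>g x\<bar>" for n
        using box_bump_bounds[of n a c] by (intro AE_I2) (simp add: abs_mult mult_left_le_one_le)
    qed
    moreover have "(\<integral>x. box_bump n a c x * g x \<partial>lebesgue) = 0" for n
    proof -
      have "(\<integral>x. f x * box_bump n a c x \<partial>lebesgue_on \<Omega>) = (\<integral>x. box_bump n a c x * g x \<partial>lebesgue)"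
        by (subst integral_restrict_space[OF S]) (simp add: g_def mult_ac)
      then show ?thesis using zero[OF box_bump_test_function[OF sub]] by simp
    qed
    ultimately have "(\<integral>x. indicator (box a c) x * g x \<partial>lebesgue) = 0" by (simp add: LIMSEQ_const_iff)
    then have "(LINT x:box a c|lebesgue. g x) = 0" by (simp add: set_lebesgue_integral_def)
    then show ?thesis
      using set_lebesgue_integral_eq_integral(2)[OF g_set[of "box a c"]] integral_open_interval[of a c g] by simp
  qed
  have "g integrable_on cbox a c" for a c
    by (rule set_lebesgue_integral_eq_integral(1)[OF g_set]) simp
  from integrable_ccontinuous_explicit[OF this] obtain N where N: "negligible N"
    "\<And>x e. x \<notin> N \<Longrightarrow> 0 < e \<Longrightarrow> \<exists>d>0. \<forall>h. 0 < h \<and> h < d \<longrightarrow>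
       norm (integral (cbox x (x + h *\<^sub>R One)) g /\<^sub>R h ^ DIM('a) - g x) < e"
    by blast
  have g0: "g x = 0" if x: "x \<in> \<Omega>" "x \<notin> N" for x
  proof (rule ccontr)
    assume "g x \<noteq> 0"
    then obtain d where d: "d > 0" "\<And>h. 0 < h \<and> h < d \<longrightarrow>
       norm (integral (cbox x (x + h *\<^sub>R One)) g /\<^sub>R h ^ DIM('a) - g x) < \<bar>g x\<bar>"
      using N(2)[OF x(2), of "\<bar>g x\<bar>"] by auto
    obtain r where r: "r > 0" "ball x r \<subseteq> \<Omega>" using \<Omega>(1) x(1) open_contains_ball by blast
    \<comment> \<open>A cube at \<open>x\<close> with side below \<open>d\<close> whose diameter
      keeps it inside the ball of radius \<open>r\<close>.\<close>
    define h where "h = min (d / 2) (r / (norm (One::'a) + 1) / 2)"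
    have No: "norm (One::'a) + 1 > 0" using norm_ge_zero[of "One::'a"] by linarith
    have h: "0 < h" "h < d" using d(1) r(1) No by (auto simp: h_def)
    have "h \<le> r / (norm (One::'a) + 1) / 2" by (simp add: h_def)
    then have hr: "h * (norm (One::'a) + 1) \<le> r / 2" using No by (simp add: field_simps)
    have "cbox x (x + h *\<^sub>R One) \<subseteq> \<Omega>"
    proof
      fix y assume y: "y \<in> cbox x (x + h *\<^sub>R One)"
      have "norm (y - x) \<le> norm (h *\<^sub>R (One::'a))"
        by (rule norm_le_componentwise) (use y h in \<open>auto simp: mem_box inner_diff_left inner_add_left\<close>)
      also have "\<dots> = h * norm (One::'a)" using h by simp
      also have "\<dots> < r" using hr h r(1) by (simp add: distrib_left)
      finally show "y \<in> \<Omega>" using r(2) by (auto simp: dist_norm norm_minus_commute)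
    qed
    then show False using d(2)[of h] h box0 by simp
  qed
  have "AE x in lebesgue. x \<notin> N" using N(1) by (simp add: negligible_iff_null_sets AE_not_in)
  then have "AE x in lebesgue. x \<in> \<Omega> \<longrightarrow> f x = 0"
    by eventually_elim (use g0 in \<open>auto simp: g_def\<close>)
  then show ?thesis by (simp add: AE_restrict_space_iff[OF S])
qed

text \<open>Tested against any test function, each component of the chosen weak gradient gives zero,
  so the gradient vanishes almost everywhere. This is what injectivity of the embedding comes down
  to, the elements being functions and not classes.\<close>

lemma H1_norm_eq_0:
  fixes u :: "'a::euclidean_space \<Rightarrow> real"
  assumes \<Omega>: "open \<Omega>" "bounded \<Omega>" and u: "u \<in> H1 \<Omega>" and zero: "AE x in lebesgue_on \<Omega>. u x = 0"
  shows "H1_norm \<Omega> u = 0"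
proof -
  let ?v = "weak_gradient \<Omega> u"
  note v = H1_weak_gradient[OF u]
  have "AE x in lebesgue_on \<Omega>. ?v x \<bullet> b = 0" if b: "b \<in> Basis" for b
  proof (rule fundamental_lemma[OF \<Omega> L2_on_inner[OF v(1)]])
    show "norm b = 1" using b by simp
    fix \<psi> assume \<psi>: "\<psi> \<in> test_functions \<Omega>"
    have "(\<integral>x. u x * frechet_derivative \<psi> (at x) b \<partial>lebesgue_on \<Omega>) = (\<integral>x. 0 \<partial>lebesgue_on \<Omega>)"
    proof (rule integral_cong_AE)
      have "u \<in> borel_measurable (lebesgue_on \<Omega>)" using H1_L2_on[OF u] by (simp add: L2_on_def)
      then show "(\<lambda>x. u x * frechet_derivative \<psi> (at x) b) \<in> borel_measurable (lebesgue_on \<Omega>)"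
        by (intro borel_measurable_times test_function_lebesgue_on(1)[OF \<Omega>(1) test_function_deriv[OF \<psi>]])
    qed (use zero in auto)
    then show "(\<integral>x. (?v x \<bullet> b) * \<psi> x \<partial>lebesgue_on \<Omega>) = 0"
      using v(2) \<psi> b by (simp add: has_weak_gradient_def)
  qed
  then have "AE x in lebesgue_on \<Omega>. \<forall>b\<in>Basis. ?v x \<bullet> b = 0"
    by (intro AE_finite_allI) auto
  then have "AE x in lebesgue_on \<Omega>. (norm (?v x))\<^sup>2 = 0"
    by eventually_elim (auto simp: euclidean_all_zero_iff)
  then have "(\<integral>x. (norm (?v x))\<^sup>2 \<partial>lebesgue_on \<Omega>) = 0" by (simp add: integral_eq_zero_AE)
  moreover have "(\<integral>x. (u x)\<^sup>2 \<partial>lebesgue_on \<Omega>) = 0"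
    by (rule integral_eq_zero_AE) (use zero in auto)
  ultimately show ?thesis by (simp add: H1_norm_def)
qed

section \<open>Invariant functions\<close>

lemma orbit_eq_orb: "orbit G x = compact_endo_group.orb (matrix_endo ` G) x"
  if "compact_orthogonal_group G"
proof -
  interpret compact_matrix_group "matrix_endo ` G" by (rule compact_orthogonal_group_endo[OF that])
  show ?thesis by (simp add: orbit_def orb_def image_image)
qed

lemma orbit_dim_eq:
  assumes "compact_orthogonal_group G"
  shows "orbit_dim G x = dim (compact_endo_group.tangent (matrix_endo ` G) x)"
proof -
  interpret compact_matrix_group "matrix_endo ` G" by (rule compact_orthogonal_group_endo[OF assms])
  show ?thesis by (simp add: orbit_dim_def orbit_eq_orb[OF assms] the_submanifold_dim)
qed

lemma orbit_dim_le:
  fixes G :: "(real^'m^'m) set"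
  assumes "compact_orthogonal_group G"
  shows "orbit_dim G x \<le> CARD('m)"
  using dim_subset_UNIV[of "compact_endo_group.tangent (matrix_endo ` G) x"] by (simp add: orbit_dim_eq[OF assms])

lemma orbit_packing:
  fixes G :: "(real^'m^'m) set"
  assumes G: "compact_orthogonal_group G" and K: "compact K" "\<forall>p\<in>K. k \<le> orbit_dim G p"
  shows "\<exists>c>0. \<exists>r0>0. \<forall>x r. x \<in> K \<longrightarrow> 0 < r \<longrightarrow> r < r0 \<longrightarrow> (\<exists>J. finite J \<and> J \<subseteq> G \<and> c / r ^ k \<le> real (card J) \<and>
      (\<forall>g\<in>J. \<forall>h\<in>J. g \<noteq> h \<longrightarrow> 2 * r \<le> dist (g *v x) (h *v x)))"
proof -
  interpret compact_matrix_group "matrix_endo ` G" by (rule compact_orthogonal_group_endo[OF G])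
  have dims: "k \<le> dim (tangent p)" if "p \<in> K" for p using K(2) that by (simp add: orbit_dim_eq[OF G])
  have "\<exists>c>0. \<exists>r0>0. \<forall>x r. x \<in> K \<longrightarrow> 0 < r \<longrightarrow> r < r0 \<longrightarrow> (\<exists>J. finite J \<and> J \<subseteq> matrix_endo ` G \<and>
      c / r ^ k \<le> real (card J) \<and> (\<forall>a\<in>J. \<forall>b\<in>J. a \<noteq> b \<longrightarrow> 2 * r \<le> dist (endo_apply a x) (endo_apply b x)))"
  proof (rule uniform_orbit_separated_points[OF K(1) dims])
    fix c r0 :: real assume "c > 0" "r0 > 0"
      and *: "\<And>x r. x \<in> K \<Longrightarrow> 0 < r \<Longrightarrow> r < r0 \<Longrightarrow> \<exists>J. finite J \<and> J \<subseteq> matrix_endo ` G \<and> c / r ^ k \<le> real (card J) \<and>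
      (\<forall>a\<in>J. \<forall>b\<in>J. a \<noteq> b \<longrightarrow> 2 * r \<le> dist (endo_apply a x) (endo_apply b x))"
    then show "\<exists>c>0. \<exists>r0>0. \<forall>x r. x \<in> K \<longrightarrow> 0 < r \<longrightarrow> r < r0 \<longrightarrow> (\<exists>J. finite J \<and> J \<subseteq> matrix_endo ` G \<and>
      c / r ^ k \<le> real (card J) \<and> (\<forall>a\<in>J. \<forall>b\<in>J. a \<noteq> b \<longrightarrow> 2 * r \<le> dist (endo_apply a x) (endo_apply b x)))"
      by (intro exI[of _ c] exI[of _ r0] conjI allI impI)
  qed
  then obtain c r0 where *: "c > 0" "r0 > 0"
    "\<forall>x r. x \<in> K \<longrightarrow> 0 < r \<longrightarrow> r < r0 \<longrightarrow> (\<exists>J. finite J \<and> J \<subseteq> matrix_endo ` G \<and> c / r ^ k \<le> real (card J) \<and>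
      (\<forall>a\<in>J. \<forall>b\<in>J. a \<noteq> b \<longrightarrow> 2 * r \<le> dist (endo_apply a x) (endo_apply b x)))"
    by (elim exE conjE)
  have "\<exists>J. finite J \<and> J \<subseteq> G \<and> c / r ^ k \<le> real (card J) \<and>
      (\<forall>g\<in>J. \<forall>h\<in>J. g \<noteq> h \<longrightarrow> 2 * r \<le> dist (g *v x) (h *v x))" if x: "x \<in> K" "0 < r" "r < r0" for x r
  proof -
    obtain J where J: "finite J" "J \<subseteq> matrix_endo ` G" "c / r ^ k \<le> real (card J)"
      "\<forall>a\<in>J. \<forall>b\<in>J. a \<noteq> b \<longrightarrow> 2 * r \<le> dist (endo_apply a x) (endo_apply b x)"
      using *(3)[rule_format, OF x] by (elim exE conjE)
    \<comment> \<open>One matrix is chosen for each endomorphism in \<open>J\<close>; distinct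
      endomorphisms receive distinct matrices because \<open>matrix_endo\<close> recovers them, so
      the count is preserved.\<close>
    define s where "s = inv_into G (matrix_endo :: real^'m^'m \<Rightarrow> _)"
    have s: "s a \<in> G" "matrix_endo (s a) = a" if "a \<in> J" for a
      using that J(2) unfolding s_def by (auto intro: inv_into_into f_inv_into_f)
    have "inj_on s J" by (rule inj_on_inverseI[of _ matrix_endo]) (rule s(2))
    then have "card (s ` J) = card J" by (rule card_image)
    moreover have "2 * r \<le> dist (s a *v x) (s b *v x)" if "a \<in> J" "b \<in> J" "s a \<noteq> s b" for a b
    proof -
      have "2 * r \<le> dist (endo_apply (matrix_endo (s a)) x) (endo_apply (matrix_endo (s b)) x)"
        using J(4) that by (auto simp only: s(2))
      then show ?thesis by simp
    qed
    ultimately show ?thesis using J(1,3) s(1) by (intro exI[of _ "s ` J"]) auto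
  qed
  then show ?thesis using *(1,2) by (intro exI[of _ c] exI[of _ r0] conjI allI impI)
qed

text \<open>Uniqueness of translation-invariant measures in one line of Fubini: with \<open>g\<close> the indicator of
  the unit ball, \<open>\<integral>f(Tx) dx \<integral>g dy = \<integral>\<integral>f(Tx) g(Tx + y) dy dx = \<integral>\<integral>f(Tx - y) g(Tx) dx dy = \<integral>g dx \<integral>f dy\<close>.\<close>

lemma nn_integral_linear_isometry:
  fixes T :: "'a::euclidean_space \<Rightarrow> 'a"
  assumes T: "linear T" "\<And>x. norm (T x) = norm x" and f[measurable]: "f \<in> borel_measurable borel"
  shows "(\<integral>\<^sup>+x. f (T x) \<partial>lborel) = (\<integral>\<^sup>+x. f x \<partial>lborel)"
proof -
  have [measurable]: "T \<in> borel_measurable borel"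
    using T(1) by (intro borel_measurable_continuous_onI linear_continuous_on) (simp add: linear_conv_bounded_linear)
  define B where "B = ball (0::'a) 1"
  have [measurable]: "B \<in> sets borel" by (simp add: B_def)
  have TB: "T x \<in> B \<longleftrightarrow> x \<in> B" for x by (simp add: B_def T(2))
  have "inj T"
  proof (rule injI)
    fix x y assume "T x = T y"
    then have "norm (x - y) = 0" using T(2)[of "x - y"] by (simp add: linear_diff[OF T(1)])
    then show "x = y" by simp
  qed
  then have surj: "surj T" using linear_injective_imp_surjective[OF T(1)] by blast
  define V where "V = emeasure lborel B"
  have V: "V \<noteq> 0" "V \<noteq> top"
  proof -
    have p: "unit_ball_vol (real DIM('a)) > 0" by (rule unit_ball_vol_pos) simp
    show "V \<noteq> 0" "V \<noteq> top" using p by (simp_all add: V_def B_def emeasure_ball order.strict_implies_not_eq[OF p, THEN not_sym])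
  qed
  have gT: "(\<integral>\<^sup>+y. indicator B (c + y) \<partial>lborel) = V" for c :: 'a
    by (subst nn_integral_translate[of "indicator B"]) (auto simp: V_def)
  have reflect: "(\<integral>\<^sup>+y. f (c - y) \<partial>lborel) = (\<integral>\<^sup>+y. f y \<partial>lborel)" for c
  proof -
    have "distr lborel borel (\<lambda>y. c - y) = lborel"
      using lborel_affine[of "-1" c] by (simp add: density_1)
    then have "(\<integral>\<^sup>+y. f y \<partial>lborel) = (\<integral>\<^sup>+y. f y \<partial>(distr lborel borel (\<lambda>y. c - y)))" by simp
    also have "\<dots> = (\<integral>\<^sup>+y. f (c - y) \<partial>lborel)" by (subst nn_integral_distr) auto
    finally show ?thesis by simp
  qed
  \<comment> \<open>Because \<open>T\<close> is onto, adding \<open>y\<close> after \<open>T\<close>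
    is a translation by a preimage \<open>y'\<close> before \<open>T\<close>.\<close>
  have shift: "(\<integral>\<^sup>+x. f (T x) * indicator B (T x + y) \<partial>lborel) = (\<integral>\<^sup>+x. f (T x - y) * indicator B (T x) \<partial>lborel)" for y
  proof -
    obtain y' where y': "y = T y'" using surj by blast
    have "(\<integral>\<^sup>+x. f (T x - y) * indicator B (T x) \<partial>lborel) = (\<integral>\<^sup>+x. f (T (y' + x) - y) * indicator B (T (y' + x)) \<partial>lborel)"
      by (rule nn_integral_translate[symmetric]) measurable
    also have "\<dots> = (\<integral>\<^sup>+x. f (T x) * indicator B (T x + y) \<partial>lborel)"
      by (simp add: y' linear_add[OF T(1)] add.commute)
    finally show ?thesis by simp
  qed
  have "(\<integral>\<^sup>+x. f (T x) \<partial>lborel) * V = (\<integral>\<^sup>+x. f (T x) * (\<integral>\<^sup>+y. indicator B (T x + y) \<partial>lborel) \<partial>lborel)"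
    by (simp add: gT nn_integral_multc)
  also have "\<dots> = (\<integral>\<^sup>+x. \<integral>\<^sup>+y. f (T x) * indicator B (T x + y) \<partial>lborel \<partial>lborel)"
    by (intro nn_integral_cong nn_integral_cmult[symmetric]) measurable
  also have "\<dots> = (\<integral>\<^sup>+y. \<integral>\<^sup>+x. f (T x) * indicator B (T x + y) \<partial>lborel \<partial>lborel)"
    by (rule lborel_pair.Fubini'[symmetric]) measurable
  also have "\<dots> = (\<integral>\<^sup>+y. \<integral>\<^sup>+x. f (T x - y) * indicator B (T x) \<partial>lborel \<partial>lborel)"
    by (simp only: shift)
  also have "\<dots> = (\<integral>\<^sup>+x. \<integral>\<^sup>+y. f (T x - y) * indicator B (T x) \<partial>lborel \<partial>lborel)"
    by (rule lborel_pair.Fubini') measurable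
  also have "\<dots> = (\<integral>\<^sup>+x. (\<integral>\<^sup>+y. f (T x - y) \<partial>lborel) * indicator B (T x) \<partial>lborel)"
    by (intro nn_integral_cong nn_integral_multc) measurable
  also have "\<dots> = (\<integral>\<^sup>+x. (\<integral>\<^sup>+y. f y \<partial>lborel) * indicator B x \<partial>lborel)"
    by (simp add: reflect indicator_def TB)
  also have "\<dots> = (\<integral>\<^sup>+y. f y \<partial>lborel) * V"
    by (simp add: nn_integral_cmult_indicator V_def)
  finally have eq: "V * (\<integral>\<^sup>+x. f (T x) \<partial>lborel) = V * (\<integral>\<^sup>+y. f y \<partial>lborel)"
    by (simp only: mult.commute)
  show ?thesis
    using ennreal_mult_le_mult_iff[OF V, of "\<integral>\<^sup>+x. f (T x) \<partial>lborel" "\<integral>\<^sup>+y. f y \<partial>lborel"]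
      ennreal_mult_le_mult_iff[OF V, of "\<integral>\<^sup>+y. f y \<partial>lborel" "\<integral>\<^sup>+x. f (T x) \<partial>lborel"]
    by (intro antisym) (simp_all only: eq order_refl)
qed

section \<open>The group action on the product domain\<close>

definition act :: "real^'m^'m \<Rightarrow> (real^'m) \<times> (real^2) \<Rightarrow> (real^'m) \<times> (real^2)" where
  "act g x = (g *v fst x, snd x)"

lemma act_continuous: "continuous_on S (act g)"
proof -
  have "bounded_linear (\<lambda>x::(real^'m) \<times> (real^2). (g *v fst x, snd x))" for g :: "real^'m^'m"
    by (intro bounded_linear_Pair bounded_linear_compose[OF matrix_vector_mul_bounded_linear] bounded_linear_fst bounded_linear_snd)
  then show ?thesis unfolding act_def[abs_def] by (rule linear_continuous_on)
qed

lemma act_borel [measurable]: "act g \<in> borel_measurable borel"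
  by (intro borel_measurable_continuous_onI act_continuous)

lemma dist_act:
  assumes "orthogonal_matrix g"
  shows "dist (act g x) (act g y) = dist x y"
proof -
  have "orthogonal_transformation ((*v) g)" using assms by (simp add: orthogonal_transformation_matrix)
  then have "dist (g *v fst x) (g *v fst y) = dist (fst x) (fst y)"
    using orthogonal_transformation_norm[of "(*v) g" "fst x - fst y"]
    by (simp add: dist_norm matrix_vector_mult_diff_distrib)
  then show ?thesis by (simp add: act_def dist_prod_def)
qed

lemma linear_act: "linear (act g)"
  by (intro linearI) (simp_all add: act_def matrix_vector_right_distrib matrix_vector_mult_scaleR)

lemma norm_act:
  assumes "orthogonal_matrix g"
  shows "norm (act g x) = norm x"
  using dist_act[OF assms, of x 0] linear_0[OF linear_act[of g]] by (simp add: dist_norm)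

lemma nn_integral_act:
  assumes "orthogonal_matrix g" "F \<in> borel_measurable borel"
  shows "(\<integral>\<^sup>+x. F (act g x) \<partial>lborel) = (\<integral>\<^sup>+x. F x \<partial>lborel)"
  by (rule nn_integral_linear_isometry[OF linear_act norm_act[OF assms(1)] assms(2)])

lemma distr_act:
  assumes "orthogonal_matrix g"
  shows "distr lborel borel (act g) = lborel"
proof (rule measure_eqI)
  fix A assume "A \<in> sets (distr lborel borel (act g))"
  then have [measurable]: "A \<in> sets borel" by simp
  have "emeasure (distr lborel borel (act g)) A = (\<integral>\<^sup>+x. indicator A x \<partial>(distr lborel borel (act g)))" by simp
  also have "\<dots> = (\<integral>\<^sup>+x. indicator A (act g x) \<partial>lborel)" by (subst nn_integral_distr) auto
  also have "\<dots> = (\<integral>\<^sup>+x. indicator A x \<partial>lborel)" by (rule nn_integral_act[OF assms]) simp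
  finally show "emeasure (distr lborel borel (act g)) A = emeasure lborel A" by simp
qed simp

lemma AE_act:
  assumes "orthogonal_matrix g" "AE x in lborel. P x"
  shows "AE x in lborel. P (act g x)"
proof (rule AE_distrD[of "act g" lborel borel])
  show "AE x in distr lborel borel (act g). P x" unfolding distr_act[OF assms(1)] by (rule assms(2))
qed simp

text \<open>The balls around the points \<open>act g x\<close>, \<open>g \<in> J\<close>, are disjoint and carry equal mass.\<close>

lemma packing_mass:
  fixes F :: "(real^'m) \<times> (real^2) \<Rightarrow> ennreal"
  assumes F[measurable]: "F \<in> borel_measurable borel"
    and J: "finite J" "\<And>g. g \<in> J \<Longrightarrow> orthogonal_matrix g" "\<And>g. g \<in> J \<Longrightarrow> AE y in lborel. F (act g y) = F y"
    and sep: "\<And>g h. g \<in> J \<Longrightarrow> h \<in> J \<Longrightarrow> g \<noteq> h \<Longrightarrow> 2 * r \<le> dist (g *v fst x) (h *v fst x)"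
  shows "of_nat (card J) * (\<integral>\<^sup>+y. F y * indicator (ball x r) y \<partial>lborel) \<le> (\<integral>\<^sup>+y. F y \<partial>lborel)"
proof -
  have [measurable]: "ball a r \<in> sets borel" for a :: "(real^'m) \<times> (real^2)" by simp
  have each: "(\<integral>\<^sup>+y. F y * indicator (ball x r) y \<partial>lborel) = (\<integral>\<^sup>+y. F y * indicator (ball (act g x) r) y \<partial>lborel)"
    if g: "g \<in> J" for g
  proof -
    have "(\<integral>\<^sup>+y. F y * indicator (ball (act g x) r) y \<partial>lborel) = (\<integral>\<^sup>+y. F (act g y) * indicator (ball (act g x) r) (act g y) \<partial>lborel)"
      by (rule nn_integral_act[OF J(2)[OF g], symmetric]) measurable
    also have "\<dots> = (\<integral>\<^sup>+y. F y * indicator (ball x r) y \<partial>lborel)"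
    proof (rule nn_integral_cong_AE, use J(3)[OF g] in eventually_elim)
      fix y assume "F (act g y) = F y"
      then show "F (act g y) * indicator (ball (act g x) r) (act g y) = F y * indicator (ball x r) y"
        by (simp add: indicator_def dist_act[OF J(2)[OF g]])
    qed
    finally show ?thesis by simp
  qed
  \<comment> \<open>A point in two of the balls would bring their centres within
    \<open>2 * r\<close>, while already the first components of the centres are that far
    apart.\<close>
  have disj: "(\<Sum>g\<in>J. indicator (ball (act g x) r) y) \<le> (1 :: ennreal)" for y
  proof (cases "\<exists>g\<in>J. y \<in> ball (act g x) r")
    case True
    then obtain g where g: "g \<in> J" "y \<in> ball (act g x) r" by blast
    have "indicator (ball (act h x) r) y = (if h = g then 1 else 0 :: ennreal)" if h: "h \<in> J" for h
    proof -
      have "y \<notin> ball (act h x) r" if "h \<noteq> g"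
      proof
        assume "y \<in> ball (act h x) r"
        then have "dist (act g x) (act h x) < 2 * r"
          using g(2) dist_triangle2[of "act g x" "act h x" y] by (simp add: dist_commute)
        moreover have "dist (g *v fst x) (h *v fst x) \<le> dist (act g x) (act h x)"
          using dist_fst_le[of "act g x" "act h x"] by (simp add: act_def)
        ultimately show False using sep[OF g(1) h] that by auto
      qed
      then show ?thesis using g(2) by auto
    qed
    then have "(\<Sum>h\<in>J. indicator (ball (act h x) r) y) = (\<Sum>h\<in>J. if h = g then 1 else 0 :: ennreal)" by (intro sum.cong) auto
    then show ?thesis using g(1) J(1) by simp
  next
    case False
    then have "(\<Sum>g\<in>J. indicator (ball (act g x) r) y) = (0 :: ennreal)" by (intro sum.neutral) auto
    then show ?thesis by simp
  qed
  have "of_nat (card J) * (\<integral>\<^sup>+y. F y * indicator (ball x r) y \<partial>lborel) = (\<Sum>g\<in>J. \<integral>\<^sup>+y. F y * indicator (ball (act g x) r) y \<partial>lborel)"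
    by (simp add: each[symmetric])
  also have "\<dots> = (\<integral>\<^sup>+y. (\<Sum>g\<in>J. F y * indicator (ball (act g x) r) y) \<partial>lborel)"
    by (rule nn_integral_sum[symmetric]) measurable
  also have "\<dots> \<le> (\<integral>\<^sup>+y. F y \<partial>lborel)"
  proof (rule nn_integral_mono)
    fix y
    have "(\<Sum>g\<in>J. F y * indicator (ball (act g x) r) y) = F y * (\<Sum>g\<in>J. indicator (ball (act g x) r) y)"
      by (simp add: sum_distrib_left)
    also have "\<dots> \<le> F y * 1" by (intro mult_left_mono disj) simp
    finally show "(\<Sum>g\<in>J. F y * indicator (ball (act g x) r) y) \<le> F y" by simp
  qed
  finally show ?thesis .
qed

section \<open>The family of invariant functions\<close>

text \<open>Shaped to fit \<open>concentrated_family\<close>: Borel functions on the whole space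
  with normalised bounds. Invariance holds almost everywhere for each group element separately,
  which suffices because a packing uses finitely many.\<close>

definition invariant_family ::
  "(real^'m^'m) set \<Rightarrow> ((real^'m) \<times> (real^2)) set \<Rightarrow> ((real^'m) \<times> (real^2) \<Rightarrow> real) set" where
  "invariant_family G \<Omega> = {w. w \<in> borel_measurable borel \<and> (\<forall>x. x \<notin> \<Omega> \<longrightarrow> w x = 0) \<and>
     (\<integral>\<^sup>+x. ennreal ((w x)\<^sup>2) \<partial>lborel) \<le> 1 \<and>
     (\<forall>z. (\<integral>\<^sup>+x. ennreal ((w (x + z) - w x)\<^sup>2) \<partial>lborel) \<le> ennreal ((norm z)\<^sup>2)) \<and>
     (\<forall>g\<in>G. AE x in lborel. w (act g x) = w x)}"

text \<open>The disjoint copies of a ball share the total mass equally, so one ball carries at most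
  the reciprocal of their number, \<open>r ^ k / c\<close>. This is why the constant passed to the
  locale is \<open>1 / c\<close>.\<close>

lemma invariant_family_concentrated:
  fixes G :: "(real^'m^'m) set"
  assumes G: "compact_orthogonal_group G" and K: "compact K" "\<forall>p\<in>K. k \<le> orbit_dim G p"
    and \<Omega>: "fst ` \<Omega> \<subseteq> K" and k: "k < CARD('m)"
  shows "\<exists>c r0. concentrated_family (invariant_family G \<Omega>) \<Omega> c r0 k"
proof -
  obtain c r0 where c: "c > 0" "r0 > 0"
    "\<forall>x r. x \<in> K \<longrightarrow> 0 < r \<longrightarrow> r < r0 \<longrightarrow> (\<exists>J. finite J \<and> J \<subseteq> G \<and> c / r ^ k \<le> real (card J) \<and>
      (\<forall>g\<in>J. \<forall>h\<in>J. g \<noteq> h \<longrightarrow> 2 * r \<le> dist (g *v x) (h *v x)))"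
    using orbit_packing[OF G K] by (elim exE conjE)
  have "concentrated_family (invariant_family G \<Omega>) \<Omega> (1 / c) r0 k"
  proof
    show "1 / c > 0" "r0 > 0" using c by auto
    show "k + 2 < DIM((real^'m) \<times> (real^2))" using k by simp
    fix u assume u: "u \<in> invariant_family G \<Omega>"
    then show [measurable]: "u \<in> borel_measurable borel" by (simp add: invariant_family_def)
    show "u x = 0" if "x \<notin> \<Omega>" for x using u that unfolding invariant_family_def by blast
    show "(\<integral>\<^sup>+x. ennreal ((u x)\<^sup>2) \<partial>lborel) \<le> 1" using u by (simp add: invariant_family_def)
    show "(\<integral>\<^sup>+x. ennreal ((u (x + z) - u x)\<^sup>2) \<partial>lborel) \<le> ennreal ((norm z)\<^sup>2)" for z
      using u unfolding invariant_family_def by blast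
    fix x and r p :: real assume x: "x \<in> \<Omega>" and r: "0 < r" "r < r0" and "1 \<le> p"
    define F where "F y = ennreal (\<bar>u y\<bar> powr p)" for y
    have [measurable]: "F \<in> borel_measurable borel" unfolding F_def by measurable
    have fstK: "fst x \<in> K" using x \<Omega> by auto
    obtain J where J: "finite J" "J \<subseteq> G" "c / r ^ k \<le> real (card J)"
      "\<forall>g\<in>J. \<forall>h\<in>J. g \<noteq> h \<longrightarrow> 2 * r \<le> dist (g *v fst x) (h *v fst x)"
      using c(3)[rule_format, OF fstK r] by (elim exE conjE)
    have inv: "AE y in lborel. F (act g y) = F y" if "g \<in> J" for g
    proof -
      have "AE y in lborel. u (act g y) = u y" using u that J(2) by (auto simp: invariant_family_def)
      then show ?thesis by eventually_elim (simp add: F_def)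
    qed
    have orth: "orthogonal_matrix g" if "g \<in> J" for g
      using G that J(2) by (auto simp: compact_orthogonal_group_def)
    let ?I = "\<integral>\<^sup>+y. F y * indicator (ball x r) y \<partial>lborel"
    have "of_nat (card J) * ?I \<le> (\<integral>\<^sup>+y. F y \<partial>lborel)"
      by (rule packing_mass[OF _ J(1) orth inv]) (use J(4) in auto)
    then have 1: "ennreal (c / r ^ k) * ?I \<le> (\<integral>\<^sup>+y. F y \<partial>lborel)"
      using mult_right_mono[OF ennreal_leI[OF J(3)], of ?I] by (simp add: ennreal_of_nat_eq_real_of_nat)
    have "?I = ennreal (1 / c * r ^ k) * (ennreal (c / r ^ k) * ?I)"
      using c(1) r(1) by (simp add: mult.assoc[symmetric] flip: ennreal_mult)
    also have "\<dots> \<le> ennreal (1 / c * r ^ k) * (\<integral>\<^sup>+y. F y \<partial>lborel)" by (intro mult_left_mono 1) simp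
    finally show "(\<integral>\<^sup>+y. ennreal (\<bar>u y\<bar> powr p) * indicator (ball x r) y \<partial>lborel)
        \<le> ennreal (1 / c * r ^ k) * (\<integral>\<^sup>+y. ennreal (\<bar>u y\<bar> powr p) \<partial>lborel)"
      by (simp add: F_def)
  qed
  then show ?thesis by blast
qed

text \<open>Division by \<open>2 * S\<close> absorbs the factor \<open>4\<close> of
  \<open>H10_shift\<close>. A bound \<open>S > 0\<close> replaces the norm itself, which may be
  zero, and lets a whole sequence be scaled alike.\<close>

lemma H1sG_scaled:
  fixes G :: "(real^'m^'m) set"
  assumes G: "compact_orthogonal_group G" and \<Omega>: "open \<Omega>" "\<And>g x. g \<in> G \<Longrightarrow> act g x \<in> \<Omega> \<longleftrightarrow> x \<in> \<Omega>"
    and u: "u \<in> H1sG G \<Omega>" and S: "S > 0" "H1_norm \<Omega> u \<le> S"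
  shows "\<exists>w\<in>invariant_family G \<Omega>. AE x in lborel. 2 * S * w x = indicator \<Omega> x * u x"
proof -
  have u10: "u \<in> H10 \<Omega>" using u by (simp add: H1sG_def H1s_def)
  then have uL2: "u \<in> L2_on \<Omega>" by (simp add: H10_def H1_L2_on)
  obtain f where f[measurable]: "f \<in> borel_measurable borel" and f0: "\<And>x. x \<notin> \<Omega> \<Longrightarrow> f x = 0"
    and f_eq: "AE x in lborel. f x = indicator \<Omega> x * u x"
    using ex_borel_representative[OF \<Omega>(1), of u] uL2 by (auto simp: L2_on_def)
  have SS: "(H1_norm \<Omega> u)\<^sup>2 \<le> S\<^sup>2" using S H1_norm_nonneg by (intro power_mono) auto
  define w where "w x = f x / (2 * S)" for x
  have [measurable]: "w \<in> borel_measurable borel" unfolding w_def by measurable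
  have w_sq: "ennreal ((a / (2 * S))\<^sup>2) = ennreal (1 / (4 * S\<^sup>2)) * ennreal (a\<^sup>2)" for a
    by (simp add: power_divide power_mult_distrib flip: ennreal_mult)
  have "(\<integral>\<^sup>+x. ennreal ((w x)\<^sup>2) \<partial>lborel) = ennreal (1 / (4 * S\<^sup>2)) * (\<integral>\<^sup>+x. ennreal ((f x)\<^sup>2) \<partial>lborel)"
    unfolding w_def w_sq by (rule nn_integral_cmult) measurable
  also have "\<dots> \<le> ennreal (1 / (4 * S\<^sup>2)) * ennreal (S\<^sup>2)"
    unfolding L2_borel_representative[OF \<Omega>(1) uL2 f_eq]
    by (intro mult_left_mono ennreal_leI order_trans[OF H1_norm_ge(1) SS]) simp
  also have "\<dots> = ennreal (1 / 4)" using S(1) by (simp flip: ennreal_mult)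
  also have "\<dots> \<le> 1" using ennreal_leI[of "1 / 4" 1] by simp
  finally have w1: "(\<integral>\<^sup>+x. ennreal ((w x)\<^sup>2) \<partial>lborel) \<le> 1" .
  have w2: "(\<integral>\<^sup>+x. ennreal ((w (x + z) - w x)\<^sup>2) \<partial>lborel) \<le> ennreal ((norm z)\<^sup>2)" for z
  proof -
    have "w (x + z) - w x = (f (x + z) - f x) / (2 * S)" for x by (simp add: w_def diff_divide_distrib)
    then have "(\<integral>\<^sup>+x. ennreal ((w (x + z) - w x)\<^sup>2) \<partial>lborel) = (\<integral>\<^sup>+x. ennreal (1 / (4 * S\<^sup>2)) * ennreal ((f (x + z) - f x)\<^sup>2) \<partial>lborel)"
      by (simp only: w_sq)
    also have "\<dots> = ennreal (1 / (4 * S\<^sup>2)) * (\<integral>\<^sup>+x. ennreal ((f (x + z) - f x)\<^sup>2) \<partial>lborel)"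
      by (rule nn_integral_cmult) measurable
    also have "\<dots> \<le> ennreal (1 / (4 * S\<^sup>2)) * ennreal (4 * (norm z)\<^sup>2 * S\<^sup>2)"
      by (intro mult_left_mono order_trans[OF H10_shift[OF \<Omega>(1) u10 f f_eq]] ennreal_leI SS) auto
    also have "\<dots> = ennreal ((norm z)\<^sup>2)" using S(1) by (simp flip: ennreal_mult)
    finally show ?thesis .
  qed
  have w3: "AE x in lborel. w (act g x) = w x" if g: "g \<in> G" for g
  proof -
    have orth: "orthogonal_matrix g" using G g by (auto simp: compact_orthogonal_group_def)
    have "AE x in lebesgue_on \<Omega>. u (act g x) = u x" using u g by (auto simp: H1sG_def act_def)
    moreover have "\<Omega> \<inter> space lebesgue \<in> sets lebesgue" using \<Omega>(1) by auto
    ultimately have "AE x in lebesgue. x \<in> \<Omega> \<longrightarrow> u (act g x) = u x" by (simp add: AE_restrict_space_iff)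
    then have 1: "AE x in lborel. x \<in> \<Omega> \<longrightarrow> u (act g x) = u x" by (simp add: AE_completion_iff)
    \<comment> \<open>The exceptional set is transported by the measure-preserving action; off the
      domain both sides vanish, as the domain is invariant.\<close>
    have "AE x in lborel. f (act g x) = f x"
      using 1 f_eq AE_act[OF orth f_eq]
    proof eventually_elim
      case (elim x)
      then show ?case using \<Omega>(2)[OF g, of x] by (auto simp: indicator_def)
    qed
    then show ?thesis by eventually_elim (simp add: w_def)
  qed
  have "w \<in> invariant_family G \<Omega>"
    using w1 w2 w3 f0 by (simp add: invariant_family_def) (simp add: w_def)
  moreover have "AE x in lborel. 2 * S * w x = indicator \<Omega> x * u x"
    using f_eq by eventually_elim (use S(1) in \<open>simp add: w_def\<close>)
  ultimately show ?thesis by blast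
qed

section \<open>The exponent and the weight\<close>

text \<open>Replacing the minimum by \<open>1 / d\<close> brings both terms over the denominator
  \<open>m d (d + 1)\<close>; with \<open>m = d + k\<close> the numerator factors as
  \<open>2 (d + 1) (1 - k)\<close>.\<close>

lemma psi_nonpos:
  assumes "1 \<le> k" "k < m" "N = m + 2"
  shows "psi N m k l \<le> 0"
proof -
  define d where "d = real m - real k"
  have d: "d > 0" using assms(2) by (simp add: d_def)
  have m: "real m = d + real k" by (simp add: d_def)
  have m0: "real m > 0" using assms by simp
  have dk: "d + real k > 0" using d by simp
  have N: "real N - real k = d + 2" using assms(3) by (simp add: d_def)
  have "2 * (real m + 1) / (real m * (d + 1)) * min l (1 / d) \<le> 2 * (real m + 1) / (real m * (d + 1)) * (1 / d)"
    using d m0 by (intro mult_left_mono) auto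
  then have "psi N m k l \<le> - (2 * real k * (d + 2)) / (real m * d * (d + 1)) + 2 * (real m + 1) / (real m * (d + 1)) * (1 / d)"
    unfolding psi_def N d_def[symmetric] by simp
  also have "\<dots> = (2 * (real m + 1) - 2 * real k * (d + 2)) / (real m * d * (d + 1))"
    by (simp add: diff_divide_distrib mult_ac)
  also have "2 * (real m + 1) - 2 * real k * (d + 2) = 2 * ((d + 1) * (1 - real k))"
    unfolding m by (simp add: algebra_simps)
  also have "2 * ((d + 1) * (1 - real k)) / (real m * d * (d + 1)) \<le> 0"
    using d m0 assms(1) by (intro divide_nonpos_pos) (auto simp: mult_nonneg_nonpos)
  finally show ?thesis .
qed

lemma weighted_Lq_bound:
  fixes u :: "'a::euclidean_space \<Rightarrow> real"
  assumes \<Omega>: "open \<Omega>" and u: "u \<in> borel_measurable (lebesgue_on \<Omega>)" and f: "AE x in lborel. f x = indicator \<Omega> x * u x"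
    and h: "h \<in> borel_measurable borel" "\<forall>x\<in>\<Omega>. 0 \<le> h x \<and> h x \<le> H" "H \<ge> 0"
    and b: "(\<integral>\<^sup>+x. ennreal (\<bar>f x\<bar> powr q) \<partial>lborel) \<le> ennreal B" "B \<ge> 0"
  shows "u \<in> weighted_Lq h q \<Omega>"
    and "(\<integral>x. h x * \<bar>u x\<bar> powr q \<partial>lebesgue_on \<Omega>) \<le> H * B"
    and "0 \<le> (\<integral>x. h x * \<bar>u x\<bar> powr q \<partial>lebesgue_on \<Omega>)"
proof -
  let ?M = "lebesgue_on \<Omega>"
  note [measurable] = u borel_lebesgue_on[OF h(1), of \<Omega>]
  have space: "x \<in> space ?M \<Longrightarrow> x \<in> \<Omega>" for x by simp
  have "(\<integral>\<^sup>+x. ennreal (h x * \<bar>u x\<bar> powr q) \<partial>?M) \<le> (\<integral>\<^sup>+x. ennreal H * ennreal (\<bar>u x\<bar> powr q) \<partial>?M)"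
    using h by (intro nn_integral_mono) (auto simp: ennreal_leI mult_right_mono simp flip: ennreal_mult)
  also have "\<dots> = ennreal H * (\<integral>\<^sup>+x. ennreal (\<bar>u x\<bar> powr q) \<partial>?M)" by (rule nn_integral_cmult) measurable
  also have "(\<integral>\<^sup>+x. ennreal (\<bar>u x\<bar> powr q) \<partial>?M) = (\<integral>\<^sup>+x. ennreal (\<bar>f x\<bar> powr q) \<partial>lborel)"
    using nn_integral_borel_representative[OF \<Omega> f, of "\<lambda>t. \<bar>t\<bar> powr q"] by simp
  also have "ennreal H * \<dots> \<le> ennreal H * ennreal B" by (intro mult_left_mono b(1)) simp
  also have "\<dots> = ennreal (H * B)" using h(3) b(2) by (intro ennreal_mult[symmetric]) auto
  finally have le: "(\<integral>\<^sup>+x. ennreal (h x * \<bar>u x\<bar> powr q) \<partial>?M) \<le> ennreal (H * B)" .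
  have nonneg: "AE x in ?M. 0 \<le> h x * \<bar>u x\<bar> powr q" using h(2) by (intro AE_I2) auto
  have int: "integrable ?M (\<lambda>x. h x * \<bar>u x\<bar> powr q)"
    by (rule integrableI_nonneg) (use nonneg le in \<open>auto intro: le_less_trans\<close>)
  then show "u \<in> weighted_Lq h q \<Omega>" using u by (simp add: weighted_Lq_def)
  show nn: "0 \<le> (\<integral>x. h x * \<bar>u x\<bar> powr q \<partial>?M)" by (rule integral_nonneg_AE[OF nonneg])
  have "ennreal (\<integral>x. h x * \<bar>u x\<bar> powr q \<partial>?M) \<le> ennreal (H * B)"
    using le nn_integral_eq_integral[OF int nonneg] by simp
  then show "(\<integral>x. h x * \<bar>u x\<bar> powr q \<partial>?M) \<le> H * B"
    using h(3) b(2) by (subst (asm) ennreal_le_iff) auto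
qed

lemma nn_integral_powr_scale:
  assumes [measurable]: "w \<in> borel_measurable borel" and "S > 0"
  shows "(\<integral>\<^sup>+x. ennreal (\<bar>2 * S * w x\<bar> powr q) \<partial>lborel) = ennreal ((2 * S) powr q) * (\<integral>\<^sup>+x. ennreal (\<bar>w x\<bar> powr q) \<partial>lborel)"
proof -
  have "ennreal (\<bar>2 * S * w x\<bar> powr q) = ennreal ((2 * S) powr q) * ennreal (\<bar>w x\<bar> powr q)" for x
    using assms(2) by (simp add: abs_mult powr_mult flip: ennreal_mult)
  then show ?thesis by (simp add: nn_integral_cmult)
qed

section \<open>The compact embedding\<close>

text \<open>The weight is seen through two properties: its upper bound \<open>H\<close> gives
  continuity and compactness, its positivity almost everywhere gives injectivity.\<close>

locale symmetric_embedding =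
  fixes G :: "(real^'m^'m) set" and \<Omega> :: "((real^'m) \<times> (real^2)) set"
    and h :: "(real^'m) \<times> (real^2) \<Rightarrow> real" and H q c r0 :: real and k :: nat
  assumes G: "compact_orthogonal_group G" and \<Omega>: "open \<Omega>" "bounded \<Omega>"
    and act_\<Omega>: "\<And>g x. g \<in> G \<Longrightarrow> act g x \<in> \<Omega> \<longleftrightarrow> x \<in> \<Omega>"
    and conc: "concentrated_family (invariant_family G \<Omega>) \<Omega> c r0 k"
    and h: "h \<in> borel_measurable borel" "\<forall>x\<in>\<Omega>. 0 \<le> h x \<and> h x \<le> H" "H \<ge> 0"
    and h_pos: "AE x in lborel. x \<in> \<Omega> \<longrightarrow> h x > 0"
    and q: "q > 1" "q < 2 * (real (CARD('m) + 2) - real k) / (real (CARD('m) + 2) - real k - 2)"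
begin

sublocale concentrated_family "invariant_family G \<Omega>" \<Omega> c r0 k by (rule conc)

lemma n_eq: "n = real (CARD('m) + 2) - real k"
  by (simp add: n_def)

lemma q_less: "q < 2 * n / (n - 2)"
  using q(2) by (simp add: n_eq)

lemma \<Omega>_borel: "\<Omega> \<in> sets borel" using \<Omega>(1) by simp

text \<open>\<open>Lq_bound\<close> covers exponents from \<open>2\<close> on, whereas
  \<open>q\<close> may be smaller. Finite measure of the domain allows the descent from a larger
  subcritical \<open>p\<close>.\<close>

lemma family_bound:
  obtains B where "B > 0" "\<And>w. w \<in> invariant_family G \<Omega> \<Longrightarrow> (\<integral>\<^sup>+x. ennreal (\<bar>w x\<bar> powr q) \<partial>lborel) \<le> ennreal B"
proof -
  have "2 < 2 * n / (n - 2)" using n_gt by (simp add: field_simps)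
  then obtain p where p: "max q 2 < p" "p < 2 * n / (n - 2)" using q_less dense[of "max q 2"] by auto
  obtain K where K: "K > 0" "\<And>w. w \<in> invariant_family G \<Omega> \<Longrightarrow> (\<integral>\<^sup>+x. ennreal (\<bar>w x\<bar> powr p) \<partial>lborel) \<le> ennreal K"
    using Lq_bound[of p] p by auto
  have "emeasure lborel \<Omega> < \<infinity>" by (rule emeasure_bounded_finite[OF \<Omega>(2)])
  then obtain M where M: "emeasure lborel \<Omega> = ennreal M" "M \<ge> 0"
    by (cases "emeasure lborel \<Omega>" rule: ennreal_cases) auto
  have "(\<integral>\<^sup>+x. ennreal (\<bar>w x\<bar> powr q) \<partial>lborel) \<le> ennreal (M + K)" if w: "w \<in> invariant_family G \<Omega>" for w
  proof -
    note [measurable] = meas[OF w] \<Omega>_borel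
    have "(\<integral>\<^sup>+x. ennreal (\<bar>w x\<bar> powr q) \<partial>lborel) \<le> (\<integral>\<^sup>+x. indicator \<Omega> x + ennreal (\<bar>w x\<bar> powr p) \<partial>lborel)"
    proof (rule nn_integral_mono)
      fix x
      show "ennreal (\<bar>w x\<bar> powr q) \<le> indicator \<Omega> x + ennreal (\<bar>w x\<bar> powr p)"
      proof (cases "x \<in> \<Omega>")
        case True
        have "\<bar>w x\<bar> powr q \<le> 1 + \<bar>w x\<bar> powr p"
        proof (cases "\<bar>w x\<bar> \<le> 1")
          case True
          then have "\<bar>w x\<bar> powr q \<le> 1" using powr_mono2[of q "\<bar>w x\<bar>" 1] q(1) by simp
          then show ?thesis using powr_ge_zero[of "\<bar>w x\<bar>" p] by linarith
        next
          case False
          then have "\<bar>w x\<bar> powr q \<le> \<bar>w x\<bar> powr p" using p(1) by (intro powr_mono) auto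
          then show ?thesis by simp
        qed
        then have "ennreal (\<bar>w x\<bar> powr q) \<le> ennreal (1 + \<bar>w x\<bar> powr p)" by (rule ennreal_leI)
        then show ?thesis using True by (simp add: ennreal_plus)
      next
        case False
        then show ?thesis using supp[OF w] by simp
      qed
    qed
    also have "\<dots> = ennreal M + (\<integral>\<^sup>+x. ennreal (\<bar>w x\<bar> powr p) \<partial>lborel)"
      by (subst nn_integral_add) (auto simp: M(1))
    also have "\<dots> \<le> ennreal M + ennreal K" by (intro add_left_mono K(2) w)
    finally show ?thesis using M(2) K(1) by (simp add: ennreal_plus)
  qed
  then show thesis using M(2) K(1) by (intro that[of "M + K"]) auto
qed

lemma H1sG_measurable: "u \<in> H1sG G \<Omega> \<Longrightarrow> u \<in> borel_measurable (lebesgue_on \<Omega>)"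
  by (simp add: H1sG_def H1s_def H10_def H1_def L2_on_def)

lemma H1sG_H1: "u \<in> H1sG G \<Omega> \<Longrightarrow> u \<in> H1 \<Omega>"
  by (simp add: H1sG_def H1s_def H10_def)

lemma embedding_bound:
  obtains C where "\<And>u. u \<in> H1sG G \<Omega> \<Longrightarrow> u \<in> weighted_Lq h q \<Omega> \<and> weighted_Lq_norm h q \<Omega> u \<le> C * H1_norm \<Omega> u"
proof -
  obtain B where B: "B > 0" "\<And>w. w \<in> invariant_family G \<Omega> \<Longrightarrow> (\<integral>\<^sup>+x. ennreal (\<bar>w x\<bar> powr q) \<partial>lborel) \<le> ennreal B"
    by (rule family_bound) blast
  define C where "C = 2 * (H * B) powr (1 / q)"
  have main: "u \<in> weighted_Lq h q \<Omega> \<and> weighted_Lq_norm h q \<Omega> u \<le> C * S"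
    if u: "u \<in> H1sG G \<Omega>" and S: "S > 0" "H1_norm \<Omega> u \<le> S" for u S
  proof -
    obtain w where w: "w \<in> invariant_family G \<Omega>" "AE x in lborel. 2 * S * w x = indicator \<Omega> x * u x"
      using H1sG_scaled[OF G \<Omega>(1) act_\<Omega> u S] by blast
    have "(\<integral>\<^sup>+x. ennreal (\<bar>2 * S * w x\<bar> powr q) \<partial>lborel) \<le> ennreal ((2 * S) powr q) * ennreal B"
      unfolding nn_integral_powr_scale[OF meas[OF w(1)] S(1)] by (intro mult_left_mono B(2) w(1)) simp
    also have "\<dots> = ennreal ((2 * S) powr q * B)" using B(1) by (intro ennreal_mult[symmetric]) auto
    finally have le: "(\<integral>\<^sup>+x. ennreal (\<bar>2 * S * w x\<bar> powr q) \<partial>lborel) \<le> ennreal ((2 * S) powr q * B)" .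
    note W = weighted_Lq_bound[OF \<Omega>(1) H1sG_measurable[OF u] w(2) h le]
    have nn: "0 \<le> (2 * S) powr q * B" using B(1) by simp
    have "weighted_Lq_norm h q \<Omega> u \<le> (H * ((2 * S) powr q * B)) powr (1 / q)"
      unfolding weighted_Lq_norm_def using q(1) W(2,3)[OF nn] by (intro powr_mono2) auto
    also have "\<dots> = ((2 * S) powr q) powr (1 / q) * (H * B) powr (1 / q)"
      using h(3) B(1) by (simp add: mult_ac flip: powr_mult)
    also have "\<dots> = C * S" using q(1) S(1) by (simp add: C_def powr_powr)
    finally show ?thesis using W(1)[OF nn] by simp
  qed
  have C0: "C \<ge> 0" by (simp add: C_def)
  have "u \<in> weighted_Lq h q \<Omega> \<and> weighted_Lq_norm h q \<Omega> u \<le> C * H1_norm \<Omega> u" if u: "u \<in> H1sG G \<Omega>" for u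
  proof
    \<comment> \<open>The scaling needs a positive bound, but the norm may be zero; a positive
      \<open>e\<close> is added and removed at the end.\<close>
    have pos: "H1_norm \<Omega> u + e > 0" if "e > 0" for e using H1_norm_nonneg[of \<Omega> u] that by linarith
    show "u \<in> weighted_Lq h q \<Omega>" using main[OF u pos[of 1]] by simp
    show "weighted_Lq_norm h q \<Omega> u \<le> C * H1_norm \<Omega> u"
    proof (rule field_le_epsilon)
      fix e :: real assume e: "e > 0"
      define e' where "e' = e / (C + 1)"
      have e': "e' > 0" using e C0 by (simp add: e'_def)
      have "weighted_Lq_norm h q \<Omega> u \<le> C * (H1_norm \<Omega> u + e')"
        using main[OF u pos[OF e']] e' by simp
      also have "\<dots> = C * H1_norm \<Omega> u + C * e'" by (simp add: distrib_left)
      also have "C * e' \<le> e"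
      proof -
        have "C * e' \<le> (C + 1) * e'" using e' by (intro mult_right_mono) auto
        also have "\<dots> = e" using C0 by (simp add: e'_def)
        finally show ?thesis .
      qed
      finally show "weighted_Lq_norm h q \<Omega> u \<le> C * H1_norm \<Omega> u + e" by simp
    qed
  qed
  then show thesis by (rule that)
qed

text \<open>Almost everywhere positivity of the weight forces \<open>u\<close> to vanish almost
  everywhere, and then the gradient part of the norm vanishes too.\<close>

lemma weighted_Lq_norm_eq_0:
  assumes u: "u \<in> H1sG G \<Omega>" and zero: "weighted_Lq_norm h q \<Omega> u = 0"
  shows "H1_norm \<Omega> u = 0"
proof (rule H1_norm_eq_0[OF \<Omega> H1sG_H1[OF u]])
  have W: "u \<in> weighted_Lq h q \<Omega>" using embedding_bound u by metis
  then have int: "integrable (lebesgue_on \<Omega>) (\<lambda>x. h x * \<bar>u x\<bar> powr q)" by (simp add: weighted_Lq_def)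
  have nonneg: "AE x in lebesgue_on \<Omega>. 0 \<le> h x * \<bar>u x\<bar> powr q" using h(2) by (intro AE_I2) auto
  have "(\<integral>x. h x * \<bar>u x\<bar> powr q \<partial>lebesgue_on \<Omega>) = 0" using zero by (simp add: weighted_Lq_norm_def)
  then have "AE x in lebesgue_on \<Omega>. h x * \<bar>u x\<bar> powr q = 0"
    using integral_nonneg_eq_0_iff_AE[OF int nonneg] by simp
  moreover have "AE x in lebesgue_on \<Omega>. h x > 0"
  proof -
    have "\<Omega> \<inter> space lebesgue \<in> sets lebesgue" using \<Omega>(1) by auto
    then show ?thesis using AE_completion[OF h_pos] by (simp add: AE_restrict_space_iff)
  qed
  ultimately show "AE x in lebesgue_on \<Omega>. u x = 0" by eventually_elim auto
qed

lemma compact_subsequence: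
  fixes u :: "nat \<Rightarrow> (real^'m) \<times> (real^2) \<Rightarrow> real"
  assumes u: "\<And>i. u i \<in> H1sG G \<Omega>" and bound: "bounded (range (\<lambda>i. H1_norm \<Omega> (u i)))"
  shows "\<exists>w\<in>weighted_Lq h q \<Omega>. \<exists>r :: nat \<Rightarrow> nat. strict_mono r \<and> (\<lambda>i. weighted_Lq_norm h q \<Omega> (\<lambda>x. u (r i) x - w x)) \<longlonglongrightarrow> 0"
proof -
  obtain S0 where S0: "\<And>i. \<bar>H1_norm \<Omega> (u i)\<bar> \<le> S0" using bound by (auto simp: bounded_iff)
  \<comment> \<open>One positive scale for the whole sequence, so that limits of the scaled
    functions scale back.\<close>
  define S where "S = \<bar>S0\<bar> + 1"
  have S: "S > 0" "H1_norm \<Omega> (u i) \<le> S" for i using S0[of i] by (auto simp: S_def)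
  have "\<forall>i. \<exists>w. w \<in> invariant_family G \<Omega> \<and> (AE x in lborel. 2 * S * w x = indicator \<Omega> x * u i x)"
    using H1sG_scaled[OF G \<Omega>(1) act_\<Omega> u S] by blast
  from choice[OF this] obtain w where
    "\<forall>i. w i \<in> invariant_family G \<Omega> \<and> (AE x in lborel. 2 * S * w i x = indicator \<Omega> x * u i x)"
    by (elim exE)
  then have w: "w i \<in> invariant_family G \<Omega>" "AE x in lborel. 2 * S * w i x = indicator \<Omega> x * u i x" for i
    by auto
  have q0: "q > 0" using q(1) by simp
  obtain r :: "nat \<Rightarrow> nat" where r: "strict_mono r"
    "\<forall>\<epsilon>>0. \<exists>N. \<forall>i\<ge>N. \<forall>j\<ge>N. (\<integral>\<^sup>+x. ennreal (\<bar>w (r i) x - w (r j) x\<bar> powr q) \<partial>lborel) \<le> ennreal \<epsilon>"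
    using Lq_Cauchy_subsequence[of w q, OF \<Omega>_borel \<Omega>(2) w(1) q0 q_less] by (elim exE conjE)
  have wr: "w (r i) \<in> borel_measurable borel" for i by (rule meas[OF w(1)])
  obtain v where v[measurable]: "v \<in> borel_measurable borel"
    and v_lim: "\<forall>\<epsilon>>0. \<exists>N. \<forall>i\<ge>N. (\<integral>\<^sup>+x. ennreal (\<bar>w (r i) x - v x\<bar> powr q) \<partial>lborel) \<le> ennreal \<epsilon>"
    using Lq_complete[of q "\<lambda>i. w (r i)", OF q0 wr r(2)] by (elim bexE)
  note [measurable] = wr
  define W where "W x = 2 * S * v x" for x
  \<comment> \<open>The completeness argument has not shown that \<open>v\<close> vanishes off the
    domain, hence the cut-off.\<close>
  define f where "f x = indicator \<Omega> x * W x" for x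
  have W_meas: "W \<in> borel_measurable (lebesgue_on \<Omega>)"
    unfolding W_def by (intro borel_lebesgue_on) measurable
  have f_AE: "AE x in lborel. f x = indicator \<Omega> x * W x" by (simp add: f_def)
  have diff_AE: "AE x in lborel. indicator \<Omega> x * (2 * S * (w (r i) x - v x)) = indicator \<Omega> x * (u (r i) x - W x)" for i
    using w(2)[of "r i"] by eventually_elim (auto simp: indicator_def W_def right_diff_distrib split: if_splits)
  have diff_le: "(\<integral>\<^sup>+x. ennreal (\<bar>indicator \<Omega> x * (2 * S * (w (r i) x - v x))\<bar> powr q) \<partial>lborel) \<le> ennreal ((2 * S) powr q * \<epsilon>)"
    if "(\<integral>\<^sup>+x. ennreal (\<bar>w (r i) x - v x\<bar> powr q) \<partial>lborel) \<le> ennreal \<epsilon>" "\<epsilon> \<ge> 0" for i \<epsilon>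
  proof -
    have "(\<integral>\<^sup>+x. ennreal (\<bar>indicator \<Omega> x * (2 * S * (w (r i) x - v x))\<bar> powr q) \<partial>lborel) \<le> (\<integral>\<^sup>+x. ennreal (\<bar>2 * S * (w (r i) x - v x)\<bar> powr q) \<partial>lborel)"
      by (intro nn_integral_mono) (auto simp: indicator_def)
    also have "\<dots> = ennreal ((2 * S) powr q) * (\<integral>\<^sup>+x. ennreal (\<bar>w (r i) x - v x\<bar> powr q) \<partial>lborel)"
      by (rule nn_integral_powr_scale[OF _ S(1)]) measurable
    also have "\<dots> \<le> ennreal ((2 * S) powr q) * ennreal \<epsilon>" by (intro mult_left_mono that(1)) simp
    also have "\<dots> = ennreal ((2 * S) powr q * \<epsilon>)" using that(2) by (intro ennreal_mult[symmetric]) auto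
    finally show ?thesis .
  qed
  have diff_meas: "(\<lambda>x. u (r i) x - W x) \<in> borel_measurable (lebesgue_on \<Omega>)" for i
    using H1sG_measurable[OF u] W_meas by (intro borel_measurable_diff)
  define I where "I i = (\<integral>x. h x * \<bar>u (r i) x - W x\<bar> powr q \<partial>lebesgue_on \<Omega>)" for i
  have I_le: "0 \<le> I i \<and> I i \<le> H * ((2 * S) powr q * \<epsilon>)"
    if "(\<integral>\<^sup>+x. ennreal (\<bar>w (r i) x - v x\<bar> powr q) \<partial>lborel) \<le> ennreal \<epsilon>" "\<epsilon> \<ge> 0" for i \<epsilon>
    using weighted_Lq_bound(2,3)[OF \<Omega>(1) diff_meas diff_AE h diff_le[OF that]] that(2) by (simp add: I_def)
  have "I \<longlonglongrightarrow> 0"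
  proof (rule LIMSEQ_I)
    fix e :: real assume e: "e > 0"
    \<comment> \<open>The summand \<open>1\<close> keeps the divisor positive even if
      \<open>H = 0\<close>.\<close>
    define A where "A = H * (2 * S) powr q + 1"
    have A: "A > 0" using h(3) by (auto simp: A_def intro!: add_nonneg_pos)
    define \<epsilon> where "\<epsilon> = e / (2 * A)"
    have \<epsilon>: "\<epsilon> > 0" using e A by (simp add: \<epsilon>_def)
    obtain N where N: "\<forall>i\<ge>N. (\<integral>\<^sup>+x. ennreal (\<bar>w (r i) x - v x\<bar> powr q) \<partial>lborel) \<le> ennreal \<epsilon>"
      using v_lim[rule_format, OF \<epsilon>] by (elim exE)
    have "norm (I i - 0) < e" if "i \<ge> N" for i
    proof -
      have "0 \<le> I i \<and> I i \<le> H * ((2 * S) powr q * \<epsilon>)"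
        by (rule I_le) (use N that \<epsilon> in auto)
      moreover have "H * ((2 * S) powr q * \<epsilon>) \<le> A * \<epsilon>" using \<epsilon> by (simp add: A_def algebra_simps)
      moreover have "A * \<epsilon> = e / 2" using A by (simp add: \<epsilon>_def)
      ultimately show ?thesis using e by auto
    qed
    then show "\<exists>N. \<forall>i\<ge>N. norm (I i - 0) < e" by (intro exI[of _ N]) simp
  qed
  moreover have "0 \<le> I i" for i unfolding I_def using h(2) by (intro integral_nonneg_AE AE_I2) auto
  ultimately have "(\<lambda>i. I i powr (1 / q)) \<longlonglongrightarrow> 0 powr (1 / q)"
    using q0 by (intro tendsto_powr' tendsto_const) auto
  then have lim: "(\<lambda>i. weighted_Lq_norm h q \<Omega> (\<lambda>x. u (r i) x - W x)) \<longlonglongrightarrow> 0"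
    by (simp add: weighted_Lq_norm_def I_def[abs_def])
  have "W \<in> weighted_Lq h q \<Omega>"
  proof -
    obtain B where B: "B > 0" "\<And>w. w \<in> invariant_family G \<Omega> \<Longrightarrow> (\<integral>\<^sup>+x. ennreal (\<bar>w x\<bar> powr q) \<partial>lborel) \<le> ennreal B"
      by (rule family_bound) blast
    obtain N where "\<forall>i\<ge>N. (\<integral>\<^sup>+x. ennreal (\<bar>w (r i) x - v x\<bar> powr q) \<partial>lborel) \<le> ennreal 1"
      using v_lim[rule_format, of 1] by auto
    then have N: "(\<integral>\<^sup>+x. ennreal (\<bar>w (r N) x - v x\<bar> powr q) \<partial>lborel) \<le> ennreal 1" by simp
    \<comment> \<open>A limit need not belong to \<open>invariant_family\<close>; its integrability
      comes from one member of the sequence at distance at most \<open>1\<close>.\<close>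
    have v_int: "(\<integral>\<^sup>+x. ennreal (\<bar>v x\<bar> powr q) \<partial>lborel) \<le> ennreal (2 powr q * (B + 1))"
    proof -
      have "(\<integral>\<^sup>+x. ennreal (\<bar>v x\<bar> powr q) \<partial>lborel) \<le> (\<integral>\<^sup>+x. ennreal (2 powr q) * (ennreal (\<bar>w (r N) x\<bar> powr q) + ennreal (\<bar>w (r N) x - v x\<bar> powr q)) \<partial>lborel)"
      proof (rule nn_integral_mono)
        fix x
        have "\<bar>v x\<bar> powr q \<le> 2 powr q * (\<bar>w (r N) x\<bar> powr q + \<bar>w (r N) x - v x\<bar> powr q)"
          using powr_diff_le[of q "w (r N) x" "w (r N) x - v x"] q0 by simp
        then show "ennreal (\<bar>v x\<bar> powr q) \<le> ennreal (2 powr q) * (ennreal (\<bar>w (r N) x\<bar> powr q) + ennreal (\<bar>w (r N) x - v x\<bar> powr q))"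
          by (simp add: ennreal_leI flip: ennreal_plus ennreal_mult)
      qed
      also have "\<dots> = ennreal (2 powr q) * ((\<integral>\<^sup>+x. ennreal (\<bar>w (r N) x\<bar> powr q) \<partial>lborel) + (\<integral>\<^sup>+x. ennreal (\<bar>w (r N) x - v x\<bar> powr q) \<partial>lborel))"
        by (subst nn_integral_cmult, measurable, subst nn_integral_add, measurable)
      also have "\<dots> \<le> ennreal (2 powr q) * (ennreal B + ennreal 1)"
        by (intro mult_left_mono add_mono B(2) w(1) N) auto
      also have "\<dots> = ennreal (2 powr q * (B + 1))" using B(1) by (simp flip: ennreal_plus ennreal_mult ennreal_1)
      finally show ?thesis .
    qed
    have "(\<integral>\<^sup>+x. ennreal (\<bar>f x\<bar> powr q) \<partial>lborel) \<le> (\<integral>\<^sup>+x. ennreal (\<bar>2 * S * v x\<bar> powr q) \<partial>lborel)"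
      by (intro nn_integral_mono) (auto simp: f_def W_def indicator_def)
    also have "\<dots> = ennreal ((2 * S) powr q) * (\<integral>\<^sup>+x. ennreal (\<bar>v x\<bar> powr q) \<partial>lborel)"
      by (rule nn_integral_powr_scale[OF v S(1)])
    also have "\<dots> \<le> ennreal ((2 * S) powr q) * ennreal (2 powr q * (B + 1))" by (intro mult_left_mono v_int) simp
    also have "\<dots> = ennreal ((2 * S) powr q * (2 powr q * (B + 1)))" using B(1) by (intro ennreal_mult[symmetric]) auto
    finally show ?thesis
      by (rule weighted_Lq_bound(1)[OF \<Omega>(1) W_meas f_AE h]) (use B(1) in simp)
  qed
  then show ?thesis using r(1) lim by blast
qed

lemma embedding_compact:
  "compactly_embedded (H1sG G \<Omega>) (H1_norm \<Omega>) (weighted_Lq h q \<Omega>) (weighted_Lq_norm h q \<Omega>)"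
proof -
  obtain C where C: "\<And>u. u \<in> H1sG G \<Omega> \<Longrightarrow> u \<in> weighted_Lq h q \<Omega> \<and> weighted_Lq_norm h q \<Omega> u \<le> C * H1_norm \<Omega> u"
    by (rule embedding_bound) blast
  show ?thesis
    unfolding compactly_embedded_def
  proof (intro conjI allI impI)
    show "H1sG G \<Omega> \<subseteq> weighted_Lq h q \<Omega>" using C by blast
    show "\<exists>C. \<forall>u\<in>H1sG G \<Omega>. weighted_Lq_norm h q \<Omega> u \<le> C * H1_norm \<Omega> u" using C by blast
    show "\<forall>u\<in>H1sG G \<Omega>. weighted_Lq_norm h q \<Omega> u = 0 \<longrightarrow> H1_norm \<Omega> u = 0" using weighted_Lq_norm_eq_0 by blast
    fix u :: "nat \<Rightarrow> (real^'m) \<times> (real^2) \<Rightarrow> real"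
    assume "(\<forall>i. u i \<in> H1sG G \<Omega>) \<and> bounded (range (\<lambda>i. H1_norm \<Omega> (u i)))"
    then show "\<exists>w\<in>weighted_Lq h q \<Omega>. \<exists>r. strict_mono r \<and> (\<lambda>i. weighted_Lq_norm h q \<Omega> (\<lambda>x. u (r i) x - w x)) \<longlonglongrightarrow> 0"
      by (intro compact_subsequence) auto
  qed
qed

end

theorem theorem1p2:
  fixes \<Omega>1 :: "(real^'m) set" and \<Omega>2 :: "(real^2) set" and \<Omega> :: "((real^'m) \<times> (real^2)) set"
    and G :: "(real^'m^'m) set" and h :: "(real^'m) \<times> (real^2) \<Rightarrow> real"
    and m N k :: nat and R l q :: real
  assumes "m = CARD('m)" and "m \<ge> 2" and "N = m + 2"
    and "bounded \<Omega>1" and "C1_open_set \<Omega>1"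
    and "R > 0" and "\<Omega>2 = ball 0 R"
    and "\<Omega> = \<Omega>1 \<times> \<Omega>2"
    and "compact_orthogonal_group G"
    and "\<forall>g\<in>G. \<forall>x\<in>\<Omega>1. g *v x \<in> \<Omega>1"
    and "\<exists>x \<in> closure \<Omega>1. orbit_dim G x = k"
    and "\<forall>x \<in> closure \<Omega>1. k \<le> orbit_dim G x"
    and "k \<ge> 1"
    and "l > 0" and "h = (\<lambda>(x1, x2). norm x2 powr l)"
    and "1 < q" and "q < crit_exp N k + psi N m k l"
  shows "compactly_embedded (H1sG G \<Omega>) (H1_norm \<Omega>) (weighted_Lq h q \<Omega>) (weighted_Lq_norm h q \<Omega>)"
proof -
  have "k \<le> m" using assms(1,11) orbit_dim_le[OF assms(9)] by auto
  moreover have "k \<noteq> m"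
  proof
    assume "k = m"
    then have "crit_exp N k = 0" "psi N m k l = 0" using assms(3,14) by (simp_all add: crit_exp_def psi_def)
    then show False using assms(16,17) by simp
  qed
  ultimately have km: "k < m" by simp
  have q_lt: "q < 2 * (real (CARD('m) + 2) - real k) / (real (CARD('m) + 2) - real k - 2)"
    using assms(17) psi_nonpos[OF assms(13) km assms(3), of l] unfolding crit_exp_def assms(1,3) by linarith
  have h_eq: "h x = norm (snd x) powr l" for x by (simp add: assms(15) case_prod_beta)
  have open\<Omega>: "open \<Omega>" using assms(5,7,8) by (auto simp: C1_open_set_def intro: open_Times)
  have bounded\<Omega>: "bounded \<Omega>" using assms(4,7,8) by (auto intro: bounded_Times)
  have act_in: "act g x \<in> \<Omega>" if "g \<in> G" "x \<in> \<Omega>" for g x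
    using that assms(8,10) by (auto simp: act_def)
  have act_iff: "act g x \<in> \<Omega> \<longleftrightarrow> x \<in> \<Omega>" if g: "g \<in> G" for g x
  proof
    \<comment> \<open>Invariance is assumed in one direction; the inverse matrix, which lies in
      \<open>G\<close>, gives the other.\<close>
    assume gx: "act g x \<in> \<Omega>"
    have inv: "matrix_inv g \<in> G" "orthogonal_matrix g" using assms(9) g by (auto simp: compact_orthogonal_group_def)
    then have "invertible g" unfolding orthogonal_matrix_def invertible_def by blast
    then have "matrix_inv g ** g = mat 1" unfolding invertible_def matrix_inv_def by (rule someI2_ex) simp
    then have "act (matrix_inv g) (act g x) = x" by (simp add: act_def matrix_vector_mul_assoc)
    then show "x \<in> \<Omega>" using act_in[OF inv(1) gx] by simp
  qed (rule act_in[OF g])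
  have K: "compact (closure \<Omega>1)" using assms(4) by (simp add: compact_closure)
  have "fst ` \<Omega> \<subseteq> closure \<Omega>1" using assms(8) closure_subset by fastforce
  from invariant_family_concentrated[OF assms(9) K assms(12) this km[unfolded assms(1)]]
  obtain c r0 where conc: "concentrated_family (invariant_family G \<Omega>) \<Omega> c r0 k" by blast
  have h_pos: "AE x in lborel. x \<in> \<Omega> \<longrightarrow> h x > 0"
  proof -
    \<comment> \<open>The weight vanishes only where the second component is zero, and this set lies
      in the hyperplane orthogonal to \<open>a\<close>, which is negligible.\<close>
    define a :: "(real^'m) \<times> (real^2)" where "a = (0, axis 1 1)"
    have "a \<noteq> 0" by (simp add: a_def zero_prod_def axis_eq_0_iff)
    then have "negligible {x. a \<bullet> x = 0}" by (intro negligible_hyperplane) simp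
    then have "AE x in lebesgue. x \<notin> {x. a \<bullet> x = 0}" by (intro AE_not_in) (simp add: negligible_iff_null_sets)
    then have "AE x in lborel. x \<notin> {x. a \<bullet> x = 0}" by (simp only: AE_completion_iff)
    then show ?thesis
    proof eventually_elim
      case (elim x)
      then have "snd x \<noteq> 0" by (auto simp: a_def inner_prod_def)
      then show ?case by (simp add: h_eq)
    qed
  qed
  interpret symmetric_embedding G \<Omega> h "R powr l" q c r0 k
  proof
    show "h \<in> borel_measurable borel" unfolding h_eq[abs_def]
      by (intro borel_measurable_continuous_onI continuous_on_powr' continuous_intros) (use assms(14) in auto)
    have "h x \<le> R powr l" if "x \<in> \<Omega>" for x
      unfolding h_eq using that assms(7,8,14) by (intro powr_mono2) (auto simp: dist_norm)
    then show "\<forall>x\<in>\<Omega>. 0 \<le> h x \<and> h x \<le> R powr l" by (simp add: h_eq)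
  qed (use assms(9,16) open\<Omega> bounded\<Omega> act_iff conc h_pos q_lt in \<open>auto simp: h_eq concentrated_family_def\<close>)
  show ?thesis by (rule embedding_compact)
qed

end
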